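(* Let $0<\beta\le 1$ and $0<s<1$. (i) Let $u\in C^{0,\beta}(\mathbb{R})$ and $2s<\beta$. Then $$\|(-\Delta_h)^s(r_hu)-r_h((-\Delta)^su)\|_{\ell^\infty}\leq C[u]_{C^{0,\beta}(\mathbb{R})}h^{\beta-2s}.$$ (ii) Let $u\in C^{1,\beta}(\mathbb{R})$ and $2s<\beta$. Then $$\|D_+(-\Delta_h)^s(r_hu)-r_h(\tfrac{d}{dx}(-\Delta)^su)\|_{\ell^\infty}\leq C[u]_{C^{1,\beta}(\mathbb{R})}h^{\beta-2s}.$$ (iii) Let $u\in C^{1,\beta}(\mathbb{R})$ and $2s>\beta$. Then $$\|(-\Delta_h)^s(r_hu)-r_h((-\Delta)^su)\|_{\ell^\infty}\leq C[u]_{C^{1,\beta}(\mathbb{R})}h^{\beta-2s+1}.$$ (iv) Let $u\in C^{k,\beta}(\mathbb{R})$ and assume that $k+\beta-2s$ is not an integer, with $2s<k+\beta$. Then $$\|D_+^l(-\Delta_h)^s(r_hu)-r_h(\tfrac{d^{l}}{dx^{l}}(-\Delta)^su)\|_{\ell^\infty}\leq C[u]_{C^{k,\beta}(\mathbb{R})}h^{\beta-2s+k-l},$$ where $l$ is the integer part of $k+\beta-2s$. The constants $C$ above depend only on $s$ and $\beta$, but not on $h$ or $u$.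
   Context: Mesh and restriction: for $h>0$, $\mathbb{Z}_h=\{hj:j\in\mathbb{Z}\}$; a function on $\mathbb{Z}_h$ is written as a sequence $u_j$, $j\in\mathbb{Z}$. For $u:\mathbb{R}\to\mathbb{R}$, its restriction to the mesh is $(r_hu)_j=u(hj)$. $\|v\|_{\ell^\infty}=\sup_{j\in\mathbb{Z}}|v_j|$. $\frac{d}{dx}$ is the standard derivative. $D_+u_j=\frac{u_{j+1}-u_j}{h}$ and $D_+^l$ is $D_+$ applied $l$ times ($D_+^0$ is the identity). Fractional discrete Laplacian: the discrete Laplacian is $\Delta_hu_j=\frac{1}{h^2}(u_{j+1}-2u_j+u_{j-1})$. Its heat semigroup is $e^{t\Delta_h}u_j=\sum_{m\in\mathbb{Z}}G(j-m,\tfrac{t}{h^2})u_m$, $t\ge0$, where $G(m,t)=e^{-2t}I_m(2t)$ and $I_m$ is the modified Bessel function of the first kind of order $m\in\mathbb{Z}$ (this is the solution $w_j(t)$ of $\partial_tw_j=\Delta_hw_j$, $w_j(0)=u_j$). For $0<s<1$, $$(-\Delta_h)^su_j=\frac{1}{\Gamma(-s)}\int_0^\infty\big(e^{t\Delta_h}u_j-u_j\big)\frac{dt}{t^{1+s}}.$$ Fractional Laplacian on $\mathbb{R}$: for $0<s<1$, $$(-\Delta)^su(x)=c_s\,\mathrm{P.V.}\int_{\mathbb{R}}\frac{u(x)-u(y)}{|x-y|^{1+2s}}\,dy,\qquad c_s=\frac{4^s\Gamma(1/2+s)}{\pi^{1/2}|\Gamma(-s)|}.$$ Hölder spaces: for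 an integer $k\ge0$ and $0<\beta\le1$, a continuous real function $u$ belongs to $C^{k,\beta}(\mathbb{R})$ if $u\in C^k(\mathbb{R})$ and $[u]_{C^{k,\beta}(\mathbb{R})}:=[u^{(k)}]_{C^{0,\beta}(\mathbb{R})}=\sup_{x\ne y}\frac{|u^{(k)}(x)-u^{(k)}(y)|}{|x-y|^\beta}<\infty$, where $u^{(k)}$ is the $k$-th derivative of $u$; the norm in $C^{k,\beta}(\mathbb{R})$ is $\sum_{l=0}^k\|u^{(l)}\|_{L^\infty(\mathbb{R})}+[u^{(k)}]_{C^{0,\beta}(\mathbb{R})}$.
   Formalization: In (iii), 2s<1+β is added: for 2s≥1+β the bound fails (e.g. u=cos, h=2πn if 2s>1+β). In (iv), C may also depend on k: a bound uniform in k is false (u=cos(ξx), lhξ=2π). For unbounded u, the truncated integrals defining (-Δ)^s u are assumed to exist. *)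

theory Defs
  imports "HOL-Analysis.Analysis"
begin

section \<open>Hoelder spaces on the real line\<close>

definition C_k :: "nat \<Rightarrow> (real \<Rightarrow> real) \<Rightarrow> bool" where
  "C_k k u \<longleftrightarrow>
     (\<forall>i<k. \<forall>x. ((deriv ^^ i) u) differentiable (at x)) \<and> continuous_on UNIV ((deriv ^^ k) u)"

definition holder_seminorm :: "nat \<Rightarrow> real \<Rightarrow> (real \<Rightarrow> real) \<Rightarrow> ereal" where
  "holder_seminorm k \<beta> u =
     (SUP (x, y) \<in> {(x, y). x \<noteq> y}.
        ereal (\<bar>(deriv ^^ k) u x - (deriv ^^ k) u y\<bar> / \<bar>x - y\<bar> powr \<beta>))"

definition holder_space :: "nat \<Rightarrow> real \<Rightarrow> (real \<Rightarrow> real) set" where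
  "holder_space k \<beta> = {u. C_k k u \<and> holder_seminorm k \<beta> u < \<infinity>}"

section \<open>The fractional Laplacian on the real line\<close>

definition frac_const :: "real \<Rightarrow> real" where
  "frac_const s = 4 powr s * Gamma (1/2 + s) / (pi powr (1/2) * \<bar>Gamma (-s)\<bar>)"

definition frac_laplacian :: "real \<Rightarrow> (real \<Rightarrow> real) \<Rightarrow> real \<Rightarrow> real" where
  "frac_laplacian s u x = frac_const s *
     Lim (at_right 0)
       (\<lambda>\<epsilon>. LINT y:{y. \<epsilon> < \<bar>x - y\<bar>}|lborel. (u x - u y) / \<bar>x - y\<bar> powr (1 + 2 * s))"

text \<open>
  Membership in \<^const>\<open>holder_space\<close> does not bound \<open>u\<close>, so the truncated integrals in
  \<^const>\<open>frac_laplacian\<close> may diverge at infinity; the Bochner integral would then silently be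
  \<open>0\<close>.  The following set consists of the functions for which all of them exist.  It contains
  every bounded continuous function, in particular every \<open>u\<close> whose Hoelder norm (the sum of the
  sup norms of \<open>u\<close>, ..., \<open>u^(k)\<close> and the seminorm) is finite; see the lemma below.
\<close>

definition frac_laplacian_dom :: "real \<Rightarrow> (real \<Rightarrow> real) set" where
  "frac_laplacian_dom s =
     {u. \<forall>x. \<forall>\<epsilon>>0. set_integrable lborel {y. \<epsilon> < \<bar>x - y\<bar>}
                       (\<lambda>y. (u x - u y) / \<bar>x - y\<bar> powr (1 + 2 * s))}"

section \<open>The mesh, and the fractional discrete Laplacian\<close>

text \<open>Functions on the mesh of size \<open>h\<close> are sequences indexed by the integers.\<close>

definition mesh_restrict :: "real \<Rightarrow> (real \<Rightarrow> real) \<Rightarrow> int \<Rightarrow> real" where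
  "mesh_restrict h u j = u (h * of_int j)"

definition linf_norm :: "(int \<Rightarrow> real) \<Rightarrow> ereal" where
  "linf_norm v = (SUP j. ereal \<bar>v j\<bar>)"

definition D_plus :: "real \<Rightarrow> (int \<Rightarrow> real) \<Rightarrow> int \<Rightarrow> real" where
  "D_plus h v j = (v (j + 1) - v j) / h"

text \<open>
  The series \<open>\<Sum>k. (x/2)\<^sup>2\<^sup>k\<^sup>+\<^sup>m / (k! \<Gamma>(m + k + 1))\<close>.  For negative \<open>m\<close> the reciprocal Gamma function
  annihilates the terms with \<open>k < -m\<close>, that is, the terms with \<open>m + k + 1 \<le> 0\<close>.
\<close>

definition bessel_I :: "int \<Rightarrow> real \<Rightarrow> real" where
  "bessel_I m x =
     (\<Sum>k. (x / 2) powi (2 * int k + m) * rGamma (of_int m + of_nat k + 1) / fact k)"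

definition heat_kernel :: "int \<Rightarrow> real \<Rightarrow> real" where
  "heat_kernel m t = exp (- 2 * t) * bessel_I m (2 * t)"

definition discrete_heat :: "real \<Rightarrow> real \<Rightarrow> (int \<Rightarrow> real) \<Rightarrow> int \<Rightarrow> real" where
  "discrete_heat h t v j = (\<Sum>\<^sub>\<infinity>m\<in>UNIV. heat_kernel (j - m) (t / h\<^sup>2) * v m)"

definition frac_discrete_laplacian :: "real \<Rightarrow> real \<Rightarrow> (int \<Rightarrow> real) \<Rightarrow> int \<Rightarrow> real" where
  "frac_discrete_laplacian s h v j =
     1 / Gamma (- s) * (LINT t:{0<..}|lborel. (discrete_heat h t v j - v j) / t powr (1 + s))"

lemma bounded_continuous_in_frac_laplacian_dom:
  assumes s: "0 < s" and u: "continuous_on UNIV u" and bnd: "\<And>x. \<bar>u x\<bar> \<le> B"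
  shows "u \<in> frac_laplacian_dom s"
proof -
  have "set_integrable lborel {y. \<epsilon> < \<bar>x - y\<bar>} (\<lambda>y. (u x - u y) / \<bar>x - y\<bar> powr (1 + 2 * s))"
    if e: "\<epsilon> > 0" for x \<epsilon> :: real
  proof -
    define g where "g = (\<lambda>y. indicator {\<epsilon>..} y * y powr (- (1 + 2 * s)) :: real)"
    have "((\<lambda>y. y powr (- (1 + 2 * s))) has_integral
            - (\<epsilon> powr (- (1 + 2 * s) + 1)) / (- (1 + 2 * s) + 1)) {\<epsilon>..}"
      using s e by (intro has_integral_powr_to_inf) auto
    then have "(\<lambda>y. y powr (- (1 + 2 * s))) absolutely_integrable_on {\<epsilon>..}"
      by (intro nonnegative_absolutely_integrable_1) (auto simp: integrable_on_def)
    then have "integrable lborel g"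
      unfolding set_integrable_def g_def
      by (subst (asm) integrable_completion) auto
    then have i: "integrable lborel (\<lambda>y. g (x + (-1) * y))" "integrable lborel (\<lambda>y. g (- x + 1 * y))"
      by (rule lborel_integrable_real_affine; simp)+
    have "integrable lborel (\<lambda>y. 2 * B * (g (x + (-1) * y) + g (- x + 1 * y)))"
      using i by (intro integrable_mult_right Bochner_Integration.integrable_add) auto
    moreover have [measurable]: "u \<in> borel_measurable borel"
      using u by (rule borel_measurable_continuous_onI)
    have "norm (indicat_real {y. \<epsilon> < \<bar>x - y\<bar>} y *\<^sub>R ((u x - u y) / \<bar>x - y\<bar> powr (1 + 2 * s)))
            \<le> norm (2 * B * (g (x + (-1) * y) + g (- x + 1 * y)))" for y
    proof (cases "\<epsilon> < \<bar>x - y\<bar>")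
      case True
      have "\<bar>u x - u y\<bar> \<le> 2 * B" "B \<ge> 0"
        using bnd[of x] bnd[of y] by linarith+
      moreover have "g (x + (-1) * y) + g (- x + 1 * y) = \<bar>x - y\<bar> powr (- (1 + 2 * s))"
        using True e by (cases "x \<ge> y") (auto simp: g_def indicator_def abs_if)
      moreover have "(u x - u y) / \<bar>x - y\<bar> powr (1 + 2 * s)
                       = (u x - u y) * \<bar>x - y\<bar> powr (- (1 + 2 * s))"
        by (simp only: powr_minus divide_inverse)
      ultimately show ?thesis
        using True by (simp add: mult_right_mono abs_mult)
    qed auto
    ultimately show ?thesis
      unfolding set_integrable_def
      by (elim Bochner_Integration.integrable_bound) (auto intro!: AE_I2)
  qed
  then show ?thesis by (auto simp: frac_laplacian_dom_def)
qed

end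

theory Submission
  imports Defs "HOL-Real_Asymp.Real_Asymp"
begin

text \<open>
  All four estimates are instances of one statement. Let \<open>l\<close> differences be taken, put
  \<open>m = k - l\<close> and assume \<open>2 s < m + \<beta> < 2 s + 1\<close>; then the error is at most
  \<open>C [u] h powr (m + \<beta> - 2 s)\<close>. Parts (i) and (iii) have \<open>l = 0\<close>, part (ii) has \<open>k = l = 1\<close>, and
  in part (iv) the bounds on \<open>m + \<beta> - 2 s = (k + \<beta> - 2 s) - l\<close> say that \<open>l\<close> is the integer part of the
  non-integer \<open>k + \<beta> - 2 s\<close>. Since \<open>0 < s < 1\<close>, only \<open>m = 0, 1, 2\<close> occur.

  Both operators integrate, or sum, the second difference
  \<open>S v x y = 2 v(x) - v(x + y) - v(x - y)\<close> against a positive weight, and the same constant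
  \<open>c = frac_const s\<close> appears in both:
  \<open>(-\<Delta>)^s v(x) = c \<integral>_0^\<infinity> S v x y / y^(1 + 2 s) dy\<close> and, for \<open>h = 1\<close>,
  \<open>(-\<Delta>_1)^s v(j) = c \<Sum>_(n \<ge> 1) \<rho>(n) S v j n\<close> with \<open>\<rho>(n) = \<Gamma>(n - s) / \<Gamma>(n + 1 + s)\<close>.
  The second formula is a computation: integrating the power series of the heat kernel against
  \<open>t^(-1 - s)\<close> term by term gives, after Legendre's duplication formula, a hypergeometric series at
  \<open>1\<close>, which Gauss's theorem evaluates (\<open>nn_integral_heat_kernel\<close>). A dilation reduces every mesh
  to the case \<open>h = 1\<close>.

  The comparison of the sum with the integral (\<open>sum_minus_integral_le\<close>) rests on three facts: the
  weight \<open>\<rho>(n)\<close> is \<open>n^(-1 - 2 s) + O(n^(-2 - 2 s))\<close>; the second difference is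
  \<open>O([v] y^(m + \<beta>))\<close>; and over an interval of unit length it varies by
  \<open>O([v] y^(m + \<beta> - 1))\<close> (by \<open>O([v])\<close> if \<open>m = 0\<close>). The resulting errors are summable because
  \<open>m + \<beta> < 1 + 2 s\<close> and \<open>s > 0\<close>. For \<open>m = 2\<close> the last two facts hold only after adding \<open>v''(x) y^2\<close>, and
  \<open>v''(x)\<close> is not controlled by the seminorm. The estimate survives because the quadratic term is
  treated exactly by the discrete operator: \<open>\<Sum> \<rho>(n) n^2\<close> telescopes, and its partial sums differ
  from \<open>\<integral> y^(1 - 2 s) dy\<close> by a null sequence, without a constant left over
  (\<open>square_sum_minus_integral_tendsto\<close>).

  Differences and derivatives pass through both operators onto \<open>u\<close>. By the mean value theorem for
  forward differences, \<open>D_+^l\<close> applied to \<open>x \<mapsto> S u x n\<close> is \<open>S (u^(l)) \<xi> n\<close> at a point \<open>\<xi>\<close> close to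
  \<open>x\<close>, and moving \<open>\<xi>\<close> to \<open>x\<close> costs again \<open>O([v] n^(m + \<beta> - 1))\<close> (or \<open>O([v])\<close>).

  Finally, \<open>u\<close> may be unbounded, so convergence needs an argument. On an interval of length \<open>3\<close> all
  derivatives up to order \<open>k\<close> are bounded by the integral of \<open>|u|\<close> plus the seminorm
  (\<open>derivatives_le_integral\<close>); as the truncated integrals of \<open>u\<close> exist, this gives a summable
  envelope for all of them (\<open>two_sided_envelope\<close>), which justifies the convergence of the sums and
  integrals and the differentiation under the integral sign.
\<close>

section \<open>Gauss's hypergeometric sum\<close>

lemma nn_integral_powr_exp:
  fixes a c :: real
  assumes "a > 0" "c > 0"
  shows "(\<integral>\<^sup>+t. ennreal (indicator {0<..} t * (t powr (a - 1) * exp (- (c * t)))) \<partial>lborel)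
           = ennreal (Gamma a / c powr a)"
proof -
  define J where "J = (\<integral>\<^sup>+t. ennreal (indicator {0<..} t * (t powr (a - 1) * exp (- (c * t)))) \<partial>lborel)"
  have "ennreal (Gamma a) = (\<integral>\<^sup>+t. ennreal (indicator {0..} t * t powr (a - 1) / exp t) \<partial>lborel)"
    using assms by (intro Gamma_conv_nn_integral_real)
  also have "\<dots> = ennreal \<bar>c\<bar> * (\<integral>\<^sup>+t. ennreal (indicator {0..} (0 + c * t) * (0 + c * t) powr (a - 1) / exp (0 + c * t)) \<partial>lborel)"
    using assms by (intro nn_integral_real_affine) auto
  also have "(\<integral>\<^sup>+t. ennreal (indicator {0..} (0 + c * t) * (0 + c * t) powr (a - 1) / exp (0 + c * t)) \<partial>lborel)
      = (\<integral>\<^sup>+t. ennreal (c powr (a - 1)) * ennreal (indicator {0<..} t * (t powr (a - 1) * exp (- (c * t)))) \<partial>lborel)"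
  proof (intro nn_integral_cong)
    fix t :: real
    consider "t < 0" | "t = 0" | "t > 0" by linarith
    then show "ennreal (indicator {0..} (0 + c * t) * (0 + c * t) powr (a - 1) / exp (0 + c * t))
        = ennreal (c powr (a - 1)) * ennreal (indicator {0<..} t * (t powr (a - 1) * exp (- (c * t))))"
    proof cases
      case 1
      then have "c * t < 0" using assms by (simp add: mult_pos_neg)
      then show ?thesis using 1 by (simp add: indicator_def)
    next
      case 3
      then have "c * t > 0" using assms by simp
      then show ?thesis using 3 assms
        by (simp add: indicator_def powr_mult exp_minus field_simps flip: ennreal_mult)
    qed (simp add: indicator_def)
  qed
  also have "\<dots> = ennreal (c powr (a - 1)) * J"
    unfolding J_def by (intro nn_integral_cmult) auto
  finally have "ennreal (Gamma a) = ennreal (c powr a) * J"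
    using assms by (simp add: powr_diff mult.assoc[symmetric] flip: ennreal_mult)
  then have "ennreal (1 / c powr a) * ennreal (Gamma a) = (ennreal (1 / c powr a) * ennreal (c powr a)) * J"
    by (simp add: mult.assoc)
  moreover have "ennreal (1 / c powr a) * ennreal (c powr a) = 1"
    using assms by (simp flip: ennreal_mult)
  moreover have "ennreal (1 / c powr a) * ennreal (Gamma a) = ennreal (Gamma a / c powr a)"
    using assms by (simp flip: ennreal_mult)
  ultimately show ?thesis by (simp add: J_def)
qed

lemma Gamma_binomial_series:
  fixes a x :: real
  assumes a: "a > 0" and x: "0 \<le> x" "x < 1"
  shows "(\<lambda>k. Gamma (a + real k) / fact k * x ^ k) sums (Gamma a * (1 - x) powr (- a))"
proof -
  have nz: "a \<notin> \<int>\<^sub>\<le>\<^sub>0" using a by (auto elim!: nonpos_Ints_cases)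
  have "(\<lambda>k. (- a gchoose k) * (- x) ^ k) sums (1 + - x) powr (- a)"
    using x by (intro gen_binomial_real) auto
  also have "(\<lambda>k. (- a gchoose k) * (- x) ^ k) = (\<lambda>k. Gamma (a + real k) / fact k * x ^ k / Gamma a)"
  proof
    fix k
    have "(- a gchoose k) * (- x) ^ k = ((- 1) ^ k * (- 1) ^ k) * (pochhammer a k / fact k) * x ^ k"
      by (simp add: gbinomial_pochhammer power_minus[of x])
    also have "(- 1) ^ k * (- 1) ^ k = (1::real)" by (simp flip: power_mult_distrib)
    finally show "(- a gchoose k) * (- x) ^ k = Gamma (a + real k) / fact k * x ^ k / Gamma a"
      using pochhammer_Gamma[OF nz, of k] by simp
  qed
  finally have "(\<lambda>k. Gamma a * (Gamma (a + real k) / fact k * x ^ k / Gamma a)) sums (Gamma a * (1 + - x) powr (- a))"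
    by (rule sums_mult)
  then show ?thesis
    using Gamma_real_pos[OF a] by simp
qed

lemma nn_integral_Beta:
  fixes a b :: real
  assumes "a > 0" "b > 0"
  shows "(\<integral>\<^sup>+x. ennreal (indicator {0<..<1} x * (x powr (a - 1) * (1 - x) powr (b - 1))) \<partial>lborel)
          = ennreal (Beta a b)"
  using nn_integral_has_integral_lebesgue[where \<Omega> = "{0<..<1}" and f = "\<lambda>x. x powr (a - 1) * (1 - x) powr (b - 1)" and I = "Beta a b"]
    has_integral_Beta_real[OF assms]
  by (simp add: has_integral_Icc_iff_Ioo)

text \<open>
  Writing \<open>\<Gamma>(b + k) / \<Gamma>(c + k)\<close> as a Beta integral turns the series into
  \<open>\<integral> x^(b - 1) (1 - x)^(c - b - 1) \<Sum>_k \<Gamma>(a + k) x^k / k! dx\<close>; the inner sum is a binomial series, and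
  what remains is another Beta integral. All terms are positive, so sum and integral commute.
\<close>

lemma Gauss_hypergeometric_sum:
  fixes a b c :: real
  assumes a: "a > 0" and b: "b > 0" and c: "c > a + b"
  shows "(\<Sum>k. ennreal (Gamma (a + real k) * Gamma (b + real k) / (fact k * Gamma (c + real k))))
          = ennreal (Gamma a * Gamma b * Gamma (c - a - b) / (Gamma (c - a) * Gamma (c - b)))"
proof -
  let ?f = "\<lambda>k x::real. indicator {0<..<1} x * (Gamma (a + real k) / (fact k * Gamma (c - b)) * (x powr (b + real k - 1) * (1 - x) powr (c - b - 1)))"
  have pos: "Gamma (a + real k) > 0" "Gamma (b + real k) > 0" "Gamma (c + real k) > 0" 
    "Gamma (c - b) > 0" "Gamma (c - a) > 0" "Gamma (c - a - b) > 0" "Gamma a > 0" for k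
    using assms by (auto intro!: Gamma_real_pos)
  have tm: "ennreal (Gamma (a + real k) * Gamma (b + real k) / (fact k * Gamma (c + real k)))
         = (\<integral>\<^sup>+x. ennreal (?f k x) \<partial>lborel)" for k
  proof -
    have "(\<integral>\<^sup>+x. ennreal (?f k x) \<partial>lborel) = 
       (\<integral>\<^sup>+x. ennreal (Gamma (a + real k) / (fact k * Gamma (c - b))) * ennreal (indicator {0<..<1} x * (x powr (b + real k - 1) * (1 - x) powr (c - b - 1))) \<partial>lborel)"
      using pos(1-3)[of k] pos(4-) by (intro nn_integral_cong) (simp add: mult_ac flip: ennreal_mult)
    also have "\<dots> = ennreal (Gamma (a + real k) / (fact k * Gamma (c - b))) * ennreal (Beta (b + real k) (c - b))"
      using a b c by (subst nn_integral_cmult) (auto simp: nn_integral_Beta)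
    also have "\<dots> = ennreal (Gamma (a + real k) * Gamma (b + real k) / (fact k * Gamma (c + real k)))"
      using pos(1-3)[of k] pos(4-) by (simp add: Beta_def field_simps flip: ennreal_mult)
    finally show ?thesis by simp
  qed
  have "(\<Sum>k. ennreal (Gamma (a + real k) * Gamma (b + real k) / (fact k * Gamma (c + real k))))
       = (\<Sum>k. \<integral>\<^sup>+x. ennreal (?f k x) \<partial>lborel)" by (simp only: tm)
  also have "\<dots> = (\<integral>\<^sup>+x. (\<Sum>k. ennreal (?f k x)) \<partial>lborel)"
    by (rule nn_integral_suminf[symmetric]) auto
  also have "\<dots> = (\<integral>\<^sup>+x. ennreal (Gamma a / Gamma (c - b)) * 
      ennreal (indicator {0<..<1} x * (x powr (b - 1) * (1 - x) powr (c - a - b - 1))) \<partial>lborel)"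
  proof (intro nn_integral_cong)
    fix x :: real
    show "(\<Sum>k. ennreal (?f k x)) = ennreal (Gamma a / Gamma (c - b)) * 
      ennreal (indicator {0<..<1} x * (x powr (b - 1) * (1 - x) powr (c - a - b - 1)))"
    proof (cases "x \<in> {0<..<1}")
      case True
      then have x: "0 < x" "x < 1" by auto
      have "(\<lambda>k. Gamma (a + real k) / fact k * x ^ k * (x powr (b - 1) * (1 - x) powr (c - b - 1) / Gamma (c - b))) sums
         (Gamma a * (1 - x) powr (- a) * (x powr (b - 1) * (1 - x) powr (c - b - 1) / Gamma (c - b)))"
        using a x by (intro sums_mult2 Gamma_binomial_series) auto
      also have "(\<lambda>k. Gamma (a + real k) / fact k * x ^ k * (x powr (b - 1) * (1 - x) powr (c - b - 1) / Gamma (c - b))) = (\<lambda>k. ?f k x)"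
      proof
        fix k
        have "x powr (b + real k - 1) = x ^ k * x powr (b - 1)"
          using x by (simp add: powr_realpow[symmetric] flip: powr_add) (simp add: algebra_simps)
        then show "Gamma (a + real k) / fact k * x ^ k * (x powr (b - 1) * (1 - x) powr (c - b - 1) / Gamma (c - b)) = ?f k x"
          using x by simp
      qed
      finally have s: "(\<lambda>k. ?f k x) sums (Gamma a / Gamma (c - b) * (x powr (b - 1) * ((1 - x) powr (-a) * (1 - x) powr (c - b - 1))))"
        by (simp add: mult_ac)
      have e: "(1 - x) powr (-a) * (1 - x) powr (c - b - 1) = (1 - x) powr (c - a - b - 1)"
        by (simp flip: powr_add add: algebra_simps)
      have "(\<Sum>k. ennreal (?f k x)) = ennreal (Gamma a / Gamma (c - b) * (x powr (b - 1) * (1 - x) powr (c - a - b - 1)))"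
        using s pos x unfolding e by (intro suminf_ennreal_eq) (auto simp: indicator_def intro!: mult_nonneg_nonneg divide_nonneg_nonneg less_imp_le)
      then show ?thesis using True pos by (simp flip: ennreal_mult)
    qed simp
  qed
  also have "\<dots> = ennreal (Gamma a / Gamma (c - b)) * ennreal (Beta b (c - a - b))"
    using a b c by (subst nn_integral_cmult) (auto simp: nn_integral_Beta)
  also have "\<dots> = ennreal (Gamma a / Gamma (c - b) * Beta b (c - a - b))"
    using pos Gamma_real_pos[OF b] by (intro ennreal_mult[symmetric]) (auto simp: Beta_def)
  also have "Gamma a / Gamma (c - b) * Beta b (c - a - b)
      = Gamma a * Gamma b * Gamma (c - a - b) / (Gamma (c - a) * Gamma (c - b))"
    by (simp add: Beta_def mult_ac)
  finally show ?thesis .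
qed

lemma Gamma_duplication_real:
  fixes z :: real
  assumes "z > 0"
  shows "Gamma z * Gamma (z + 1/2) = 2 powr (1 - 2 * z) * sqrt pi * Gamma (2 * z)"
proof -
  have "complex_of_real z \<notin> \<int>\<^sub>\<le>\<^sub>0" "complex_of_real z + 1/2 \<notin> \<int>\<^sub>\<le>\<^sub>0"
    using assms by (auto elim!: nonpos_Ints_cases simp: complex_eq_iff)
  from Gamma_legendre_duplication[OF this]
  have "of_real (Gamma z * Gamma (z + 1/2)) = complex_of_real (2 powr (1 - 2 * z) * sqrt pi * Gamma (2 * z))"
    using Gamma_complex_of_real[of "z + 1/2"] Gamma_complex_of_real[of "2 * z"]
    by (simp add: Gamma_complex_of_real powr_def flip: exp_of_real)
  then show ?thesis by (simp only: of_real_eq_iff)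
qed

section \<open>Ratios of Gamma functions\<close>

lemma Gamma_real_plus1:
  fixes z :: real
  assumes "z > 0"
  shows "Gamma (z + 1) = z * Gamma z"
proof (rule Gamma_plus1)
  show "z \<notin> \<int>\<^sub>\<le>\<^sub>0" using assms by (auto elim!: nonpos_Ints_cases)
qed

text \<open>
  Gauss's product for \<open>1 / \<Gamma>(z + 1)\<close> says that \<open>\<Gamma>(n + z + 2)\<close> is asymptotic to
  \<open>n! n^(z + 1)\<close>; the quotient of two such relations is the claim at \<open>n + 2\<close>.
\<close>

lemma Gamma_ratio_tendsto:
  fixes a b :: real
  assumes a: "a > -1" and b: "b > -1"
  shows "(\<lambda>n. Gamma (real n + a) / Gamma (real n + b) * real n powr (b - a)) \<longlonglongrightarrow> 1"
proof -
  let ?p = "\<lambda>n. (Gamma (real n + a + 2) / (fact n * real n powr (a + 1))) / (Gamma (real n + b + 2) / (fact n * real n powr (b + 1))) * ((real n + 2) / real n) powr (b - a)"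
  let ?p2 = "\<lambda>n. Gamma (real (n + 2) + a) / Gamma (real (n + 2) + b) * real (n + 2) powr (b - a)"
  have q: "(\<lambda>n. Gamma (real n + z + 2) / (fact n * real n powr (z + 1))) \<longlonglongrightarrow> 1" if z: "z > -1" for z :: real
  proof -
    have nz: "z + 1 \<notin> \<int>\<^sub>\<le>\<^sub>0" using z by (auto elim!: nonpos_Ints_cases)
    have G: "Gamma (z + 1) > 0" using z by (intro Gamma_real_pos) auto
    have "(\<lambda>n. Gamma (z + 1) * rGamma_series (z + 1) n) \<longlonglongrightarrow> Gamma (z + 1) * rGamma (z + 1)"
      by (intro tendsto_intros)
    also have "Gamma (z + 1) * rGamma (z + 1) = 1" using G by (simp add: rGamma_inverse_Gamma)
    finally have lim: "(\<lambda>n. Gamma (z + 1) * rGamma_series (z + 1) n) \<longlonglongrightarrow> 1" .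
    have "eventually (\<lambda>n. Gamma (z + 1) * rGamma_series (z + 1) n = Gamma (real n + z + 2) / (fact n * real n powr (z + 1))) sequentially"
      using eventually_gt_at_top[of 0]
    proof eventually_elim
      case (elim n)
      have "z + 1 + real (n + 1) = real n + z + 2" by simp
      then show ?case
        unfolding rGamma_series_def pochhammer_Gamma[OF nz] using elim G by (simp add: powr_def add_ac)
    qed
    then show ?thesis by (rule Lim_transform_eventually[OF lim])
  qed
  have lim: "(\<lambda>n. ?p n) \<longlonglongrightarrow> 1 / 1 * 1"
    by (intro tendsto_mult tendsto_divide q a b) (simp, real_asymp)
  have "eventually (\<lambda>n. ?p n
     = ?p2 n) sequentially"
    using eventually_gt_at_top[of 0]
  proof eventually_elim
    case (elim n)
    then have n: "real n > 0" by simp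
    have e: "real n + a + 2 = real (n + 2) + a" "real n + b + 2 = real (n + 2) + b" by simp_all
    have "real n powr (b + 1) = real n powr (b - a) * real n powr (a + 1)" using n by (simp flip: powr_add)
    moreover have "((real n + 2) / real n) powr (b - a) = real (n + 2) powr (b - a) / real n powr (b - a)"
      by (subst powr_divide) (auto simp: add.commute)
    moreover have "real n powr (b - a) > 0" "real n powr (a + 1) > 0" using n by auto
    moreover have "G1 / (f * X) / (G2 / (f * (Y * X))) * (Z / Y) = G1 / G2 * Z" if "X > 0" "Y > 0" "f > 0" for G1 G2 X Y Z f :: real
      using that by simp
    ultimately show ?case unfolding e by (simp only: fact_gt_zero)
  qed
  from Lim_transform_eventually[OF lim this]
  have "(\<lambda>n. ?p2 n) \<longlonglongrightarrow> 1"
    by (simp only: mult_1_right div_by_1)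
  then show ?thesis by (rule LIMSEQ_offset)
qed

text \<open>
  Since \<open>1 / n^2 \<le> 2 / n - 2 / (n + 1)\<close>, the increments telescope.
\<close>

lemma bound_from_increments:
  fixes r :: "nat \<Rightarrow> real"
  assumes lim: "r \<longlonglongrightarrow> L" and N: "N \<ge> 1" and K: "K \<ge> 0"
    and inc: "\<And>n. n \<ge> N \<Longrightarrow> \<bar>r (Suc n) - r n\<bar> \<le> K / (real n)\<^sup>2"
    and n: "n \<ge> N"
  shows "\<bar>r n - L\<bar> \<le> 2 * K / real n"
proof -
  have tele: "\<bar>r (Suc k) - r k\<bar> \<le> 2 * K / real k - 2 * K / real (Suc k)" if "k \<ge> N" for k
  proof -
    have k: "real k \<ge> 1" using that N by simp
    have "K / (real k)\<^sup>2 \<le> 2 * K / real k - 2 * K / real (Suc k)"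
    proof -
      have "2 * K / real k - 2 * K / real (Suc k) = K * (2 / (real k * (real k + 1)))" using k by (simp add: field_simps)
      moreover have "real k * (real k + 1) \<le> 2 * (real k)\<^sup>2" using k by (simp add: power2_eq_square)
      then have "2 / (2 * (real k)\<^sup>2) \<le> 2 / (real k * (real k + 1))" using k by (intro divide_left_mono) auto
      then have "1 / (real k)\<^sup>2 \<le> 2 / (real k * (real k + 1))" by simp
      then have "K * (1 / (real k)\<^sup>2) \<le> K * (2 / (real k * (real k + 1)))" using K by (intro mult_left_mono)
      ultimately show ?thesis by simp
    qed
    with inc[OF that] show ?thesis by linarith
  qed
  have m: "\<bar>r (n + j) - r n\<bar> \<le> 2 * K / real n - 2 * K / real (n + j)" for j
  proof (induction j)
    case (Suc j)
    then show ?case using tele[of "n + j"] n by (simp del: of_nat_Suc) 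
  qed simp
  have "\<bar>r (n + j) - r n\<bar> \<le> 2 * K / real n" for j
    using m[of j] K by (smt (verit) divide_nonneg_nonneg of_nat_0_le_iff)
  moreover have "(\<lambda>j. r (n + j)) \<longlonglongrightarrow> L"
    using LIMSEQ_ignore_initial_segment[OF lim, of n] by (simp add: add.commute)
  then have "(\<lambda>j. \<bar>r (n + j) - r n\<bar>) \<longlonglongrightarrow> \<bar>L - r n\<bar>" by (intro tendsto_intros)
  ultimately have "\<bar>L - r n\<bar> \<le> 2 * K / real n" by (intro LIMSEQ_le_const2) auto
  then show ?thesis by linarith
qed

text \<open>
  The functional equation makes consecutive quotients of the normalised ratio equal to
  \<open>(n + a) / (n + b) * ((n + 1) / n)^(b - a) = 1 + O(1 / n^2)\<close>, which upgrades the bare limit to a rate.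
\<close>

lemma Gamma_ratio_asymp:
  fixes a b :: real
  assumes a: "a > -1" and b: "b > -1"
  shows "\<exists>C\<ge>0. \<forall>n\<ge>1. \<bar>Gamma (real n + a) / Gamma (real n + b) - real n powr (a - b)\<bar> \<le> C * real n powr (a - b - 1)"
proof -
  let ?q = "\<lambda>n. (real n + a) / (real n + b) * ((real n + 1) / real n) powr (b - a)" and ?G = "\<lambda>n. Gamma (real n + a) / Gamma (real n + b)"
  define r where "r n = ?G n * real n powr (b - a)" for n
  have lim: "r \<longlonglongrightarrow> 1" unfolding r_def by (rule Gamma_ratio_tendsto[OF a b])
  have "(\<lambda>x::real. (x + a) / (x + b) * ((x + 1) / x) powr (b - a) - 1) \<in> O(\<lambda>x. 1 / x\<^sup>2)"
    by real_asymp
  then obtain c where c: "c > 0" and ev: "eventually (\<lambda>x::real. norm ((x + a) / (x + b) * ((x + 1) / x) powr (b - a) - 1) \<le> c * norm (1 / x\<^sup>2)) at_top"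
    by (elim landau_o.bigE)
  have "eventually (\<lambda>n. norm (?q n - 1) \<le> c * norm (1 / (real n)\<^sup>2)) sequentially"
    by (rule eventually_compose_filterlim[OF ev filterlim_real_sequentially])
  then obtain N0 where N0: "\<And>n. n \<ge> N0 \<Longrightarrow> \<bar>?q n - 1\<bar> \<le> c / (real n)\<^sup>2"
    by (auto simp: eventually_at_top_linorder)
  obtain M where M: "M > 0" "\<And>n. \<bar>r n\<bar> \<le> M"
    using lim convergent_imp_Bseq[of r] unfolding convergent_def Bseq_def by (auto simp: real_norm_def)
  define N where "N = Suc N0"
  have inc: "\<bar>r (Suc n) - r n\<bar> \<le> M * c / (real n)\<^sup>2" if "n \<ge> N" for n
  proof -
    have n: "real n \<ge> 1" "n \<ge> N0" using that by (auto simp: N_def)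
    have pos: "real n + a > 0" "real n + b > 0" using n a b by auto
    have ga: "Gamma (real (Suc n) + a) = (real n + a) * Gamma (real n + a)" "Gamma (real (Suc n) + b) = (real n + b) * Gamma (real n + b)"
      using Gamma_real_plus1[OF pos(1)] Gamma_real_plus1[OF pos(2)] by (simp_all add: add_ac)
    have p: "real (Suc n) powr (b - a) = ((real n + 1) / real n) powr (b - a) * real n powr (b - a)"
      using n by (subst powr_divide) (auto simp: add_ac)
    have "r (Suc n) - r n = r n * (?q n - 1)"
    proof -
      have alg: "A * G1 / (B * G2) * (X * P) - G1 / G2 * P = G1 / G2 * P * (A / B * X - 1)" if "B > 0" "G2 > 0" for A B G1 G2 X P :: real
        using that by (simp add: field_simps)
      show ?thesis unfolding r_def ga p by (rule alg) (use pos in \<open>auto intro: Gamma_real_pos\<close>)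
    qed
    then have "\<bar>r (Suc n) - r n\<bar> = \<bar>r n\<bar> * \<bar>?q n - 1\<bar>"
      by (simp add: abs_mult)
    also have "\<dots> \<le> M * (c / (real n)\<^sup>2)" using M N0[OF n(2)] by (intro mult_mono) auto
    finally show ?thesis by simp
  qed
  have big: "\<bar>r n - 1\<bar> \<le> 2 * (M * c) / real n" if "n \<ge> N" for n
    using bound_from_increments[OF lim _ _ inc that] M(1) c by (auto simp: N_def)
  define C where "C = Max (insert (2 * (M * c)) ((\<lambda>n. \<bar>r n - 1\<bar> * real n) ` {..<N}))"
  have C: "\<bar>r n - 1\<bar> * real n \<le> C" if "n \<ge> 1" for n
  proof (cases "n \<ge> N")
    case True
    then have "\<bar>r n - 1\<bar> * real n \<le> 2 * (M * c)" using big[OF True] that by (simp add: field_simps)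
    also have "\<dots> \<le> C" unfolding C_def by (intro Max_ge) auto
    finally show ?thesis .
  qed (auto simp: C_def intro!: Max_ge)
  have "C \<ge> 0"
  proof -
    have "2 * (M * c) \<le> C" unfolding C_def by (intro Max_ge) auto
    moreover have "0 \<le> 2 * (M * c)" using M c by simp
    ultimately show ?thesis by linarith
  qed
  moreover have "\<bar>?G n - real n powr (a - b)\<bar> \<le> C * real n powr (a - b - 1)" if "n \<ge> 1" for n
  proof -
    have n: "real n > 0" using that by simp
    have e: "real n powr (b - a) * real n powr (a - b) = 1" using n by (simp flip: powr_add)
    have "?G n = r n * real n powr (a - b)"
      using e by (simp add: r_def)
    then have "?G n - real n powr (a - b) = (r n - 1) * real n powr (a - b)"
      by (simp add: left_diff_distrib)
    moreover have "real n powr (a - b) = real n * real n powr (a - b - 1)" using n by (simp add: powr_diff)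
    ultimately have "\<bar>?G n - real n powr (a - b)\<bar> = \<bar>r n - 1\<bar> * real n * real n powr (a - b - 1)"
      by (simp add: abs_mult)
    also have "\<dots> \<le> C * real n powr (a - b - 1)" by (intro mult_right_mono C that) auto
    finally show ?thesis .
  qed
  ultimately show ?thesis by blast
qed

section \<open>The discrete heat kernel\<close>

lemma has_sum_exp_terms:
  fixes t :: real
  assumes "t > 0"
  shows "((\<lambda>k. t ^ k / fact k) has_sum exp t) UNIV"
  using exp_converges[of t] assms by (intro sums_nonneg_imp_has_sum) (auto simp: field_simps)

lemma has_sum_exp_product:
  fixes t :: real
  assumes t: "t > 0"
  shows "((\<lambda>(k, p). t ^ k / fact k * (t ^ p / fact p)) has_sum exp (2 * t)) (UNIV \<times> UNIV)"
proof -
  let ?f = "\<lambda>(k, p). t ^ k / fact k * (t ^ p / fact p)"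
  have f: "((\<lambda>p. ?f (k, p)) has_sum (t ^ k / fact k * exp t)) UNIV" for k :: nat
    using has_sum_cmult_right[OF has_sum_exp_terms[OF t], of "t ^ k / fact k"] by simp
  have g: "((\<lambda>k. t ^ k / fact k * exp t) has_sum exp (2 * t)) UNIV"
    using has_sum_cmult_left[OF has_sum_exp_terms[OF t], of "exp t"] by (simp flip: exp_add)
  have "?f summable_on (UNIV \<times> UNIV)"
    using f g t by (intro summable_on_SigmaI[where g = "\<lambda>k. t ^ k / fact k * exp t"])
      (auto simp: summable_on_def)
  then show ?thesis using f g by (intro has_sum_SigmaI[where g = "\<lambda>k. t ^ k / fact k * exp t"]) auto
qed

text \<open>
  For integer order the reciprocal Gamma function is a reciprocal factorial or zero, so the series
  is that of \<open>\<Sum> t^k / k! * t^p / p!\<close> along the diagonal \<open>p - k = m\<close>.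
\<close>

lemma bessel_I_term:
  fixes t :: real
  assumes "t > 0"
  shows "t powi (2 * int k + m) * rGamma (of_int m + of_nat k + 1) / fact k
     = (if int k + m \<ge> 0 then t ^ k / fact k * (t ^ nat (int k + m) / fact (nat (int k + m))) else 0)"
proof (cases "int k + m \<ge> 0")
  case True
  define p where "p = nat (int k + m)"
  have p: "int p = int k + m" using True by (simp add: p_def)
  then have m: "m = int p - int k" by simp
  have "rGamma (of_int m + of_nat k + 1 :: real) = 1 / fact p"
    using Gamma_fact[of p, where 'a = real] by (simp add: m rGamma_inverse_Gamma field_simps)
  moreover have "t powi (2 * int k + m) = t ^ k * t ^ p"
  proof -
    have "2 * int k + m = int (k + p)" by (simp add: m)
    then show ?thesis by (simp only: power_int_of_nat power_add)
  qed
  ultimately show ?thesis using True by (simp add: p_def)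
next
  case False
  then have "(of_int m + of_nat k + 1 :: real) = of_int (m + int k + 1)" "m + int k + 1 \<le> 0" by auto
  then have "(of_int m + of_nat k + 1 :: real) \<in> \<int>\<^sub>\<le>\<^sub>0" using nonpos_Ints_of_int by metis
  then show ?thesis using False by (simp add: rGamma_eq_zero_iff)
qed

text \<open>
  The diagonals \<open>p - k = m\<close> partition all pairs \<open>(k, p)\<close>. Summing the product of two exponential series
  along them yields the Bessel functions, and summing over all of them the generating function at \<open>1\<close>.
\<close>

lemma bessel_I_has_sum:
  fixes t :: real
  assumes t: "t > 0"
  shows "((\<lambda>k. t ^ k / fact k * (t ^ nat (int k + m) / fact (nat (int k + m)))) has_sum bessel_I m (2 * t))
           {k. int k + m \<ge> 0}" (is ?th1)
    and "((\<lambda>m. bessel_I m (2 * t)) has_sum exp (2 * t)) UNIV" (is ?th2)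
proof -
  let ?F = "\<lambda>m k. t ^ k / fact k * (t ^ nat (int k + m) / fact (nat (int k + m)))"
  let ?b = "\<lambda>m k. t powi (2 * int k + m) * rGamma (of_int m + of_nat k + 1) / fact k"
  have S: "((\<lambda>(m, k). ?F m k) has_sum exp (2 * t)) (SIGMA m:UNIV. {k. int k + m \<ge> 0})"
  proof -
    have "((\<lambda>(k, p). t ^ k / fact k * (t ^ p / fact p)) has_sum exp (2 * t)) (UNIV \<times> UNIV) \<longleftrightarrow> ?thesis"
      by (rule has_sum_reindex_bij_witness[where j = "\<lambda>(k, p). (int p - int k, k)" and i = "\<lambda>(m, k). (k, nat (int k + m))"])
        auto
    then show ?thesis using has_sum_exp_product[OF t] by blast
  qed
  have fib: "(?F m has_sum bessel_I m (2 * t)) {k. int k + m \<ge> 0}" for m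
  proof -
    have "?F m summable_on {k. int k + m \<ge> 0}"
      by (rule summable_on_SigmaD1[where A = UNIV]) (use S in \<open>auto simp: summable_on_def\<close>)
    then obtain B where B: "(?F m has_sum B) {k. int k + m \<ge> 0}" by (auto simp: summable_on_def)
    also have "?this \<longleftrightarrow> (?b m has_sum B) UNIV"
      by (rule has_sum_cong_neutral) (auto simp: bessel_I_term[OF t])
    finally have "?b m sums B" by (rule has_sum_imp_sums)
    then have "bessel_I m (2 * t) = B" by (simp add: bessel_I_def sums_unique[symmetric])
    with B show ?thesis by simp
  qed
  then show ?th1 .
  show ?th2
    by (rule has_sum_Sigma'[OF S]) (use fib in auto)
qed

lemma bessel_I_uminus:
  fixes t :: real
  assumes t: "t > 0"
  shows "bessel_I (- int m) (2 * t) = bessel_I (int m) (2 * t)"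
proof -
  let ?F = "\<lambda>m k. t ^ k / fact k * (t ^ nat (int k + m) / fact (nat (int k + m)))"
  have "(?F (int m) has_sum bessel_I (int m) (2 * t)) {k. int k + int m \<ge> 0} \<longleftrightarrow>
        (?F (- int m) has_sum bessel_I (int m) (2 * t)) {k. int k + - int m \<ge> 0}"
    by (rule has_sum_reindex_bij_witness[where j = "\<lambda>k. k + m" and i = "\<lambda>k. k - m"])
       (auto simp: nat_int_add mult_ac)
  with bessel_I_has_sum(1)[OF t, of "int m"] bessel_I_has_sum(1)[OF t, of "- int m"]
  show ?thesis using has_sum_unique by blast
qed

lemma heat_kernel_props:
  fixes t :: real
  assumes t: "t > 0"
  shows heat_kernel_nonneg: "heat_kernel m t \<ge> 0"
    and heat_kernel_uminus: "heat_kernel (- int n) t = heat_kernel (int n) t"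
    and heat_kernel_has_sum: "((\<lambda>m. heat_kernel m t) has_sum 1) UNIV"
    and heat_kernel_sums: "(\<lambda>k. exp (- 2 * t) * (t ^ (2 * k + n) / (fact k * fact (k + n)))) sums heat_kernel (int n) t"
proof -
  have "bessel_I m (2 * t) \<ge> 0"
    by (rule has_sum_nonneg[OF bessel_I_has_sum(1)[OF t]]) (use t in auto)
  then show "heat_kernel m t \<ge> 0" by (simp add: heat_kernel_def)
  show "heat_kernel (- int n) t = heat_kernel (int n) t"
    by (simp add: heat_kernel_def bessel_I_uminus[OF t])
  show "((\<lambda>m. heat_kernel m t) has_sum 1) UNIV"
    using has_sum_cmult_right[OF bessel_I_has_sum(2)[OF t], of "exp (- 2 * t)"]
    by (simp add: heat_kernel_def flip: exp_add)
  have "{k. int k + int n \<ge> 0} = UNIV" by auto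
  then have bs: "(\<lambda>k. t ^ k / fact k * (t ^ nat (int k + int n) / fact (nat (int k + int n)))) sums bessel_I (int n) (2 * t)"
    using bessel_I_has_sum(1)[OF t, of "int n"] by (auto intro!: has_sum_imp_sums)
  have "(\<lambda>k. t ^ (2 * k + n) / (fact k * fact (k + n))) sums bessel_I (int n) (2 * t)"
  proof -
    have "nat (int k + int n) = k + n" "t ^ (2 * k + n) = t ^ k * t ^ (k + n)" for k
      by (simp_all add: nat_int_add mult_2 add.assoc flip: power_add)
    then show ?thesis using bs by simp
  qed
  then show "(\<lambda>k. exp (- 2 * t) * (t ^ (2 * k + n) / (fact k * fact (k + n)))) sums heat_kernel (int n) t"
    unfolding heat_kernel_def by (rule sums_mult)
qed

text \<open>
  The weights of the fractional discrete Laplacian, without the factor \<^const>\<open>frac_const\<close> that all of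
  them share.
\<close>

definition lap_weight :: "real \<Rightarrow> nat \<Rightarrow> real" where
  "lap_weight s n = Gamma (real n - s) / Gamma (real n + 1 + s)"

lemma lap_weight_pos: "\<lbrakk>0 < s; s < 1; n \<ge> 1\<rbrakk> \<Longrightarrow> lap_weight s n > 0"
  by (auto simp: lap_weight_def intro!: divide_pos_pos Gamma_real_pos)

text \<open>
  Integrating the power series term by term gives \<open>\<Gamma>(2 k + n - s) / (2^(2 k + n - s) k! (k + n)!)\<close>.
  Duplication splits the numerator into \<open>\<Gamma>(a + k) \<Gamma>(b + k)\<close> with \<open>a = (n - s) / 2\<close> and
  \<open>b = a + 1/2\<close>, so that the sum is Gauss's with \<open>c = n + 1\<close>. Duplication, applied to \<open>a\<close> and to
  \<open>c - b\<close>, also puts the result into closed form.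
\<close>

lemma nn_integral_heat_kernel:
  fixes s :: real
  assumes s: "0 < s" "s < 1" and n: "n \<ge> 1"
  shows "(\<integral>\<^sup>+t. ennreal (indicator {0<..} t * (heat_kernel (int n) t / t powr (1 + s))) \<partial>lborel)
     = ennreal (4 powr s * Gamma (1/2 + s) / sqrt pi * lap_weight s n)"
proof -
  define a b c where "a = (real n - s) / 2" and "b = (real n - s) / 2 + 1/2" and "c = real n + 1"
  have abc: "a > 0" "b > 0" "c > a + b" using s n by (auto simp: a_def b_def c_def field_simps)
  let ?g = "\<lambda>k. Gamma (a + real k) * Gamma (b + real k) / (fact k * Gamma (c + real k))"
  let ?e = "\<lambda>t k. exp (- 2 * t) * (t ^ (2 * k + n) / (fact k * fact (k + n)))"
  let ?A = "\<lambda>k. 2 * real k + real n - s"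
  let ?f = "\<lambda>k t. 1 / (fact k * fact (k + n)) * (indicator {0<..} t * (t powr (?A k - 1) * exp (- (2 * t))))"
  have "(\<integral>\<^sup>+t. ennreal (indicator {0<..} t * (heat_kernel (int n) t / t powr (1 + s))) \<partial>lborel)
     = (\<integral>\<^sup>+t. (\<Sum>k. ennreal (?f k t)) \<partial>lborel)"
  proof (intro nn_integral_cong)
    fix t :: real
    show "ennreal (indicator {0<..} t * (heat_kernel (int n) t / t powr (1 + s))) = (\<Sum>k. ennreal (?f k t))"
    proof (cases "t > 0")
      case True
      have "(\<lambda>k. ?e t k / t powr (1 + s)) sums (heat_kernel (int n) t / t powr (1 + s))"
        by (intro sums_divide heat_kernel_sums True)
      also have "(\<lambda>k. ?e t k / t powr (1 + s)) = (\<lambda>k. ?f k t)"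
      proof
        fix k
        have "t ^ (2 * k + n) / t powr (1 + s) = t powr (?A k - 1)"
          using True by (simp add: powr_realpow[symmetric] powr_diff[symmetric] algebra_simps)
        then show "?e t k / t powr (1 + s) = ?f k t"
          using True by (simp add: field_simps)
      qed
      finally have "(\<Sum>k. ennreal (?f k t)) = ennreal (heat_kernel (int n) t / t powr (1 + s))"
        using True by (intro suminf_ennreal_eq) auto
      then show ?thesis using True by simp
    qed simp
  qed
  also have "\<dots> = (\<Sum>k. \<integral>\<^sup>+t. ennreal (?f k t) \<partial>lborel)"
    by (rule nn_integral_suminf) auto
  also have "(\<lambda>k. \<integral>\<^sup>+t. ennreal (?f k t) \<partial>lborel)
      = (\<lambda>k. ennreal (1 / (2 * sqrt pi)) * ennreal (?g k))"
  proof
    fix k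
    have A: "?A k > 0" using s n by simp
    have z: "a + real k > 0" using abc by simp
    have "(\<integral>\<^sup>+t. ennreal (?f k t) \<partial>lborel) = ennreal (1 / (fact k * fact (k + n))) * ennreal (Gamma (?A k) / 2 powr ?A k)"
    proof -
      have "ennreal (?f k t) = ennreal (1 / (fact k * fact (k + n))) * ennreal (indicator {0<..} t * (t powr (?A k - 1) * exp (- (2 * t))))" for t
        by (rule ennreal_mult) auto
      then show ?thesis using nn_integral_powr_exp[OF A, of 2] by (simp only: nn_integral_cmult) (subst nn_integral_cmult, auto)
    qed
    also have "\<dots> = ennreal (1 / (fact k * fact (k + n)) * (Gamma (?A k) / 2 powr ?A k))"
      by (intro ennreal_mult[symmetric] divide_nonneg_nonneg less_imp_le[OF Gamma_real_pos[OF A]]) simp_all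
    also have "1 / (fact k * fact (k + n)) * (Gamma (?A k) / 2 powr ?A k)
        = 1 / (2 * sqrt pi) * (?g k)"
    proof -
      have e: "a + real k + 1/2 = b + real k" "2 * (a + real k) = ?A k" by (auto simp: a_def b_def)
      have "Gamma (a + real k) * Gamma (b + real k) = 2 powr (1 - ?A k) * sqrt pi * Gamma (?A k)"
        using Gamma_duplication_real[OF z] by (simp only: e)
      moreover have "Gamma (c + real k) = fact (k + n)"
        using Gamma_fact[of "k + n", where 'a = real] by (simp add: c_def add_ac)
      moreover have "2 powr (1 - ?A k) = 2 / 2 powr ?A k" by (simp only: powr_diff) simp
      ultimately show ?thesis by simp
    qed
    also have "ennreal \<dots> = ennreal (1 / (2 * sqrt pi)) * ennreal (?g k)"
      using abc by (intro ennreal_mult divide_nonneg_nonneg mult_nonneg_nonneg less_imp_le[OF Gamma_real_pos]) simp_all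
    finally show "(\<integral>\<^sup>+t. ennreal (?f k t) \<partial>lborel) = ennreal (1 / (2 * sqrt pi)) * ennreal (?g k)" .
  qed
  also have "(\<Sum>k. ennreal (1 / (2 * sqrt pi)) * ennreal (?g k))
      = ennreal (1 / (2 * sqrt pi)) * ennreal (Gamma a * Gamma b * Gamma (c - a - b) / (Gamma (c - a) * Gamma (c - b)))"
    by (simp only: ennreal_suminf_cmult Gauss_hypergeometric_sum[OF abc])
  also have "\<dots> = ennreal (1 / (2 * sqrt pi) * (Gamma a * Gamma b * Gamma (c - a - b) / (Gamma (c - a) * Gamma (c - b))))"
    using abc by (intro ennreal_mult[symmetric] divide_nonneg_nonneg mult_nonneg_nonneg less_imp_le[OF Gamma_real_pos]) simp_all
  also have "1 / (2 * sqrt pi) * (Gamma a * Gamma b * Gamma (c - a - b) / (Gamma (c - a) * Gamma (c - b)))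
      = 4 powr s * Gamma (1/2 + s) / sqrt pi * lap_weight s n"
  proof -
    have 1: "Gamma a * Gamma b = 2 powr (1 - (real n - s)) * sqrt pi * Gamma (real n - s)"
    proof -
      have "2 * a = real n - s" "a + 1/2 = b" by (simp_all add: a_def b_def)
      with Gamma_duplication_real[OF abc(1)] show ?thesis by (simp only:)
    qed
    have ab: "2 * a = real n - s" "b = a + 1/2" by (simp_all add: a_def b_def)
    have cb: "c - b = (real n + 1 + s) / 2" by (simp add: b_def c_def field_simps)
    have ca: "c - a = (real n + 1 + s) / 2 + 1/2" by (simp add: a_def c_def field_simps)
    have e: "c - b + 1/2 = c - a" unfolding ca cb ..
    have e2: "2 * (c - b) = real n + 1 + s" unfolding cb by simp
    have e3: "c - a - b = 1/2 + s" unfolding ca b_def by (simp add: field_simps)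
    have e4: "c - b > 0" unfolding cb using s by simp
    have 2: "Gamma (c - a) * Gamma (c - b) = 2 powr (1 - (real n + 1 + s)) * sqrt pi * Gamma (real n + 1 + s)"
      using Gamma_duplication_real[OF e4] unfolding e e2 by (subst mult.commute)
    have 3: "Gamma (real n + 1 + s) > 0" using s by (intro Gamma_real_pos) auto
    have "2 powr s * 2 powr s = (4::real) powr s" by (simp add: powr_mult[symmetric])
    moreover have "1 - (real n - s) = 1 + (s + s) + (1 - (real n + 1 + s))" by simp
    then have "2 powr (1 - (real n - s)) = 2 powr 1 * (2 powr s * 2 powr s) * 2 powr (1 - (real n + 1 + s))"
      by (simp only: powr_add)
    ultimately have 4: "2 powr (1 - (real n - s)) = 2 * 4 powr s * 2 powr (1 - (real n + 1 + s))" by simp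
    have alg: "1 / (2 * P) * ((2 * F * X * P * G1) * Q / (X * P * G2)) = F * Q / P * (G1 / G2)"
      if "X > 0" "G2 > 0" "P > 0" for X G1 G2 F P Q :: real
      using that by (simp add: field_simps)
    show ?thesis unfolding 1 2 e3 lap_weight_def 4 by (rule alg) (use 3 in simp_all)
  qed
  finally show ?thesis .
qed

lemma has_sum_int_split:
  fixes f :: "int \<Rightarrow> real"
  assumes "((\<lambda>n. f (int (Suc n))) has_sum A) UNIV" "((\<lambda>n. f (- int (Suc n))) has_sum B) UNIV"
  shows "(f has_sum (f 0 + A + B)) UNIV"
proof -
  have p: "(f has_sum A) {0<..}"
    using assms(1) by (subst (asm) has_sum_reindex_bij_betw[of "\<lambda>n. int (Suc n)" UNIV "{0<..}"])
      (auto intro!: bij_betwI[of _ _ _ "\<lambda>m. nat m - 1"])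
  have n: "(f has_sum B) {..<0}"
    using assms(2) by (subst (asm) has_sum_reindex_bij_betw[of "\<lambda>n. - int (Suc n)" UNIV "{..<0}"])
      (auto intro!: bij_betwI[of _ _ _ "\<lambda>m. nat (- m) - 1"])
  have z: "(f has_sum f 0) {0}" using has_sum_finite[of "{0}" f] by simp
  have "(f has_sum (f 0 + A + B)) (({0} \<union> {0<..}) \<union> {..<0})"
    by (rule has_sum_Un_disjoint[OF has_sum_Un_disjoint[OF z p] n]) auto
  also have "({0} \<union> {0<..}) \<union> {..<0} = (UNIV :: int set)" by auto
  finally show ?thesis .
qed

section \<open>The fractional discrete Laplacian as a weighted sum of second differences\<close>

lemma lap_weight_asymp:
  assumes s: "0 < s" "s < 1"
  shows "\<exists>C\<ge>0. \<forall>n\<ge>1. \<bar>lap_weight s n - real n powr (-1 - 2 * s)\<bar> \<le> C * real n powr (-2 - 2 * s)"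
proof -
  have e: "- s - (1 + s) = -1 - 2 * s" "-1 - 2 * s - 1 = -2 - 2 * s" "real n + - s = real n - s" "real n + (1 + s) = real n + 1 + s" for n
    by simp_all
  have "- s > -1" "1 + s > -1" using s by auto
  from Gamma_ratio_asymp[OF this] show ?thesis unfolding lap_weight_def e .
qed

lemma lap_weight_le:
  assumes s: "0 < s" "s < 1"
  shows "\<exists>C\<ge>0. \<forall>n\<ge>1. lap_weight s n \<le> C * real n powr (-1 - 2 * s)"
proof -
  obtain C where C: "C \<ge> 0" "\<And>n. n \<ge> 1 \<Longrightarrow> \<bar>lap_weight s n - real n powr (-1 - 2 * s)\<bar> \<le> C * real n powr (-2 - 2 * s)"
    using lap_weight_asymp[OF s] by blast
  have "lap_weight s n \<le> (C + 1) * real n powr (-1 - 2 * s)" if "n \<ge> 1" for n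
  proof -
    have "C * real n powr (-2 - 2 * s) \<le> C * real n powr (-1 - 2 * s)"
      using that C(1) by (intro mult_left_mono powr_mono) auto
    with C(2)[OF that] show ?thesis by (simp add: algebra_simps)
  qed
  then show ?thesis using C(1) by (intro exI[of _ "C + 1"]) auto
qed

lemma summable_powr_Suc:
  assumes "p < -1"
  shows "summable (\<lambda>n. real (Suc n) powr p)"
  using summable_Suc_iff[of "\<lambda>n. real n powr p"] summable_real_powr_iff[of p] assms by simp

lemma summable_lap_weight_mult:
  assumes s: "0 < s" "s < 1"
    and f: "summable (\<lambda>n. \<bar>f n\<bar> * real (Suc n) powr (-1 - 2 * s))"
  shows "summable (\<lambda>n. lap_weight s (Suc n) * \<bar>f n\<bar>)"
proof -
  obtain C where C: "C \<ge> 0" "\<And>n. n \<ge> 1 \<Longrightarrow> lap_weight s n \<le> C * real n powr (-1 - 2 * s)"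
    using lap_weight_le[OF s] by blast
  show ?thesis
  proof (rule summable_comparison_test')
    show "summable (\<lambda>n. C * (\<bar>f n\<bar> * real (Suc n) powr (-1 - 2 * s)))"
      by (intro summable_mult f)
    show "norm (lap_weight s (Suc n) * \<bar>f n\<bar>) \<le> C * (\<bar>f n\<bar> * real (Suc n) powr (-1 - 2 * s))" if "n \<ge> 0" for n
    proof -
      have "lap_weight s (Suc n) * \<bar>f n\<bar> \<le> C * real (Suc n) powr (-1 - 2 * s) * \<bar>f n\<bar>"
        by (intro mult_right_mono C(2)) auto
      then show ?thesis using lap_weight_pos[OF s, of "Suc n"] by (simp add: abs_mult mult_ac)
    qed
  qed
qed

text \<open>
  At a fixed time the kernel is \<open>O(t^n / n!)\<close>, far smaller than needed. The bound ensures that the heat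
  semigroup may be applied to samples that are only summable against \<open>n^(-1 - 2 s)\<close>.
\<close>

lemma heat_kernel_decay:
  fixes t s :: real
  assumes t: "t > 0" and s: "0 < s" "s < 1"
  shows "\<exists>C\<ge>0. \<forall>n\<ge>1. heat_kernel (int n) t \<le> C * real n powr (-1 - 2 * s)"
proof -
  define C where "C = exp (t\<^sup>2) * exp (8 * t)"
  have "heat_kernel (int n) t \<le> C * real n powr (-1 - 2 * s)" if n: "n \<ge> 1" for n
  proof -
    have "(\<lambda>k. (t\<^sup>2) ^ k / fact k) sums exp (t\<^sup>2)"
      using has_sum_exp_terms[of "t\<^sup>2"] t by (intro has_sum_imp_sums) auto
    then have S: "(\<lambda>k. t ^ n / fact n * ((t\<^sup>2) ^ k / fact k)) sums (t ^ n / fact n * exp (t\<^sup>2))"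
      by (rule sums_mult)
    have le: "exp (- 2 * t) * (t ^ (2 * k + n) / (fact k * fact (k + n))) \<le> t ^ n / fact n * ((t\<^sup>2) ^ k / fact k)" for k
    proof -
      have "exp (- 2 * t) * (t ^ (2 * k + n) / (fact k * fact (k + n))) \<le> 1 * (t ^ (2 * k + n) / (fact k * fact (k + n)))"
        using t by (intro mult_right_mono) auto
      also have "\<dots> \<le> t ^ (2 * k + n) / (fact k * fact n)"
        using t by (auto intro!: divide_left_mono mult_left_mono fact_mono)
      also have "\<dots> = t ^ n / fact n * ((t\<^sup>2) ^ k / fact k)"
        by (simp add: power_add power_mult) (simp add: mult.commute)
      finally show ?thesis .
    qed
    have "heat_kernel (int n) t \<le> t ^ n / fact n * exp (t\<^sup>2)"
      by (rule sums_le[OF le heat_kernel_sums[OF t] S])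
    moreover have "real n powr (1 + 2 * s) * (t ^ n / fact n) \<le> exp (8 * t)"
    proof -
      \<comment> \<open>Since \<open>1 + 2 s < 3\<close> and \<open>n < 2^n\<close>, the weight is at most \<open>8^n\<close>.\<close>
      have "real n powr (1 + 2 * s) \<le> real n powr 3" using n s by (intro powr_mono) auto
      also have "\<dots> = real n ^ 3" using n powr_realpow[of "real n" 3] by simp
      also have "\<dots> \<le> (2 ^ n) ^ 3" by (intro power_mono) (auto intro: less_imp_le[OF of_nat_less_two_power])
      also have "\<dots> = (8::real) ^ n" by (simp add: power_mult[symmetric] mult.commute[of n]) (simp add: power_mult)
      finally have "real n powr (1 + 2 * s) * (t ^ n / fact n) \<le> 8 ^ n * (t ^ n / fact n)"
        using t by (intro mult_right_mono) auto
      also have "\<dots> = (8 * t) ^ n / fact n" by (simp add: power_mult_distrib)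
      also have "\<dots> \<le> exp (8 * t)"
      proof -
        have "(\<lambda>k. (8 * t) ^ k / fact k) sums exp (8 * t)"
          using has_sum_exp_terms[of "8 * t"] t by (intro has_sum_imp_sums) auto
        then show ?thesis
          using sum_le_suminf[of "\<lambda>k. (8 * t) ^ k / fact k" "{n}"] t by (auto simp: sums_iff)
      qed
      finally show ?thesis .
    qed
    moreover have "real n powr (1 + 2 * s) * real n powr (-1 - 2 * s) = 1" using n by (simp flip: powr_add)
    ultimately show ?thesis
    proof -
      assume 1: "heat_kernel (int n) t \<le> t ^ n / fact n * exp (t\<^sup>2)"
        and 2: "real n powr (1 + 2 * s) * (t ^ n / fact n) \<le> exp (8 * t)"
        and 3: "real n powr (1 + 2 * s) * real n powr (-1 - 2 * s) = 1"
      have "t ^ n / fact n = (real n powr (1 + 2 * s) * (t ^ n / fact n)) * real n powr (-1 - 2 * s)"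
        using 3 by (simp add: mult_ac)
      also have "\<dots> \<le> exp (8 * t) * real n powr (-1 - 2 * s)" by (intro mult_right_mono 2) auto
      finally have "t ^ n / fact n * exp (t\<^sup>2) \<le> exp (8 * t) * real n powr (-1 - 2 * s) * exp (t\<^sup>2)"
        by (intro mult_right_mono) auto
      with 1 show ?thesis by (simp add: C_def mult_ac)
    qed
  qed
  then show ?thesis by (intro exI[of _ C]) (auto simp: C_def)
qed

lemma summable_heat_kernel_mult:
  fixes f :: "nat \<Rightarrow> real"
  assumes t: "t > 0" and s: "0 < s" "s < 1"
    and f: "summable (\<lambda>n. \<bar>f n\<bar> * real (Suc n) powr (-1 - 2 * s))"
  shows "summable (\<lambda>n. heat_kernel (int (Suc n)) t * \<bar>f n\<bar>)"
proof -
  obtain C where C: "C \<ge> 0" "\<And>n. n \<ge> 1 \<Longrightarrow> heat_kernel (int n) t \<le> C * real n powr (-1 - 2 * s)"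
    using heat_kernel_decay[OF t s] by blast
  show ?thesis
  proof (rule summable_comparison_test')
    show "summable (\<lambda>n. C * (\<bar>f n\<bar> * real (Suc n) powr (-1 - 2 * s)))"
      by (intro summable_mult f)
    show "norm (heat_kernel (int (Suc n)) t * \<bar>f n\<bar>) \<le> C * (\<bar>f n\<bar> * real (Suc n) powr (-1 - 2 * s))" if "n \<ge> 0" for n
    proof -
      have "heat_kernel (int (Suc n)) t * \<bar>f n\<bar> \<le> C * real (Suc n) powr (-1 - 2 * s) * \<bar>f n\<bar>"
        by (intro mult_right_mono C(2)) auto
      then show ?thesis using heat_kernel_nonneg[OF t, of "int (Suc n)"] by (simp add: abs_mult mult_ac del: of_nat_Suc)
    qed
  qed
qed

text \<open>
  The kernel has mass \<open>1\<close>, so \<open>v j\<close> may be subtracted under the sum; its symmetry then pairs the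
  neighbours at distance \<open>n\<close>.
\<close>

lemma discrete_heat_eq:
  fixes v :: "int \<Rightarrow> real"
  assumes t: "t > 0"
    and p: "summable (\<lambda>n. heat_kernel (int (Suc n)) t * \<bar>v (j + int (Suc n))\<bar>)"
    and m: "summable (\<lambda>n. heat_kernel (int (Suc n)) t * \<bar>v (j - int (Suc n))\<bar>)"
  shows "(\<lambda>n. heat_kernel (int (Suc n)) t * (v (j + int (Suc n)) + v (j - int (Suc n)) - 2 * v j))
           sums (discrete_heat 1 t v j - v j)"
proof -
  define H where "H n = heat_kernel (int (Suc n)) t" for n
  have H0: "H n \<ge> 0" for n by (simp add: H_def heat_kernel_nonneg[OF t] del: of_nat_Suc)
  have Hm: "heat_kernel (- int (Suc n)) t = H n" for n unfolding H_def by (rule heat_kernel_uminus[OF t])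
  have sp: "summable (\<lambda>n. norm (H n * v (j + int (Suc n))))" "summable (\<lambda>n. norm (H n * v (j - int (Suc n))))"
    using p m H0 by (simp_all add: H_def[symmetric] abs_mult del: of_nat_Suc)
  have hs: "(f has_sum (suminf f)) UNIV" if "summable (\<lambda>n. norm (f n))" for f :: "nat \<Rightarrow> real"
    by (rule norm_summable_imp_has_sum[OF that summable_sums[OF summable_norm_cancel[OF that]]])
  define A B where "A = (\<Sum>n. H n * v (j + int (Suc n)))" and "B = (\<Sum>n. H n * v (j - int (Suc n)))"
  have "((\<lambda>d. heat_kernel d t * v (j - d)) has_sum (heat_kernel 0 t * v (j - 0) + B + A)) UNIV"
    by (rule has_sum_int_split) (use hs[OF sp(1)] hs[OF sp(2)] in \<open>auto simp: A_def B_def Hm H_def[symmetric] simp del: of_nat_Suc\<close>)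
  also have "?this \<longleftrightarrow> ((\<lambda>i. heat_kernel (j - i) t * v i) has_sum (heat_kernel 0 t * v j + B + A)) UNIV"
    by (rule has_sum_reindex_bij_witness[where j = "\<lambda>d. j - d" and i = "\<lambda>d. j - d"]) auto
  finally have 1: "discrete_heat 1 t v j = heat_kernel 0 t * v j + B + A"
    unfolding discrete_heat_def by (simp add: infsumI)
  have "summable H"
  proof -
    have "(\<lambda>d. heat_kernel d t) summable_on range (\<lambda>n. int (Suc n))"
      by (rule summable_on_subset_banach[OF has_sum_imp_summable[OF heat_kernel_has_sum[OF t]] subset_UNIV])
    then have "((\<lambda>d. heat_kernel d t) \<circ> (\<lambda>n. int (Suc n))) summable_on UNIV"
      by (rule summable_on_reindex[THEN iffD1, rotated]) (simp add: inj_on_def)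
    then show ?thesis unfolding o_def H_def by (rule summable_on_imp_summable)
  qed
  moreover from this have "(H has_sum suminf H) UNIV" using H0 by (intro hs) auto
  then have "((\<lambda>d. heat_kernel d t) has_sum (heat_kernel 0 t + suminf H + suminf H)) UNIV"
    by (intro has_sum_int_split) (auto simp: Hm H_def[symmetric] simp del: of_nat_Suc)
  then have "heat_kernel 0 t + suminf H + suminf H = 1"
    using heat_kernel_has_sum[OF t] has_sum_unique by blast
  then have h0: "heat_kernel 0 t = 1 - 2 * suminf H" by simp
  have "(\<lambda>n. H n * v (j + int (Suc n)) + H n * v (j - int (Suc n)) - 2 * v j * H n) sums (A + B - 2 * v j * suminf H)"
    unfolding A_def B_def
    by (intro sums_add sums_diff sums_mult summable_sums \<open>summable H\<close> sp[THEN summable_norm_cancel])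
  moreover have "A + B - 2 * v j * suminf H = discrete_heat 1 t v j - v j" unfolding 1 h0 by (simp add: algebra_simps)
  moreover have "heat_kernel (int (Suc n)) t * (v (j + int (Suc n)) + v (j - int (Suc n)) - 2 * v j)
     = H n * v (j + int (Suc n)) + H n * v (j - int (Suc n)) - 2 * v j * H n" for n
    unfolding H_def[symmetric] by (simp only: ring_distribs right_diff_distrib mult.commute)
  ultimately show ?thesis by (simp only:)
qed

text \<open>
  The time integral and the sum over the neighbours may be interchanged, because the kernel is
  nonnegative and its time integrals, the weights, are summable against the samples. The sign comes from \<open>\<Gamma>(-s) < 0\<close>.
\<close>

lemma frac_discrete_laplacian_unit:
  fixes v :: "int \<Rightarrow> real"
  assumes s: "0 < s" "s < 1"
    and p: "summable (\<lambda>n. \<bar>v (j + int (Suc n))\<bar> * real (Suc n) powr (-1 - 2 * s))"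
    and m: "summable (\<lambda>n. \<bar>v (j - int (Suc n))\<bar> * real (Suc n) powr (-1 - 2 * s))"
  shows "frac_discrete_laplacian s 1 v j
           = frac_const s * (\<Sum>n. lap_weight s (Suc n) * (2 * v j - v (j + int (Suc n)) - v (j - int (Suc n))))"
proof -
  let ?e = "\<lambda>n t k. exp (- 2 * t) * (t ^ (2 * k + Suc n) / (fact k * fact (k + Suc n)))"
  let ?w = "\<lambda>n. real (Suc n) powr (-1 - 2 * s)"
  let ?V = "\<lambda>n. 2 * v j - v (j + int (Suc n)) - v (j - int (Suc n))"
  define c0 where "c0 = 4 powr s * Gamma (1/2 + s) / sqrt pi"
  have c0: "c0 > 0" using s unfolding c0_def by (intro divide_pos_pos mult_pos_pos Gamma_real_pos) auto
  have lw: "lap_weight s (Suc n) > 0" for n using lap_weight_pos[OF s] by simp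
  define g where "g n t = indicator {0<..} t * (heat_kernel (int (Suc n)) t / t powr (1 + s))" for n t
  have g0: "g n t \<ge> 0" for n t using heat_kernel_nonneg[of t] by (auto simp: g_def indicator_def simp del: of_nat_Suc)
  have gm [measurable]: "g n \<in> borel_measurable borel" for n
  proof -
    have "(\<lambda>t. indicator {0<..} t * ((\<Sum>k. ?e n t k) / t powr (1 + s))) \<in> borel_measurable borel"
      by measurable
    also have "(\<lambda>t. indicator {0<..} t * ((\<Sum>k. ?e n t k) / t powr (1 + s))) = g n"
    proof
      fix t :: real
      show "indicator {0<..} t * ((\<Sum>k. ?e n t k) / t powr (1 + s)) = g n t"
        using sums_unique[OF heat_kernel_sums[of t "Suc n"]] unfolding g_def by (cases "t > 0") auto
    qed
    finally show ?thesis .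
  qed
  have gn: "(\<integral>\<^sup>+t. ennreal (g n t) \<partial>lborel) = ennreal (c0 * lap_weight s (Suc n))" for n
    using nn_integral_heat_kernel[OF s, of "Suc n"] by (simp add: g_def c0_def)
  have gi: "has_bochner_integral lborel (g n) (c0 * lap_weight s (Suc n))" for n
    using g0 gn c0 lw[of n] by (intro has_bochner_integral_nn_integral) auto
  define w where "w n = v (j + int (Suc n)) + v (j - int (Suc n)) - 2 * v j" for n
  have sw0: "summable (\<lambda>n. \<bar>w n\<bar> * ?w n)"
  proof (rule summable_comparison_test')
    show "summable (\<lambda>n. \<bar>v (j + int (Suc n))\<bar> * ?w n
       + \<bar>v (j - int (Suc n))\<bar> * ?w n + 2 * \<bar>v j\<bar> * ?w n)"
      using s by (intro summable_add summable_mult p m summable_powr_Suc) auto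
    show "norm (\<bar>w n\<bar> * ?w n) \<le> \<bar>v (j + int (Suc n))\<bar> * ?w n
       + \<bar>v (j - int (Suc n))\<bar> * ?w n + 2 * \<bar>v j\<bar> * ?w n" if "n \<ge> 0" for n
    proof -
      have "\<bar>w n\<bar> \<le> \<bar>v (j + int (Suc n))\<bar> + \<bar>v (j - int (Suc n))\<bar> + 2 * \<bar>v j\<bar>" unfolding w_def by linarith
      then have "\<bar>w n\<bar> * ?w n \<le> (\<bar>v (j + int (Suc n))\<bar> + \<bar>v (j - int (Suc n))\<bar> + 2 * \<bar>v j\<bar>) * ?w n"
        by (intro mult_right_mono) auto
      then show ?thesis by (simp only: distrib_right real_norm_def abs_mult abs_abs abs_of_nonneg[OF powr_ge_zero])
    qed
  qed
  have "(LINT t:{0<..}|lborel. (discrete_heat 1 t v j - v j) / t powr (1 + s)) = (\<integral>t. (\<Sum>n. g n t * w n) \<partial>lborel)"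
    unfolding set_lebesgue_integral_def
  proof (intro Bochner_Integration.integral_cong refl)
    fix t :: real
    show "indicator {0<..} t *\<^sub>R ((discrete_heat 1 t v j - v j) / t powr (1 + s)) = (\<Sum>n. g n t * w n)"
    proof (cases "t > 0")
      case True
      have "(\<lambda>n. heat_kernel (int (Suc n)) t * w n) sums (discrete_heat 1 t v j - v j)"
        unfolding w_def
        by (intro discrete_heat_eq True summable_heat_kernel_mult[OF True s] p m)
      then have "(\<lambda>n. heat_kernel (int (Suc n)) t * w n / t powr (1 + s)) sums ((discrete_heat 1 t v j - v j) / t powr (1 + s))"
        by (rule sums_divide)
      then show ?thesis using True by (simp add: g_def sums_iff del: of_nat_Suc)
    qed (simp add: g_def)
  qed
  also have "\<dots> = (\<Sum>n. \<integral>t. g n t * w n \<partial>lborel)"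
  proof (rule integral_suminf)
    show "integrable lborel (\<lambda>t. g n t * w n)" for n
      using gi[of n] by (auto simp: has_bochner_integral_iff)
    show "AE t in lborel. summable (\<lambda>n. norm (g n t * w n))"
    proof (intro always_eventually allI)
      fix t :: real
      show "summable (\<lambda>n. norm (g n t * w n))"
      proof (cases "t > 0")
        case True
        have "summable (\<lambda>n. heat_kernel (int (Suc n)) t * \<bar>w n\<bar> / t powr (1 + s))"
          by (intro summable_divide summable_heat_kernel_mult[OF True s] sw0)
        then show ?thesis using True heat_kernel_nonneg[OF True]
          by (simp add: g_def abs_mult del: of_nat_Suc)
      qed (simp add: g_def)
    qed
    have "(\<integral>t. norm (g n t * w n) \<partial>lborel) = c0 * (lap_weight s (Suc n) * \<bar>w n\<bar>)" for n
      using gi[of n] g0 by (simp add: abs_mult has_bochner_integral_iff)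
    then show "summable (\<lambda>n. \<integral>t. norm (g n t * w n) \<partial>lborel)"
      using summable_mult[OF summable_lap_weight_mult[OF s sw0], of c0] by (simp only:)
  qed
  also have "\<dots> = (\<Sum>n. c0 * (- 1) * (lap_weight s (Suc n) * ?V n))"
  proof (rule arg_cong[where f = suminf], rule ext)
    fix n
    have "(\<integral>t. g n t * w n \<partial>lborel) = c0 * lap_weight s (Suc n) * w n"
      using gi[of n] by (simp add: has_bochner_integral_iff)
    also have "\<dots> = c0 * (- 1) * (lap_weight s (Suc n) * ?V n)"
      unfolding w_def by (simp only: algebra_simps)
    finally show "(\<integral>t. g n t * w n \<partial>lborel) = \<dots>" .
  qed
  also have "\<dots> = c0 * (- 1) * (\<Sum>n. lap_weight s (Suc n) * ?V n)"
  proof (rule suminf_mult)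
    have "summable (\<lambda>n. norm (lap_weight s (Suc n) * w n))"
      using summable_lap_weight_mult[OF s sw0] by (simp add: abs_mult abs_of_pos[OF lw])
    then have "summable (\<lambda>n. - (lap_weight s (Suc n) * w n))" by (rule summable_minus[OF summable_norm_cancel])
    moreover have "- (lap_weight s (Suc n) * w n) = lap_weight s (Suc n) * ?V n" for n
      unfolding w_def by (simp only: algebra_simps)
    ultimately show "summable (\<lambda>n. lap_weight s (Suc n) * ?V n)"
      by (simp only:)
  qed
  finally have main: "(LINT t:{0<..}|lborel. (discrete_heat 1 t v j - v j) / t powr (1 + s))
     = c0 * (- 1) * (\<Sum>n. lap_weight s (Suc n) * ?V n)" .
  have "- s \<notin> \<int>\<^sub>\<le>\<^sub>0"
  proof
    assume "- s \<in> \<int>\<^sub>\<le>\<^sub>0"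
    then obtain k where "- s = real_of_int k" by (rule nonpos_Ints_cases)
    then have "real_of_int (- 1) < real_of_int k" "real_of_int k < real_of_int 0" using s by simp_all
    then show False by (simp only: of_int_less_iff)
  qed
  then have "Gamma (1 - s) = - s * Gamma (- s)" using Gamma_plus1[of "- s"] by simp
  moreover have "Gamma (1 - s) > 0" using s by (intro Gamma_real_pos) auto
  ultimately have neg: "Gamma (- s) < 0" using s by (simp add: mult_less_0_iff)
  have "1 / Gamma (- s) * (c0 * (- 1)) = frac_const s"
    using neg by (simp add: frac_const_def c0_def powr_half_sqrt)
  then show ?thesis unfolding frac_discrete_laplacian_def main by (simp only: mult.assoc[symmetric])
qed

section \<open>Integrals of powers\<close>

lemma has_bochner_integral_powr_0:
  fixes p c :: real
  assumes "p > -1" "c \<ge> 0"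
  shows "has_bochner_integral lborel (\<lambda>y. indicator {0<..c} y * y powr p) (c powr (p + 1) / (p + 1))"
proof (rule has_bochner_integral_nn_integral)
  have "(\<integral>\<^sup>+y. ennreal (indicator {0<..c} y * y powr p) \<partial>lborel) = (\<integral>\<^sup>+y. ennreal (indicator {0..c} y * y powr p) \<partial>lborel)"
    by (intro nn_integral_cong) (auto simp: indicator_def)
  also have "\<dots> = ennreal (c powr (p + 1) / (p + 1))"
    by (intro nn_integral_has_integral_lebesgue has_integral_powr_from_0 assms) auto
  finally show "(\<integral>\<^sup>+y. ennreal (indicator {0<..c} y * y powr p) \<partial>lborel) = ennreal (c powr (p + 1) / (p + 1))" .
qed (use assms in auto)

lemma set_integrable_powr_0:
  fixes p c :: real
  assumes "p > -1" "c \<ge> 0"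
  shows "set_integrable lborel {0<..c} (\<lambda>y. y powr p)"
  using has_bochner_integral_powr_0[OF assms] by (simp add: set_integrable_def has_bochner_integral_iff)

lemma set_integral_powr_0:
  fixes p c :: real
  assumes "p > -1" "c \<ge> 0"
  shows "(LINT y:{0<..c}|lborel. y powr p) = c powr (p + 1) / (p + 1)"
  using has_bochner_integral_powr_0[OF assms] by (simp add: set_lebesgue_integral_def has_bochner_integral_iff)

lemma set_integrable_powr_inf:
  fixes p c :: real
  assumes "p < -1" "c > 0"
  shows "set_integrable lborel {c<..} (\<lambda>y. y powr p)"
proof -
  have "has_bochner_integral lborel (\<lambda>y. indicator {c..} y * y powr p) (- (c powr (p + 1)) / (p + 1))"
    using assms
    by (intro has_bochner_integral_nn_integral nn_integral_has_integral_lebesgue has_integral_powr_to_inf)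
      (auto intro!: divide_nonneg_neg)
  then have "set_integrable lborel {c..} (\<lambda>y. y powr p)"
    by (simp add: set_integrable_def has_bochner_integral_iff)
  then show ?thesis by (rule set_integrable_subset) auto
qed

section \<open>Second differences of Hoelder functions\<close>

definition sdiff :: "(real \<Rightarrow> real) \<Rightarrow> real \<Rightarrow> real \<Rightarrow> real" where
  "sdiff v x y = 2 * v x - v (x + y) - v (x - y)"

definition holder_bound :: "real \<Rightarrow> real \<Rightarrow> (real \<Rightarrow> real) \<Rightarrow> bool" where
  "holder_bound L \<beta> v \<longleftrightarrow> (\<forall>x y. \<bar>v x - v y\<bar> \<le> L * \<bar>x - y\<bar> powr \<beta>)"

text \<open>
  A function together with candidates for its derivatives. Keeping them as an arbitrary sequence makes
  the notion stable under passing to a derivative, affine substitution, and taking second differences.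
\<close>

definition deriv_chain :: "nat \<Rightarrow> (nat \<Rightarrow> real \<Rightarrow> real) \<Rightarrow> bool" where
  "deriv_chain m d \<longleftrightarrow> (\<forall>i<m. \<forall>x. (d i has_real_derivative d (Suc i) x) (at x))"

lemma deriv_chainD: "deriv_chain m d \<Longrightarrow> i < m \<Longrightarrow> (d i has_real_derivative d (Suc i) x) (at x)"
  by (simp add: deriv_chain_def)

lemma deriv_chain_shift: "deriv_chain (m + i) d \<Longrightarrow> deriv_chain m (\<lambda>j. d (i + j))"
  by (auto simp: deriv_chain_def)

text \<open>
  Over a unit interval beyond \<open>r\<close> the second difference varies by \<open>O(r^e)\<close>, where \<open>e\<close> is this exponent:
  one power less than its size, except that without derivatives only a bound of order \<open>r^0\<close> holds.
\<close>

definition variation_exp :: "nat \<Rightarrow> real \<Rightarrow> real" where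
  "variation_exp m \<beta> = (if m = 0 then 0 else real m - 1 + \<beta>)"

lemma increment_le:
  fixes g g' :: "real \<Rightarrow> real"
  assumes "a \<le> b" and "\<And>t. a \<le> t \<Longrightarrow> t \<le> b \<Longrightarrow> (g has_real_derivative g' t) (at t)"
    and "\<And>t. a < t \<Longrightarrow> t < b \<Longrightarrow> \<bar>g' t\<bar> \<le> B"
  shows "\<bar>g b - g a\<bar> \<le> B * (b - a)"
proof (cases "a = b")
  case False
  then have "a < b" using assms by simp
  from MVT2[OF this assms(2)] obtain z where "a < z" "z < b" "g b - g a = (b - a) * g' z" by blast
  then show ?thesis using assms(1) assms(3)[of z] by (simp add: abs_mult mult.commute mult_right_mono)
qed simp

lemma powr_scaled_le:
  fixes p c y :: real
  assumes "0 \<le> p" "p \<le> 1" "1 \<le> c" "0 \<le> y"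
  shows "(c * y) powr p \<le> c * y powr p"
proof -
  have "(c * y) powr p = c powr p * y powr p" using assms by (simp add: powr_mult)
  also have "c powr p \<le> c powr 1" using assms by (intro powr_mono) auto
  finally show ?thesis using assms by (simp add: mult_right_mono)
qed

lemma holder_boundD: "holder_bound L \<beta> v \<Longrightarrow> \<bar>v x - v y\<bar> \<le> L * \<bar>x - y\<bar> powr \<beta>"
  by (simp add: holder_bound_def)

lemma holder_bound_nonneg: "holder_bound L \<beta> v \<Longrightarrow> L \<ge> 0"
  using holder_boundD[of L \<beta> v 1 0] by (smt (verit) mult_cancel_left1 powr_one_eq_one abs_numeral abs_one abs_ge_zero)

lemma sdiff_profile0:
  assumes "holder_bound L \<beta> v" "0 \<le> \<beta>" "y > 0"
  shows "\<bar>sdiff v x y\<bar> \<le> 2 * L * y powr \<beta>"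
  using holder_boundD[OF assms(1), of x "x + y"] holder_boundD[OF assms(1), of x "x - y"] assms(3)
  unfolding sdiff_def by simp

lemma sdiff_deriv_y:
  assumes "\<And>z. (v has_real_derivative v' z) (at z)"
  shows "((\<lambda>y. sdiff v x y) has_real_derivative (v' (x - y) - v' (x + y))) (at y)"
proof -
  have "((\<lambda>y. v (x + y)) has_real_derivative v' (x + y) * (0 + 1)) (at y)"
    by (rule DERIV_chain2[where f = v and g = "\<lambda>y. x + y"], rule assms) (auto intro!: derivative_eq_intros)
  moreover have "((\<lambda>y. v (x - y)) has_real_derivative v' (x - y) * (0 - 1)) (at y)"
    by (rule DERIV_chain2[where f = v and g = "\<lambda>y. x - y"], rule assms) (auto intro!: derivative_eq_intros)
  ultimately show ?thesis unfolding sdiff_def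
    by (auto intro!: derivative_eq_intros)
qed

lemma sdiff_deriv_x:
  assumes "\<And>z. (v has_real_derivative v' z) (at z)"
  shows "((\<lambda>x. sdiff v x y) has_real_derivative sdiff v' x y) (at x)"
proof -
  have "((\<lambda>x. v (x + y)) has_real_derivative v' (x + y) * (1 + 0)) (at x)"
    by (rule DERIV_chain2[where f = v and g = "\<lambda>x. x + y"], rule assms) (auto intro!: derivative_eq_intros)
  moreover have "((\<lambda>x. v (x - y)) has_real_derivative v' (x - y) * (1 - 0)) (at x)"
    by (rule DERIV_chain2[where f = v and g = "\<lambda>x. x - y"], rule assms) (auto intro!: derivative_eq_intros)
  ultimately show ?thesis unfolding sdiff_def using assms[of x]
    by (auto intro!: derivative_eq_intros)
qed

text \<open>
  The derivative of the second difference in \<open>y\<close> is \<open>v'(x - y) - v'(x + y)\<close>, a difference of \<open>v'\<close> over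
  the distance \<open>2 y\<close>.
\<close>

lemma sdiff_profile1:
  assumes v: "\<And>z. (v has_real_derivative v' z) (at z)"
    and h: "holder_bound L \<beta> v'" and b: "0 \<le> \<beta>" "\<beta> \<le> 1" and y: "y > 0"
  shows "\<bar>v' (x - y) - v' (x + y)\<bar> \<le> 2 * L * y powr \<beta>"
    and "\<bar>sdiff v x y\<bar> \<le> 2 * L * y powr (1 + \<beta>)"
proof -
  have L: "L \<ge> 0" by (rule holder_bound_nonneg[OF h])
  have d: "\<bar>v' (x - t) - v' (x + t)\<bar> \<le> 2 * L * t powr \<beta>" if "t > 0" for t
  proof -
    have "\<bar>v' (x - t) - v' (x + t)\<bar> \<le> L * (2 * t) powr \<beta>" using holder_boundD[OF h, of "x - t" "x + t"] that by simp
    also have "\<dots> \<le> L * (2 * t powr \<beta>)" using that b L by (intro mult_left_mono powr_scaled_le) auto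
    finally show ?thesis by simp
  qed
  from d[OF y] show "\<bar>v' (x - y) - v' (x + y)\<bar> \<le> 2 * L * y powr \<beta>" .
  have "\<bar>sdiff v x y - sdiff v x 0\<bar> \<le> (2 * L * y powr \<beta>) * (y - 0)"
  proof (rule increment_le)
    show "\<bar>v' (x - t) - v' (x + t)\<bar> \<le> 2 * L * y powr \<beta>" if "0 < t" "t < y" for t
    proof -
      have "2 * L * t powr \<beta> \<le> 2 * L * y powr \<beta>" using that b L by (intro mult_left_mono powr_mono2) auto
      with d[OF that(1)] show ?thesis by linarith
    qed
  qed (use y in \<open>auto intro!: sdiff_deriv_y v\<close>)
  then show "\<bar>sdiff v x y\<bar> \<le> 2 * L * y powr (1 + \<beta>)"
    using y by (simp add: sdiff_def powr_add mult_ac)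
qed

text \<open>
  Adding \<open>v''(x) y^2\<close> makes the second derivative in \<open>y\<close> equal to the second difference of \<open>v''\<close>, which is
  \<open>O(y^\<beta>)\<close>; two integrations follow.
\<close>

lemma sdiff_profile2:
  assumes v: "\<And>z. (v has_real_derivative v' z) (at z)" and v': "\<And>z. (v' has_real_derivative v'' z) (at z)"
    and h: "holder_bound L \<beta> v''" and b: "0 \<le> \<beta>" "\<beta> \<le> 1" and y: "y > 0"
  shows "\<bar>v' (x - y) - v' (x + y) + 2 * v'' x * y\<bar> \<le> 2 * L * y powr (1 + \<beta>)"
    and "\<bar>sdiff v x y + v'' x * y\<^sup>2\<bar> \<le> 2 * L * y powr (2 + \<beta>)"
proof -
  have L: "L \<ge> 0" by (rule holder_bound_nonneg[OF h])
  define g where "g t = v' (x - t) - v' (x + t) + 2 * v'' x * t" for t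
  have g': "(g has_real_derivative sdiff v'' x t) (at t)" for t
  proof -
    have "((\<lambda>y. v' (x + y)) has_real_derivative v'' (x + t) * (0 + 1)) (at t)"
      by (rule DERIV_chain2[where f = v' and g = "\<lambda>y. x + y"], rule v') (auto intro!: derivative_eq_intros)
    moreover have "((\<lambda>y. v' (x - y)) has_real_derivative v'' (x - t) * (0 - 1)) (at t)"
      by (rule DERIV_chain2[where f = v' and g = "\<lambda>y. x - y"], rule v') (auto intro!: derivative_eq_intros)
    ultimately show ?thesis unfolding g_def sdiff_def by (auto intro!: derivative_eq_intros)
  qed
  have d: "\<bar>g t\<bar> \<le> 2 * L * t powr (1 + \<beta>)" if t: "t > 0" for t
  proof -
    have "\<bar>g t - g 0\<bar> \<le> (2 * L * t powr \<beta>) * (t - 0)"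
    proof (rule increment_le)
      show "\<bar>sdiff v'' x z\<bar> \<le> 2 * L * t powr \<beta>" if "0 < z" "z < t" for z
      proof -
        have "2 * L * z powr \<beta> \<le> 2 * L * t powr \<beta>" using that b L by (intro mult_left_mono powr_mono2) auto
        with sdiff_profile0[OF h b(1) that(1), of x] show ?thesis by linarith
      qed
    qed (use t in \<open>auto intro!: g'\<close>)
    then show ?thesis using t by (simp add: g_def powr_add mult_ac)
  qed
  from d[OF y] show "\<bar>v' (x - y) - v' (x + y) + 2 * v'' x * y\<bar> \<le> 2 * L * y powr (1 + \<beta>)" by (simp add: g_def)
  have "\<bar>(sdiff v x y + v'' x * y\<^sup>2) - (sdiff v x 0 + v'' x * 0\<^sup>2)\<bar> \<le> (2 * L * y powr (1 + \<beta>)) * (y - 0)"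
  proof (rule increment_le)
    show "((\<lambda>y. sdiff v x y + v'' x * y\<^sup>2) has_real_derivative g t) (at t)" for t
      unfolding g_def using sdiff_deriv_y[OF v, of x t] by (auto intro!: derivative_eq_intros)
    show "\<bar>g t\<bar> \<le> 2 * L * y powr (1 + \<beta>)" if "0 < t" "t < y" for t
    proof -
      have "2 * L * t powr (1 + \<beta>) \<le> 2 * L * y powr (1 + \<beta>)" using that b L by (intro mult_left_mono powr_mono2) auto
      with d[OF that(1)] show ?thesis by linarith
    qed
  qed (use y in auto)
  moreover have "y powr (2 + \<beta>) = y powr (1 + \<beta>) * y" using y by (simp add: powr_add power2_eq_square powr_numeral)
  ultimately show "\<bar>sdiff v x y + v'' x * y\<^sup>2\<bar> \<le> 2 * L * y powr (2 + \<beta>)"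
    using y by (simp add: sdiff_def mult_ac)
qed

text \<open>
  The hypotheses of the comparison between the lattice sum and the integral, for the second difference
  after its quadratic correction.
\<close>

definition profile_bounds :: "real \<Rightarrow> real \<Rightarrow> real \<Rightarrow> (real \<Rightarrow> real) \<Rightarrow> bool" where
  "profile_bounds L \<alpha> \<gamma> \<psi> \<longleftrightarrow> (\<forall>y>0. \<bar>\<psi> y\<bar> \<le> 2 * L * y powr \<alpha>) \<and>
     (\<forall>r\<ge>1. \<forall>y\<in>{r..r+1}. \<bar>\<psi> y - \<psi> r\<bar> \<le> 8 * L * r powr \<gamma>)"

text \<open>
  Each derivative of \<open>v\<close> improves the power of \<open>y\<close> by one. The second one does so only after the Taylor
  term \<open>v''(x) y^2\<close> has been removed.
\<close>

lemma sdiff_profile: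
  assumes d: "deriv_chain m d" and h: "holder_bound L \<beta> (d m)" and b: "0 \<le> \<beta>" "\<beta> \<le> 1" and m: "m \<le> 2"
  shows "\<exists>a. (m < 2 \<longrightarrow> a = 0) \<and>
     profile_bounds L (real m + \<beta>) (variation_exp m \<beta>) (\<lambda>y. sdiff (d 0) x y + a * y\<^sup>2)"
proof -
  have L: "L \<ge> 0" by (rule holder_bound_nonneg[OF h])
  have step: "(2 * L * (r + 1) powr p) * (y - r) \<le> 8 * L * r powr p" if r: "r \<ge> 1" "y \<in> {r..r+1}" and p: "0 \<le> p" "p \<le> 2" for r y p :: real
  proof -
    have "(r + 1) powr p \<le> (2 * r) powr p" using r p by (intro powr_mono2) auto
    also have "\<dots> = 2 powr p * r powr p" using r by (simp add: powr_mult)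
    also have "\<dots> \<le> 2 powr 2 * r powr p" using p by (intro mult_right_mono powr_mono) auto
    finally have *: "(r + 1) powr p \<le> 4 * r powr p" by simp
    have "(2 * L * (r + 1) powr p) * (y - r) \<le> (2 * L * (4 * r powr p)) * 1"
      using r L * by (intro mult_mono mult_left_mono) auto
    then show ?thesis by simp
  qed
  consider "m = 0" | "m = 1" | "m = 2" using m by linarith
  then show ?thesis
  proof cases
    case 1
    have "\<bar>sdiff (d 0) x y - sdiff (d 0) x r\<bar> \<le> 8 * L" if "r \<ge> 1" "y \<in> {r..r+1}" for r y
    proof -
      have "\<bar>y - r\<bar> powr \<beta> \<le> 1" "\<bar>r - y\<bar> powr \<beta> \<le> 1" using that b by (auto intro!: powr_le1)
      then have "L * \<bar>y - r\<bar> powr \<beta> \<le> L" "L * \<bar>r - y\<bar> powr \<beta> \<le> L" using L by (auto intro: mult_left_le)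
      moreover have "\<bar>d 0 (x + y) - d 0 (x + r)\<bar> \<le> L * \<bar>y - r\<bar> powr \<beta>" "\<bar>d 0 (x - y) - d 0 (x - r)\<bar> \<le> L * \<bar>r - y\<bar> powr \<beta>"
        using holder_boundD[OF h, of "x + y" "x + r"] holder_boundD[OF h, of "x - y" "x - r"] 1 by simp_all
      ultimately show ?thesis unfolding sdiff_def using L by linarith
    qed
    then show ?thesis using 1 sdiff_profile0[of L \<beta> "d 0" _ x] h b by (intro exI[of _ 0]) (auto simp: variation_exp_def profile_bounds_def)
  next
    case 2
    have v: "(d 0 has_real_derivative d 1 z) (at z)" for z using deriv_chainD[OF d, of 0 z] 2 by simp
    have "\<bar>sdiff (d 0) x y - sdiff (d 0) x r\<bar> \<le> 8 * L * r powr \<beta>" if r: "r \<ge> 1" "y \<in> {r..r+1}" for r y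
    proof -
      have "\<bar>sdiff (d 0) x y - sdiff (d 0) x r\<bar> \<le> (2 * L * (r + 1) powr \<beta>) * (y - r)"
      proof (rule increment_le)
        show "\<bar>d 1 (x - t) - d 1 (x + t)\<bar> \<le> 2 * L * (r + 1) powr \<beta>" if "r < t" "t < y" for t
        proof -
          have "2 * L * t powr \<beta> \<le> 2 * L * (r + 1) powr \<beta>" using that r b L by (intro mult_left_mono powr_mono2) auto
          with sdiff_profile1(1)[OF v, of L \<beta> t x] h b 2 that r show ?thesis by simp
        qed
      qed (use r v in \<open>auto intro!: sdiff_deriv_y\<close>)
      also have "\<dots> \<le> 8 * L * r powr \<beta>" using r b by (intro step) auto
      finally show ?thesis .
    qed
    then show ?thesis using 2 sdiff_profile1(2)[OF v, of L \<beta> _ x] h b by (intro exI[of _ 0]) (auto simp: variation_exp_def profile_bounds_def)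
  next
    case 3
    have v: "(d 0 has_real_derivative d 1 z) (at z)" "(d 1 has_real_derivative d 2 z) (at z)" for z
      using deriv_chainD[OF d, of 0 z] deriv_chainD[OF d, of 1 z] 3 by (simp_all add: numeral_2_eq_2)
    let ?a = "d 2 x"
    have "\<bar>(sdiff (d 0) x y + ?a * y\<^sup>2) - (sdiff (d 0) x r + ?a * r\<^sup>2)\<bar> \<le> 8 * L * r powr (1 + \<beta>)" if r: "r \<ge> 1" "y \<in> {r..r+1}" for r y
    proof -
      have "\<bar>(sdiff (d 0) x y + ?a * y\<^sup>2) - (sdiff (d 0) x r + ?a * r\<^sup>2)\<bar> \<le> (2 * L * (r + 1) powr (1 + \<beta>)) * (y - r)"
      proof (rule increment_le)
        show "((\<lambda>y. sdiff (d 0) x y + ?a * y\<^sup>2) has_real_derivative (d 1 (x - t) - d 1 (x + t) + 2 * ?a * t)) (at t)" for t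
          using sdiff_deriv_y[OF v(1), of x t] by (auto intro!: derivative_eq_intros)
        show "\<bar>d 1 (x - t) - d 1 (x + t) + 2 * ?a * t\<bar> \<le> 2 * L * (r + 1) powr (1 + \<beta>)" if "r < t" "t < y" for t
        proof -
          have "2 * L * t powr (1 + \<beta>) \<le> 2 * L * (r + 1) powr (1 + \<beta>)" using that r b L by (intro mult_left_mono powr_mono2) auto
          with sdiff_profile2(1)[OF v, of L \<beta> t x] h b 3 that r show ?thesis by simp
        qed
      qed (use r in auto)
      also have "\<dots> \<le> 8 * L * r powr (1 + \<beta>)" using r b by (intro step) auto
      finally show ?thesis .
    qed
    then show ?thesis using 3 sdiff_profile2(2)[OF v, of L \<beta> _ x] h b by (intro exI[of _ ?a]) (auto simp: variation_exp_def profile_bounds_def)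
  qed
qed

text \<open>
  The derivative in \<open>x\<close> of the second difference is the second difference of the derivative, whose
  size is known from the case of one derivative less. No quadratic correction occurs there.
\<close>

lemma sdiff_shift:
  assumes d: "deriv_chain m d" and h: "holder_bound L \<beta> (d m)" and b: "0 \<le> \<beta>" "\<beta> \<le> 1" and m: "m \<le> 2"
    and y: "y \<ge> 1"
  shows "\<bar>sdiff (d 0) \<xi> y - sdiff (d 0) x y\<bar> \<le> 4 * L * (1 + \<bar>\<xi> - x\<bar>) * y powr (variation_exp m \<beta>)"
proof (cases "m = 0")
  case True
  have L: "L \<ge> 0" by (rule holder_bound_nonneg[OF h])
  have "\<bar>\<xi> - x\<bar> powr \<beta> \<le> 1 + \<bar>\<xi> - x\<bar>"
  proof (cases "\<bar>\<xi> - x\<bar> \<le> 1")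
    case True
    then have "\<bar>\<xi> - x\<bar> powr \<beta> \<le> 1" using b by (intro powr_le1) auto
    then show ?thesis by simp
  next
    case False
    then have "\<bar>\<xi> - x\<bar> powr \<beta> \<le> \<bar>\<xi> - x\<bar> powr 1" using b by (intro powr_mono) auto
    then show ?thesis by simp
  qed
  then have "L * \<bar>\<xi> - x\<bar> powr \<beta> \<le> L * (1 + \<bar>\<xi> - x\<bar>)" by (rule mult_left_mono[OF _ L])
  moreover have "\<bar>d 0 \<xi> - d 0 x\<bar> \<le> L * \<bar>\<xi> - x\<bar> powr \<beta>" "\<bar>d 0 (\<xi> + y) - d 0 (x + y)\<bar> \<le> L * \<bar>\<xi> - x\<bar> powr \<beta>"
    "\<bar>d 0 (\<xi> - y) - d 0 (x - y)\<bar> \<le> L * \<bar>\<xi> - x\<bar> powr \<beta>"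
    using holder_boundD[OF h, of \<xi> x] holder_boundD[OF h, of "\<xi> + y" "x + y"] holder_boundD[OF h, of "\<xi> - y" "x - y"] True
    by simp_all
  ultimately have "\<bar>sdiff (d 0) \<xi> y - sdiff (d 0) x y\<bar> \<le> 4 * (L * (1 + \<bar>\<xi> - x\<bar>))"
    unfolding sdiff_def by linarith
  then show ?thesis using True y by (simp add: variation_exp_def)
next
  case False
  then obtain m' where m': "m = Suc m'" by (cases m) auto
  have L: "L \<ge> 0" by (rule holder_bound_nonneg[OF h])
  have v: "(d 0 has_real_derivative d 1 z) (at z)" for z using deriv_chainD[OF d, of 0 z] m' by simp
  have c: "deriv_chain m' (\<lambda>j. d (1 + j))" "holder_bound L \<beta> ((\<lambda>j. d (1 + j)) m')"
    using deriv_chain_shift[of m' 1 d] d h m' by auto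
  have bd: "\<bar>sdiff (d 1) z y\<bar> \<le> 2 * L * y powr (variation_exp m \<beta>)" for z
    using sdiff_profile[OF c b, of z] m m' y by (auto simp: variation_exp_def profile_bounds_def)
  have "\<bar>sdiff (d 0) \<xi> y - sdiff (d 0) x y\<bar> \<le> 2 * L * y powr (variation_exp m \<beta>) * \<bar>\<xi> - x\<bar>"
  proof (cases "x \<le> \<xi>")
    case True
    then show ?thesis using increment_le[of x \<xi> "\<lambda>x. sdiff (d 0) x y" "\<lambda>x. sdiff (d 1) x y"] bd sdiff_deriv_x[OF v] by simp
  next
    case False
    then show ?thesis using increment_le[of \<xi> x "\<lambda>x. sdiff (d 0) x y" "\<lambda>x. sdiff (d 1) x y"] bd sdiff_deriv_x[OF v]
      by (simp add: abs_minus_commute)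
  qed
  also have "\<dots> \<le> 4 * L * (1 + \<bar>\<xi> - x\<bar>) * y powr (variation_exp m \<beta>)"
  proof -
    have "2 * \<bar>\<xi> - x\<bar> * (L * y powr (variation_exp m \<beta>)) \<le> 4 * (1 + \<bar>\<xi> - x\<bar>) * (L * y powr (variation_exp m \<beta>))"
      using L by (intro mult_right_mono) auto
    then show ?thesis by (simp add: mult_ac)
  qed
  finally show ?thesis .
qed

section \<open>Comparison of the lattice sum with the integral\<close>

text \<open>
  Since \<open>n^2 = (n - s) (n + s) + s^2\<close>, the summand is a sum of two Gamma ratios, each of which is a
  difference of consecutive Gamma ratios. The boundary terms at \<open>n = 1\<close> cancel, which is why no
  constant appears on the right.
\<close>

lemma Gamma_ratio_square_sum:
  assumes s: "0 < s" "s < 1"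
  shows "(\<Sum>n<N. lap_weight s (Suc n) * (real (Suc n))\<^sup>2)
     = Gamma (real N + 1 - s) / Gamma (real N + 1 + s) * ((real N + 1 - s) * (real N + s) / (2 - 2 * s) - s / 2)"
proof (induction N)
  case 0
  have "(1 - s) * s / (2 - 2 * s) - s / 2 = 0" using s by (simp add: field_simps)
  then show ?case by simp
next
  case (Suc N)
  define M where "M = real N + 1"
  have M: "M \<ge> 1" by (simp add: M_def)
  define G H where "G = Gamma (M - s)" and "H = Gamma (M + s)"
  have H: "H > 0" unfolding H_def using M s by (intro Gamma_real_pos) auto
  have G1: "Gamma (M + 1 - s) = (M - s) * G" and H1: "Gamma (M + 1 + s) = (M + s) * H"
    using Gamma_real_plus1[of "M - s"] Gamma_real_plus1[of "M + s"] M s by (simp_all add: G_def H_def algebra_simps)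
  have e: "real (Suc N) = M" "real N = M - 1" by (simp_all add: M_def)
  have pos: "M + s > 0" "2 - 2 * s > 0" using M s by auto
  have "G / H * ((M - s) * (M - 1 + s) / (2 - 2 * s) - s / 2) + (G / ((M + s) * H)) * M\<^sup>2
     = ((M - s) * G) / ((M + s) * H) * ((M + 1 - s) * (M + s) / (2 - 2 * s) - s / 2)"
  proof -
    have "((M - s) * (M - 1 + s) / (2 - 2 * s) - s / 2) * (M + s) + M\<^sup>2
       = (M - s) * ((M + 1 - s) * (M + s) / (2 - 2 * s) - s / 2)"
    proof -
      have "(M - s) * ((M + 1 - s) * (M + s) / (2 - 2 * s) - s / 2) - ((M - s) * (M - 1 + s) / (2 - 2 * s) - s / 2) * (M + s)
         = (M - s) * (M + s) * ((2 - 2 * s) / (2 - 2 * s)) + s\<^sup>2"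
        by (simp add: field_simps power2_eq_square add_divide_distrib[symmetric] diff_divide_distrib[symmetric])
      also have "\<dots> = M\<^sup>2" using pos by (simp add: algebra_simps power2_eq_square)
      finally have *: "(M - s) * ((M + 1 - s) * (M + s) / (2 - 2 * s) - s / 2) - ((M - s) * (M - 1 + s) / (2 - 2 * s) - s / 2) * (M + s) = M\<^sup>2" .
      have aux: "y + z = x" if "x - y = z" for x y z :: real using that by simp
      show ?thesis by (rule aux[OF *])
    qed
    moreover have "G / H * P + (G / (K * H)) * Q = G / (K * H) * (P * K + Q)" if "K > 0" for P Q K
      using that H by (simp add: field_simps)
    note this[OF pos(1)]
    ultimately show ?thesis by simp
  qed
  then show ?case
    using Suc.IH unfolding sum.lessThan_Suc lap_weight_def e by (simp add: G1 H1 G_def[symmetric] H_def[symmetric])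
qed

text \<open>
  The subtracted term is the integral of \<open>y^(1 - 2 s)\<close> over \<open>(0, N + 1)\<close>. The difference is
  \<open>O(N^(1 - 2 s))\<close>, hence a null sequence for \<open>s > 1/2\<close>, the range in which the quadratic correction
  is needed.
\<close>

lemma square_sum_minus_integral_tendsto:
  assumes s: "1/2 < s" "s < 1"
  shows "(\<lambda>N. (\<Sum>n<N. lap_weight s (Suc n) * (real (Suc n))\<^sup>2) - real (Suc N) powr (2 - 2 * s) / (2 - 2 * s)) \<longlonglongrightarrow> 0"
proof -
  obtain C where C: "C \<ge> 0" "\<And>n. n \<ge> 1 \<Longrightarrow> \<bar>Gamma (real n + - s) / Gamma (real n + s) - real n powr (- s - s)\<bar> \<le> C * real n powr (- s - s - 1)"
    using Gamma_ratio_asymp[of "- s" s] s by auto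
  let ?q = "\<lambda>x. (x - s) * (x - 1 + s) / (2 - 2 * s) - s / 2"
  have l1: "(\<lambda>N. C * real (Suc N) powr (- s - s - 1) * \<bar>?q (real (Suc N))\<bar>) \<longlonglongrightarrow> 0"
    using s by real_asymp
  have l2: "(\<lambda>N. real (Suc N) powr (- s - s) * ?q (real (Suc N)) - real (Suc N) powr (2 - 2 * s) / (2 - 2 * s)) \<longlonglongrightarrow> 0"
    using s by real_asymp
  have "(\<lambda>N. (Gamma (real (Suc N) + - s) / Gamma (real (Suc N) + s) - real (Suc N) powr (- s - s)) * ?q (real (Suc N))) \<longlonglongrightarrow> 0"
  proof (rule Lim_null_comparison[OF always_eventually l1], rule allI)
    fix N
    show "norm ((Gamma (real (Suc N) + - s) / Gamma (real (Suc N) + s) - real (Suc N) powr (- s - s)) * ?q (real (Suc N)))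
       \<le> C * real (Suc N) powr (- s - s - 1) * \<bar>?q (real (Suc N))\<bar>"
      unfolding abs_mult real_norm_def by (intro mult_right_mono C(2)) auto
  qed
  note T = tendsto_add[OF this l2, unfolded add_0]
  show ?thesis
  proof (rule Lim_transform_eventually[OF T always_eventually], rule allI)
    fix N
    have e: "real (Suc N) + - s = real N + 1 - s" "real (Suc N) + s = real N + 1 + s"
      "real (Suc N) - s = real N + 1 - s" "real (Suc N) - 1 + s = real N + s" by simp_all
    have aux: "(a - b) * q + (b * q - z) = a * q - z" for a b q z :: real by (simp add: algebra_simps)
    have "0 < s" using s by simp
    show "(Gamma (real (Suc N) + - s) / Gamma (real (Suc N) + s) - real (Suc N) powr (- s - s)) * ?q (real (Suc N))
        + (real (Suc N) powr (- s - s) * ?q (real (Suc N)) - real (Suc N) powr (2 - 2 * s) / (2 - 2 * s))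
      = (\<Sum>n<N. lap_weight s (Suc n) * (real (Suc n))\<^sup>2) - real (Suc N) powr (2 - 2 * s) / (2 - 2 * s)"
      unfolding aux Gamma_ratio_square_sum[OF \<open>0 < s\<close> s(2)] e ..
  qed
qed

lemma set_integral_unit_cell_le:
  fixes g :: "real \<Rightarrow> real"
  assumes g: "set_integrable lborel {r<..r+1} g" and B: "\<And>y. y \<in> {r<..r+1} \<Longrightarrow> \<bar>g y\<bar> \<le> B"
  shows "\<bar>LINT y:{r<..r+1}|lborel. g y\<bar> \<le> B"
proof -
  have c: "set_integrable lborel {r<..r+1} (\<lambda>_. B)"
    unfolding set_integrable_def by simp
  have "\<bar>LINT y:{r<..r+1}|lborel. g y\<bar> \<le> (LINT y:{r<..r+1}|lborel. \<bar>g y\<bar>)"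
    using set_integral_norm_bound[OF g] by simp
  also have "\<dots> \<le> (LINT y:{r<..r+1}|lborel. B)"
    using B set_integrable_norm[OF g] by (intro set_integral_mono c) auto
  also have "\<dots> = B" by (simp add: set_lebesgue_integral_def)
  finally show ?thesis .
qed

lemma powr_unit_variation:
  fixes p r y :: real
  assumes p: "0 \<le> p" "p \<le> 3" and r: "r \<ge> 1" "r \<le> y" "y \<le> r + 1"
  shows "\<bar>r powr (- p) - y powr (- p)\<bar> \<le> 3 * r powr (- p - 1)"
proof -
  have "\<bar>y powr (- p) - r powr (- p)\<bar> \<le> (3 * r powr (- p - 1)) * (y - r)"
  proof (rule increment_le[OF r(2)])
    show "((\<lambda>y. y powr (- p)) has_real_derivative (- p * t powr (- p - 1))) (at t)" if "r \<le> t" "t \<le> y" for t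
      using that r by (auto intro!: derivative_eq_intros)
    show "\<bar>- p * t powr (- p - 1)\<bar> \<le> 3 * r powr (- p - 1)" if "r < t" "t < y" for t
    proof -
      have "t powr (- p - 1) \<le> r powr (- p - 1)" using that r p by (intro powr_mono2') auto
      then show ?thesis using p by (auto simp: abs_mult intro!: mult_mono)
    qed
  qed
  also have "\<dots> \<le> (3 * r powr (- p - 1)) * 1" using r by (intro mult_left_mono) auto
  finally show ?thesis by (simp add: abs_minus_commute)
qed

text \<open>
  Each lattice point \<open>n\<close> is compared with the cell \<open>(n, n + 1]\<close>; the cell \<open>(0, 1]\<close> has no partner and is
  small because \<open>\<alpha> > 2 s\<close>. On a cell, the weight, the power of \<open>y\<close> and the corrected function
  \<open>\<psi> y = S y + a y^2\<close> are frozen one after the other. The removed quadratic part contributes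
  \<open>a R N\<close>, where \<open>R N\<close> tends to zero.
\<close>

lemma sum_minus_integral_le:
  fixes s \<alpha> \<gamma> :: real
  assumes s: "0 < s" "s < 1" and \<alpha>: "2 * s < \<alpha>" "\<alpha> < 1 + 2 * s" and \<gamma>: "\<gamma> < 2 * s"
  shows "\<exists>C\<ge>0. \<forall>L\<ge>0. \<forall>S a. (a = 0 \<or> 1/2 < s) \<longrightarrow>
      profile_bounds L \<alpha> \<gamma> (\<lambda>y. S y + a * y\<^sup>2) \<longrightarrow>
      summable (\<lambda>n. lap_weight s (Suc n) * S (real (Suc n))) \<longrightarrow>
      set_integrable lborel {0<..} (\<lambda>y. S y * y powr (-1 - 2 * s)) \<longrightarrow>
      \<bar>(\<Sum>n. lap_weight s (Suc n) * S (real (Suc n))) - (LINT y:{0<..}|lborel. S y * y powr (-1 - 2 * s))\<bar> \<le> C * L"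
proof -
  let ?K = "\<lambda>n. lap_weight s (Suc n)" and ?r = "\<lambda>n. real (Suc n)"
  obtain C1 where C1: "C1 \<ge> 0" "\<And>n. n \<ge> 1 \<Longrightarrow> \<bar>lap_weight s n - real n powr (-1 - 2 * s)\<bar> \<le> C1 * real n powr (-2 - 2 * s)"
    using lap_weight_asymp[OF s] by blast
  \<comment> \<open>The error on the cell \<open>n + 1\<close>: \<open>2 C1\<close> from the weight, \<open>6 = 2 * 3\<close> from the power of \<open>y\<close>, \<open>8\<close> from the variation of \<open>\<psi>\<close>.\<close>
  define d where "d n = (2 * C1 + 6) * ?r n powr (\<alpha> - 2 - 2 * s) + 8 * ?r n powr (\<gamma> - 1 - 2 * s)" for n
  have d0: "d n \<ge> 0" for n using C1 by (simp add: d_def)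
  have sd: "summable d" unfolding d_def using \<alpha> \<gamma> by (intro summable_add summable_mult summable_powr_Suc) auto
  define C where "C = suminf d + 2 / (\<alpha> - 2 * s)"
  have "C \<ge> 0" using \<alpha> suminf_nonneg[OF sd d0] by (simp add: C_def)
  moreover have "\<bar>(\<Sum>n. ?K n * S (?r n)) - (LINT y:{0<..}|lborel. S y * y powr (-1 - 2 * s))\<bar> \<le> C * L"
    if L: "L \<ge> 0" and a: "a = 0 \<or> 1/2 < s"
      and prof: "profile_bounds L \<alpha> \<gamma> (\<lambda>y. S y + a * y\<^sup>2)"
      and sS: "summable (\<lambda>n. ?K n * S (?r n))"
      and iS: "set_integrable lborel {0<..} (\<lambda>y. S y * y powr (-1 - 2 * s))"
    for L S a
  proof -
    let ?w = "\<lambda>y::real. y powr (-1 - 2 * s)"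
    define f where "f y = S y * ?w y" for y
    define Q where "Q y = y powr (1 - 2 * s)" for y :: real
    define P where "P y = f y + a * Q y" for y
    define \<psi> where "\<psi> y = S y + a * y\<^sup>2" for y
    have size: "\<bar>\<psi> y\<bar> \<le> 2 * L * y powr \<alpha>" if "y > 0" for y
      using prof that by (simp add: profile_bounds_def \<psi>_def)
    have var: "\<bar>\<psi> y - \<psi> r\<bar> \<le> 8 * L * r powr \<gamma>" if "r \<ge> 1" "y \<in> {r..r+1}" for r y
      using prof that by (simp add: profile_bounds_def \<psi>_def)
    have P: "P y = \<psi> y * ?w y" if "y > 0" for y
    proof -
      have "y\<^sup>2 * ?w y = Q y" unfolding Q_def using that by (simp add: powr_numeral[symmetric] powr_add[symmetric] del: powr_numeral)
      then show ?thesis by (simp add: P_def f_def \<psi>_def algebra_simps)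
    qed
    have fi: "set_integrable lborel A f" if "A \<subseteq> {0<..}" "A \<in> sets lborel" for A
      using iS unfolding f_def[abs_def] by (rule set_integrable_subset) (use that in auto)
    have Qi: "set_integrable lborel A Q" if "A \<subseteq> {0<..M}" "A \<in> sets lborel" "M \<ge> 0" for A M
      by (rule set_integrable_subset[of _ "{0<..M}"]) (use that s in \<open>auto simp: Q_def[abs_def] intro!: set_integrable_powr_0\<close>)
    have Pi: "set_integrable lborel A P" if "A \<subseteq> {0<..M}" "A \<in> sets lborel" "M \<ge> 0" for A M
      unfolding P_def[abs_def] using that by (intro set_integral_add(1) set_integrable_mult_right fi Qi[of A M]) auto
    have Qint: "(LINT y:{0<..M}|lborel. Q y) = M powr (2 - 2 * s) / (2 - 2 * s)" if "M \<ge> 0" for M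
      using set_integral_powr_0[of "1 - 2 * s" M] that s by (simp add: Q_def)
    have Pint: "(LINT y:{0<..M}|lborel. P y) = (LINT y:{0<..M}|lborel. f y) + a * (M powr (2 - 2 * s) / (2 - 2 * s))" if "M \<ge> 0" for M
    proof -
      have "(LINT y:{0<..M}|lborel. P y) = (LINT y:{0<..M}|lborel. f y) + (LINT y:{0<..M}|lborel. a * Q y)"
        unfolding P_def[abs_def] using that by (intro set_integral_add(2) set_integrable_mult_right fi Qi[of _ M]) auto
      then show ?thesis using that by (simp add: Qint)
    qed
    have split: "(LINT y:{0<..real (Suc N)}|lborel. P y) = (LINT y:{0<..1}|lborel. P y) + (\<Sum>n<N. LINT y:{?r n<..?r n + 1}|lborel. P y)" for N
    proof (induction N)
      case (Suc N)
      have "{0<..real (Suc (Suc N))} = {0<..real (Suc N)} \<union> {real (Suc N)<..real (Suc N) + 1}" by auto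
      then have "(LINT y:{0<..real (Suc (Suc N))}|lborel. P y) = (LINT y:{0<..real (Suc N)}|lborel. P y) + (LINT y:{real (Suc N)<..real (Suc N) + 1}|lborel. P y)"
        by (simp only:) (intro set_integral_Un Pi[of _ "real (Suc N) + 1"]; auto)
      then show ?case using Suc.IH by simp
    qed simp
    have cell: "\<bar>?K n * \<psi> (?r n) - (LINT y:{?r n<..?r n + 1}|lborel. P y)\<bar> \<le> L * d n" for n
    proof -
      define r where "r = ?r n"
      have r: "r \<ge> 1" by (simp add: r_def)
      have ip: "set_integrable lborel {r<..r+1} P" by (intro Pi[of _ "r + 1"]) (use r in auto)
      have ic: "set_integrable lborel {r<..r+1} (\<lambda>_. \<psi> r * ?w r)" unfolding set_integrable_def by simp
      have \<psi>r: "\<bar>\<psi> r\<bar> \<le> 2 * L * r powr \<alpha>" using size r by simp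
      have w1: "\<bar>?K n - ?w r\<bar> \<le> C1 * r powr (-2 - 2 * s)" using C1(2)[of "Suc n"] by (simp add: r_def)
      have "\<bar>LINT y:{r<..r+1}|lborel. \<psi> r * ?w r - P y\<bar> \<le> 6 * L * r powr (\<alpha> - 2 - 2 * s) + 8 * L * r powr (\<gamma> - 1 - 2 * s)"
      proof (rule set_integral_unit_cell_le)
        show "set_integrable lborel {r<..r+1} (\<lambda>y. \<psi> r * ?w r - P y)" by (intro set_integral_diff(1) ic ip)
        fix y assume y: "y \<in> {r<..r+1}"
        have "\<psi> r * ?w r - P y = \<psi> r * (?w r - ?w y) - (\<psi> y - \<psi> r) * ?w y"
          using P[of y] y r by (simp add: algebra_simps)
        then have "\<bar>\<psi> r * ?w r - P y\<bar> \<le> \<bar>\<psi> r * (?w r - ?w y)\<bar> + \<bar>(\<psi> y - \<psi> r) * ?w y\<bar>" by linarith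
        also have "\<bar>\<psi> r * (?w r - ?w y)\<bar> \<le> (2 * L * r powr \<alpha>) * (3 * r powr (-2 - 2 * s))"
        proof -
          have "\<bar>?w r - ?w y\<bar> \<le> 3 * r powr (-2 - 2 * s)"
            using powr_unit_variation[of "1 + 2 * s" r y] s r y by (simp add: algebra_simps)
          then show ?thesis unfolding abs_mult using \<psi>r L by (intro mult_mono) auto
        qed
        also have "\<bar>(\<psi> y - \<psi> r) * ?w y\<bar> \<le> (8 * L * r powr \<gamma>) * ?w r"
        proof -
          have "\<bar>\<psi> y - \<psi> r\<bar> \<le> 8 * L * r powr \<gamma>" using var r y by simp
          moreover have "?w y \<le> ?w r" using r y s by (intro powr_mono2') auto
          ultimately show ?thesis unfolding abs_mult using L by (intro mult_mono) auto
        qed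
        also have "(2 * L * r powr \<alpha>) * (3 * r powr (-2 - 2 * s)) + (8 * L * r powr \<gamma>) * ?w r = 6 * L * r powr (\<alpha> - 2 - 2 * s) + 8 * L * r powr (\<gamma> - 1 - 2 * s)"
          by (simp add: powr_add[symmetric] mult.assoc mult.left_commute[of "r powr _"] algebra_simps)
        finally show "\<bar>\<psi> r * ?w r - P y\<bar> \<le> 6 * L * r powr (\<alpha> - 2 - 2 * s) + 8 * L * r powr (\<gamma> - 1 - 2 * s)" by simp
      qed
      moreover have "(LINT y:{r<..r+1}|lborel. \<psi> r * ?w r - P y) = \<psi> r * ?w r - (LINT y:{r<..r+1}|lborel. P y)"
        by (subst set_integral_diff(2)[OF ic ip]) (simp add: set_lebesgue_integral_def)
      moreover have "\<bar>(?K n - ?w r) * \<psi> r\<bar> \<le> 2 * C1 * L * r powr (\<alpha> - 2 - 2 * s)"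
      proof -
        have "\<bar>(?K n - ?w r) * \<psi> r\<bar> \<le> (C1 * r powr (-2 - 2 * s)) * (2 * L * r powr \<alpha>)"
          unfolding abs_mult using w1 \<psi>r C1(1) by (intro mult_mono) auto
        also have "\<dots> = 2 * C1 * L * (r powr \<alpha> * r powr (-2 - 2 * s))" by simp
        also have "r powr \<alpha> * r powr (-2 - 2 * s) = r powr (\<alpha> - 2 - 2 * s)" by (simp add: powr_add[symmetric] algebra_simps)
        finally show ?thesis .
      qed
      ultimately have "\<bar>?K n * \<psi> r - (LINT y:{r<..r+1}|lborel. P y)\<bar>
          \<le> 2 * C1 * L * r powr (\<alpha> - 2 - 2 * s) + (6 * L * r powr (\<alpha> - 2 - 2 * s) + 8 * L * r powr (\<gamma> - 1 - 2 * s))"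
      proof -
        have aux: "\<bar>x - q\<bar> \<le> A + B" if "\<bar>i\<bar> \<le> B" "i = z - q" "\<bar>x - z\<bar> \<le> A" for x q A B i z :: real
          using that by linarith
        assume "\<bar>LINT y:{r<..r+1}|lborel. \<psi> r * ?w r - P y\<bar> \<le> 6 * L * r powr (\<alpha> - 2 - 2 * s) + 8 * L * r powr (\<gamma> - 1 - 2 * s)"
          "(LINT y:{r<..r+1}|lborel. \<psi> r * ?w r - P y) = \<psi> r * ?w r - (LINT y:{r<..r+1}|lborel. P y)"
          "\<bar>(?K n - ?w r) * \<psi> r\<bar> \<le> 2 * C1 * L * r powr (\<alpha> - 2 - 2 * s)"
        then show ?thesis by (intro aux) (simp_all add: left_diff_distrib right_diff_distrib mult.commute)
      qed
      also have "\<dots> = L * d n" by (simp add: d_def r_def algebra_simps)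
      finally show ?thesis by (simp only: r_def)
    qed
    have first: "\<bar>LINT y:{0<..1}|lborel. P y\<bar> \<le> L * (2 / (\<alpha> - 2 * s))"
    proof -
      have ip: "set_integrable lborel {0<..1} P" by (intro Pi[of _ 1]) auto
      have iq: "set_integrable lborel {0<..1} (\<lambda>y. 2 * L * y powr (\<alpha> - 1 - 2 * s))"
        using \<alpha> by (intro set_integrable_mult_right set_integrable_powr_0) auto
      have "\<bar>LINT y:{0<..1}|lborel. P y\<bar> \<le> (LINT y:{0<..1}|lborel. \<bar>P y\<bar>)"
        using set_integral_norm_bound[OF ip] by simp
      also have "\<dots> \<le> (LINT y:{0<..1}|lborel. 2 * L * y powr (\<alpha> - 1 - 2 * s))"
      proof (rule set_integral_mono)
        show "set_integrable lborel {0<..1} (\<lambda>y. \<bar>P y\<bar>)" using set_integrable_norm[OF ip] by simp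
        fix y :: real assume y: "y \<in> {0<..1}"
        have "\<bar>P y\<bar> = \<bar>\<psi> y\<bar> * ?w y" using P y by (simp add: abs_mult)
        also have "\<dots> \<le> (2 * L * y powr \<alpha>) * ?w y" using size y by (intro mult_right_mono) auto
        also have "\<dots> = 2 * L * y powr (\<alpha> - 1 - 2 * s)" by (simp add: powr_add[symmetric] mult.assoc algebra_simps)
        finally show "\<bar>P y\<bar> \<le> 2 * L * y powr (\<alpha> - 1 - 2 * s)" .
      qed (rule iq)
      also have "\<dots> = 2 * L * (1 / (\<alpha> - 2 * s))"
        using \<alpha> set_integral_powr_0[of "\<alpha> - 1 - 2 * s" 1] by (simp add: algebra_simps)
      finally show ?thesis by (simp add: mult.commute)
    qed
    define R where "R N = (\<Sum>n<N. ?K n * (?r n)\<^sup>2) - real (Suc N) powr (2 - 2 * s) / (2 - 2 * s)" for N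
    have aR: "(\<lambda>N. a * R N) \<longlonglongrightarrow> 0"
    proof (cases "a = 0")
      case False
      then have "R \<longlonglongrightarrow> 0" using square_sum_minus_integral_tendsto[of s] a s unfolding R_def[abs_def] by simp
      from tendsto_mult_left[OF this, of a] show ?thesis by simp
    qed simp
    define D where "D N = (\<Sum>n<N. ?K n * S (?r n)) - (LINT y:{0<..real (Suc N)}|lborel. f y)" for N
    have D: "D N = (\<Sum>n<N. ?K n * \<psi> (?r n) - (LINT y:{?r n<..?r n + 1}|lborel. P y))
        - (LINT y:{0<..1}|lborel. P y) - a * R N" for N
    proof -
      have "?K n * \<psi> (?r n) = ?K n * S (?r n) + a * (?K n * (?r n)\<^sup>2)" for n
        unfolding \<psi>_def by (simp only: distrib_left mult.left_commute)
      then have "(\<Sum>n<N. ?K n * \<psi> (?r n)) = (\<Sum>n<N. ?K n * S (?r n)) + a * (\<Sum>n<N. ?K n * (?r n)\<^sup>2)"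
        by (simp only: sum.distrib sum_distrib_left)
      moreover have "(LINT y:{0<..real (Suc N)}|lborel. P y) = (LINT y:{0<..real (Suc N)}|lborel. f y) + a * (real (Suc N) powr (2 - 2 * s) / (2 - 2 * s))"
        by (rule Pint) simp
      moreover have "a * R N = a * (\<Sum>n<N. ?K n * (?r n)\<^sup>2) - a * (real (Suc N) powr (2 - 2 * s) / (2 - 2 * s))"
        unfolding R_def by (rule right_diff_distrib)
      ultimately show ?thesis unfolding D_def sum_subtractf using split[of N] by linarith
    qed
    have Db: "\<bar>D N\<bar> \<le> C * L + \<bar>a * R N\<bar>" for N
    proof -
      let ?e = "\<lambda>n. ?K n * \<psi> (?r n) - (LINT y:{?r n<..?r n + 1}|lborel. P y)"
      have "\<bar>\<Sum>n<N. ?e n\<bar> \<le> (\<Sum>n<N. \<bar>?e n\<bar>)" by (rule sum_abs)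
      also have "\<dots> \<le> (\<Sum>n<N. L * d n)" by (intro sum_mono cell)
      also have "\<dots> \<le> L * suminf d"
        unfolding sum_distrib_left[symmetric] using sum_le_suminf[OF sd, of "{..<N}"] d0 L by (intro mult_left_mono) auto
      finally have "\<bar>D N\<bar> \<le> L * suminf d + L * (2 / (\<alpha> - 2 * s)) + \<bar>a * R N\<bar>"
        unfolding D using first by linarith
      also have "\<dots> = C * L + \<bar>a * R N\<bar>" by (simp add: C_def algebra_simps)
      finally show ?thesis .
    qed
    have "(\<lambda>N. LINT y:{0<..real (Suc N)}|lborel. f y) \<longlonglongrightarrow> (LINT y:(\<Union>N. {0<..real (Suc N)})|lborel. f y)"
      by (intro set_integral_cont_up fi) (auto simp: incseq_def)
    also have "(\<Union>N. {0<..real (Suc N)}) = {0<..}"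
    proof (intro equalityI subsetI)
      fix x :: real assume "x \<in> {0<..}"
      obtain n where "x \<le> real n" using real_arch_simple by blast
      then have "x \<le> ?r n" by simp
      with \<open>x \<in> {0<..}\<close> show "x \<in> (\<Union>N. {0<..real (Suc N)})" by (intro UN_I[of n]) auto
    qed auto
    finally have If: "(\<lambda>N. LINT y:{0<..real (Suc N)}|lborel. f y) \<longlonglongrightarrow> (LINT y:{0<..}|lborel. f y)" .
    have "D \<longlonglongrightarrow> (\<Sum>n. ?K n * S (?r n)) - (LINT y:{0<..}|lborel. f y)"
      unfolding D_def[abs_def] by (intro tendsto_diff If summable_LIMSEQ sS)
    then have "(\<lambda>N. \<bar>D N\<bar>) \<longlonglongrightarrow> \<bar>(\<Sum>n. ?K n * S (?r n)) - (LINT y:{0<..}|lborel. f y)\<bar>"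
      by (rule tendsto_rabs)
    moreover have "(\<lambda>N. C * L + \<bar>a * R N\<bar>) \<longlonglongrightarrow> C * L + \<bar>0\<bar>"
      by (intro tendsto_add tendsto_const tendsto_rabs aR)
    ultimately have "\<bar>(\<Sum>n. ?K n * S (?r n)) - (LINT y:{0<..}|lborel. f y)\<bar> \<le> C * L + \<bar>0\<bar>"
      by (rule LIMSEQ_le) (use Db in blast)
    then show ?thesis by (simp add: f_def)
  qed
  ultimately show ?thesis by blast
qed

section \<open>Growth at infinity\<close>

lemma deriv_chain_continuous:
  assumes "deriv_chain k d" "continuous_on UNIV (d k)" "i \<le> k"
  shows "continuous_on UNIV (d i)"
proof (cases "i = k")
  case False
  then have "(d i has_real_derivative d (Suc i) x) (at x)" for x
    using deriv_chainD[OF assms(1), of i x] assms(3) by simp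
  then show ?thesis by (intro continuous_at_imp_continuous_on) (auto dest: DERIV_isCont)
qed (use assms in simp)

text \<open>
  If \<open>d j\<close> is small at a point of the first third and at a point of the last third of an interval, then
  the mean value theorem gives a point between them at which \<open>d (j + 1)\<close> is small.
\<close>

lemma exists_small_derivative:
  "\<forall>l>0. \<exists>c\<ge>0. \<forall>d a. deriv_chain j d \<longrightarrow> continuous_on UNIV (d 0) \<longrightarrow>
     (\<exists>p\<in>{a..a+l}. \<bar>d j p\<bar> \<le> c * integral {a..a+l} (\<lambda>y. \<bar>d 0 y\<bar>))"
proof (induction j)
  case 0
  show ?case
  proof (intro allI impI)
    fix l :: real assume l: "l > 0"
    have "\<exists>p\<in>{a..a+l}. \<bar>d 0 p\<bar> \<le> (1 / l) * integral {a..a+l} (\<lambda>y. \<bar>d 0 y\<bar>)"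
      if c: "continuous_on UNIV (d 0)" for d :: "nat \<Rightarrow> real \<Rightarrow> real" and a :: real
    proof -
      have c': "continuous_on {a..a+l} (\<lambda>y. \<bar>d 0 y\<bar>)"
        by (intro continuous_on_rabs continuous_on_subset[OF c]) auto
      obtain p where p: "p \<in> {a..a+l}" "\<And>y. y \<in> {a..a+l} \<Longrightarrow> \<bar>d 0 p\<bar> \<le> \<bar>d 0 y\<bar>"
        using continuous_attains_inf[OF _ _ c'] l by auto
      have "integral {a..a+l} (\<lambda>_. \<bar>d 0 p\<bar>) \<le> integral {a..a+l} (\<lambda>y. \<bar>d 0 y\<bar>)"
        using p(2) by (intro integral_le integrable_continuous_interval c') auto
      then have "l * \<bar>d 0 p\<bar> \<le> integral {a..a+l} (\<lambda>y. \<bar>d 0 y\<bar>)" using l by simp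
      then have "\<bar>d 0 p\<bar> \<le> (1 / l) * integral {a..a+l} (\<lambda>y. \<bar>d 0 y\<bar>)" using l by (simp add: field_simps)
      then show ?thesis using p(1) by blast
    qed
    then show "\<exists>c\<ge>0. \<forall>d a. deriv_chain 0 d \<longrightarrow> continuous_on UNIV (d 0) \<longrightarrow>
       (\<exists>p\<in>{a..a+l}. \<bar>d 0 p\<bar> \<le> c * integral {a..a+l} (\<lambda>y. \<bar>d 0 y\<bar>))"
      using l by (intro exI[of _ "1 / l"]) auto
  qed
next
  case (Suc j)
  show ?case
  proof (intro allI impI)
    fix l :: real assume l: "l > 0"
    then have "l / 3 > 0" by simp
    with Suc.IH obtain c where c: "c \<ge> 0" and
      IH: "\<And>d a. deriv_chain j d \<Longrightarrow> continuous_on UNIV (d 0) \<Longrightarrow>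
       (\<exists>p\<in>{a..a+l/3}. \<bar>d j p\<bar> \<le> c * integral {a..a+l/3} (\<lambda>y. \<bar>d 0 y\<bar>))" by blast
    have "\<exists>p\<in>{a..a+l}. \<bar>d (Suc j) p\<bar> \<le> (6 / l * c) * integral {a..a+l} (\<lambda>y. \<bar>d 0 y\<bar>)"
      if d: "deriv_chain (Suc j) d" and cd: "continuous_on UNIV (d 0)" for d a
    proof -
      let ?I = "integral {a..a+l} (\<lambda>y. \<bar>d 0 y\<bar>)"
      have io: "(\<lambda>y. \<bar>d 0 y\<bar>) integrable_on {u..v}" for u v
        by (intro integrable_continuous_interval continuous_on_rabs continuous_on_subset[OF cd]) auto
      have dj: "deriv_chain j d" using d by (auto simp: deriv_chain_def)
      have sub: "c * integral {u..v} (\<lambda>y. \<bar>d 0 y\<bar>) \<le> c * ?I" if "a \<le> u" "v \<le> a + l" for u v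
        using that by (intro mult_left_mono c integral_subset_le io) auto
      obtain p where p: "p \<in> {a..a+l/3}" "\<bar>d j p\<bar> \<le> c * ?I"
        using IH[OF dj cd, of a] sub[of a "a + l/3"] l by fastforce
      obtain q where q: "q \<in> {a+2*l/3..a+2*l/3+l/3}" "\<bar>d j q\<bar> \<le> c * ?I"
        using IH[OF dj cd, of "a + 2*l/3"] sub[of "a + 2*l/3" "a+2*l/3+l/3"] l by fastforce
      have pq: "q - p \<ge> l / 3" "p < q" using p q l by auto
      obtain z where z: "p < z" "z < q" "d j q - d j p = (q - p) * d (Suc j) z"
        using MVT2[OF pq(2), of "d j" "d (Suc j)"] deriv_chainD[OF d] by auto
      have "l / 3 * \<bar>d (Suc j) z\<bar> \<le> (q - p) * \<bar>d (Suc j) z\<bar>" using pq by (intro mult_right_mono) auto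
      also have "\<dots> = \<bar>d j q - d j p\<bar>" using z(3) pq by (simp add: abs_mult)
      also have "\<dots> \<le> 2 * (c * ?I)" using p(2) q(2) by linarith
      finally have "\<bar>d (Suc j) z\<bar> \<le> (6 / l * c) * ?I" using l by (simp add: field_simps)
      then show ?thesis using z p q l by (intro bexI[of _ z]) auto
    qed
    then show "\<exists>c\<ge>0. \<forall>d a. deriv_chain (Suc j) d \<longrightarrow> continuous_on UNIV (d 0) \<longrightarrow>
       (\<exists>p\<in>{a..a+l}. \<bar>d (Suc j) p\<bar> \<le> c * integral {a..a+l} (\<lambda>y. \<bar>d 0 y\<bar>))"
      using l c by (intro exI[of _ "6 / l * c"]) auto
  qed
qed

text \<open>
  At one point the top derivative is bounded by the integral, and it oscillates by at most \<open>M\<close>; it then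
  bounds the oscillation of the derivative below it, and so on down to \<open>d 0\<close>. The length \<open>3\<close> leaves room
  for a shift by one to either side of a unit cell.
\<close>

lemma derivatives_le_integral:
  "\<exists>C\<ge>0. \<forall>d a M. deriv_chain k d \<longrightarrow> continuous_on UNIV (d 0) \<longrightarrow>
     (\<forall>x\<in>{a..a+3}. \<forall>y\<in>{a..a+3}. \<bar>d k x - d k y\<bar> \<le> M) \<longrightarrow>
     (\<forall>i\<le>k. \<forall>x\<in>{a..a+3}. \<bar>d i x\<bar> \<le> C * (integral {a..a+3} (\<lambda>y. \<bar>d 0 y\<bar>) + M))"
proof (induction k)
  case 0
  obtain c where c: "c \<ge> 0" "\<And>d a. deriv_chain 0 d \<Longrightarrow> continuous_on UNIV (d 0) \<Longrightarrow>
     (\<exists>p\<in>{a..a+3}. \<bar>d 0 p\<bar> \<le> c * integral {a..a+3} (\<lambda>y. \<bar>d 0 y\<bar>))"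
    using exists_small_derivative[of 0, rule_format, of 3] by auto
  have "\<bar>d 0 x\<bar> \<le> (c + 1) * (integral {a..a+3} (\<lambda>y. \<bar>d 0 y\<bar>) + M)"
    if d: "deriv_chain 0 d" "continuous_on UNIV (d 0)"
      and M: "\<forall>x\<in>{a..a+3}. \<forall>y\<in>{a..a+3}. \<bar>d 0 x - d 0 y\<bar> \<le> M" and x: "x \<in> {a..a+3}"
    for d :: "nat \<Rightarrow> real \<Rightarrow> real" and a M x
  proof -
    let ?I = "integral {a..a+3} (\<lambda>y. \<bar>d 0 y\<bar>)"
    obtain p where p: "p \<in> {a..a+3}" "\<bar>d 0 p\<bar> \<le> c * ?I" using c(2)[OF d] by blast
    have "?I \<ge> 0" by (rule integral_nonneg)
      (auto intro!: integrable_continuous_interval continuous_on_rabs continuous_on_subset[OF d(2)])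
    moreover have M0: "M \<ge> 0" using M[rule_format, OF x x] by simp
    moreover have "\<bar>d 0 x\<bar> \<le> c * ?I + M" using M[rule_format, OF x p(1)] p(2) by linarith
    moreover have "(c + 1) * (?I + M) = c * ?I + M + (c * M + ?I)" by (simp add: algebra_simps)
    moreover have "c * M \<ge> 0" using c M0 by simp
    ultimately show ?thesis by linarith
  qed
  then show ?case using c(1) by (intro exI[of _ "c + 1"]) auto
next
  case (Suc k)
  obtain C where C: "C \<ge> 0" and IH: "\<And>d a M i x. deriv_chain k d \<Longrightarrow> continuous_on UNIV (d 0) \<Longrightarrow>
     (\<forall>x\<in>{a..a+3}. \<forall>y\<in>{a..a+3}. \<bar>d k x - d k y\<bar> \<le> M) \<Longrightarrow> i \<le> k \<Longrightarrow> x \<in> {a..a+3} \<Longrightarrow>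
     \<bar>d i x\<bar> \<le> C * (integral {a..a+3} (\<lambda>y. \<bar>d 0 y\<bar>) + M)" using Suc.IH by blast
  obtain c where c: "c \<ge> 0" "\<And>d a. deriv_chain (Suc k) d \<Longrightarrow> continuous_on UNIV (d 0) \<Longrightarrow>
     (\<exists>p\<in>{a..a+3}. \<bar>d (Suc k) p\<bar> \<le> c * integral {a..a+3} (\<lambda>y. \<bar>d 0 y\<bar>))"
    using exists_small_derivative[of "Suc k", rule_format, of 3] by auto
  \<comment> \<open>Large enough for \<open>c I + M\<close> (the top derivative) and for \<open>C (I + 3 (c I + M))\<close> (the others).\<close>
  define C' where "C' = c + 1 + C * (4 + 3 * c)"
  have C': "C' \<ge> 0" using c C by (simp add: C'_def)
  have "\<bar>d i x\<bar> \<le> C' * (integral {a..a+3} (\<lambda>y. \<bar>d 0 y\<bar>) + M)"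
    if d: "deriv_chain (Suc k) d" "continuous_on UNIV (d 0)"
      and M: "\<forall>x\<in>{a..a+3}. \<forall>y\<in>{a..a+3}. \<bar>d (Suc k) x - d (Suc k) y\<bar> \<le> M"
      and x: "x \<in> {a..a+3}" and i: "i \<le> Suc k"
    for d :: "nat \<Rightarrow> real \<Rightarrow> real" and a M x i
  proof -
    let ?I = "integral {a..a+3} (\<lambda>y. \<bar>d 0 y\<bar>)"
    obtain p where p: "p \<in> {a..a+3}" "\<bar>d (Suc k) p\<bar> \<le> c * ?I" using c(2)[OF d] by blast
    have I0: "?I \<ge> 0" by (rule integral_nonneg)
      (auto intro!: integrable_continuous_interval continuous_on_rabs continuous_on_subset[OF d(2)])
    have M0: "M \<ge> 0" using M[rule_format, OF x x] by simp
    have top: "\<bar>d (Suc k) y\<bar> \<le> c * ?I + M" if "y \<in> {a..a+3}" for y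
      using M[rule_format, OF that p(1)] p(2) by linarith
    have nn: "c * M \<ge> 0" "c * ?I \<ge> 0" "C * ?I \<ge> 0" "C * M \<ge> 0" "C * (c * M) \<ge> 0" "C * (c * ?I) \<ge> 0"
      using c C M0 I0 by auto
    have E: "C' * (?I + M) = (c * ?I + M) + (c * M + ?I) + C * (?I + 3 * (c * ?I + M)) + (3 * (C * ?I) + C * M + 3 * (C * (c * M)))"
      unfolding C'_def by (simp add: algebra_simps)
    show ?thesis
    proof (cases "i = Suc k")
      case True
      have "C * (?I + 3 * (c * ?I + M)) \<ge> 0" using C nn I0 M0 by (intro mult_nonneg_nonneg) auto
      then show ?thesis unfolding True using top[OF x] nn I0 E by linarith
    next
      case False
      have osc: "\<forall>x\<in>{a..a+3}. \<forall>y\<in>{a..a+3}. \<bar>d k x - d k y\<bar> \<le> 3 * (c * ?I + M)"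
      proof (intro ballI)
        have *: "\<bar>d k y - d k x\<bar> \<le> 3 * (c * ?I + M)" if "x \<in> {a..a+3}" "y \<in> {a..a+3}" "x \<le> y" for x y
        proof -
          have "\<bar>d k y - d k x\<bar> \<le> (c * ?I + M) * (y - x)"
            using that by (intro increment_le[where g' = "d (Suc k)"] top deriv_chainD[OF d(1)]) auto
          also have "\<dots> \<le> (c * ?I + M) * 3" using that nn M0 by (intro mult_left_mono) auto
          finally show ?thesis by simp
        qed
        fix x y assume "x \<in> {a..a+3}" "y \<in> {a..a+3}"
        then show "\<bar>d k x - d k y\<bar> \<le> 3 * (c * ?I + M)"
          using *[of x y] *[of y x] by (cases "x \<le> y") (auto simp: abs_minus_commute)
      qed
      have dk: "deriv_chain k d" using d by (auto simp: deriv_chain_def)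
      have "\<bar>d i x\<bar> \<le> C * (?I + 3 * (c * ?I + M))" by (rule IH[of d a _ i x, OF dk d(2) osc]) (use False i x in auto)
      then show ?thesis using nn I0 M0 E by linarith
    qed
  qed
  then show ?case using C' by (intro exI[of _ C']) auto
qed

text \<open>
  The power \<open>y^p\<close> decreases, so on the cell \<open>[m, m + 1]\<close> it is at least its value at the right endpoint,
  and the cells with \<open>m \<ge> 1\<close> together exhaust the integral over \<open>(1, \<infinity>)\<close>.
\<close>

lemma summable_cell_integrals:
  fixes g :: "real \<Rightarrow> real"
  assumes g: "continuous_on UNIV g" and p: "p \<le> 0"
    and i: "set_integrable lborel {1<..} (\<lambda>y. g y * y powr p)"
  shows "summable (\<lambda>m. integral {real m..real m + 1} (\<lambda>y. \<bar>g y\<bar>) * real (Suc m) powr p)"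
proof -
  let ?I = "\<lambda>m. {real (Suc m)<..real (Suc m) + 1}"
  let ?c = "\<lambda>m. integral {real (Suc m)..real (Suc m) + 1} (\<lambda>y. \<bar>g y\<bar>) * real (Suc (Suc m)) powr p"
  let ?f = "\<lambda>y. \<bar>g y\<bar> * y powr p"
  have fi: "set_integrable lborel A ?f" if "A \<subseteq> {1<..}" "A \<in> sets lborel" for A
  proof -
    have "set_integrable lborel {1<..} ?f" using set_integrable_norm[OF i] by (simp add: abs_mult)
    then show ?thesis by (rule set_integrable_subset) (use that in auto)
  qed
  have cell: "?c m \<le> (LINT y:?I m|lborel. ?f y)" for m
  proof -
    let ?r = "real (Suc m)"
    have gi: "set_integrable lborel {?r..?r+1} (\<lambda>y. \<bar>g y\<bar>)"
      by (intro borel_integrable_atLeastAtMost' continuous_on_rabs continuous_on_subset[OF g]) auto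
    then have gi': "set_integrable lborel {?r<..?r+1} (\<lambda>y. \<bar>g y\<bar>)" by (rule set_integrable_subset) auto
    have "integral {?r..?r+1} (\<lambda>y. \<bar>g y\<bar>) = integral {?r<..?r+1} (\<lambda>y. \<bar>g y\<bar>)"
      by (rule integral_spike_set) (auto intro: negligible_subset[of "{?r}"])
    also have "\<dots> = (LINT y:{?r<..?r+1}|lborel. \<bar>g y\<bar>)"
      using set_borel_integral_eq_integral(2)[OF gi'] by simp
    finally have "integral {?r..?r+1} (\<lambda>y. \<bar>g y\<bar>) * real (Suc (Suc m)) powr p = (LINT y:{?r<..?r+1}|lborel. \<bar>g y\<bar> * real (Suc (Suc m)) powr p)"
      by simp
    also have "\<dots> \<le> (LINT y:{?r<..?r+1}|lborel. ?f y)"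
    proof (rule set_integral_mono)
      show "\<bar>g y\<bar> * real (Suc (Suc m)) powr p \<le> ?f y" if "y \<in> {?r<..?r+1}" for y
        using that p by (intro mult_left_mono powr_mono2') auto
    qed (use gi' in \<open>auto intro!: fi\<close>)
    finally show ?thesis .
  qed
  have sum: "(\<Sum>m<N. LINT y:?I m|lborel. ?f y) = (LINT y:{1<..real (Suc N)}|lborel. ?f y)" for N
  proof (induction N)
    case (Suc N)
    have "{1<..real (Suc (Suc N))} = {1<..real (Suc N)} \<union> {real (Suc N)<..real (Suc N) + 1}" by auto
    then have "(LINT y:{1<..real (Suc (Suc N))}|lborel. ?f y) = (LINT y:{1<..real (Suc N)}|lborel. ?f y) + (LINT y:{real (Suc N)<..real (Suc N) + 1}|lborel. ?f y)"
      by (simp only:) (intro set_integral_Un fi; auto)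
    then show ?case using Suc.IH by simp
  qed (simp add: set_lebesgue_integral_def)
  have "summable (\<lambda>m. ?c m)"
  proof (rule bounded_imp_summable)
    show "?c m \<ge> 0" for m
      by (intro mult_nonneg_nonneg integral_nonneg integrable_continuous_interval continuous_on_rabs continuous_on_subset[OF g]) auto
    show "(\<Sum>m\<le>N. ?c m) \<le> (LINT y:{1<..}|lborel. ?f y)" for N
    proof -
      have "(\<Sum>m\<le>N. ?c m) \<le> (\<Sum>m<Suc N. LINT y:?I m|lborel. ?f y)"
        unfolding lessThan_Suc_atMost by (intro sum_mono cell)
      also have "\<dots> = (LINT y:{1<..real (Suc (Suc N))}|lborel. ?f y)" by (rule sum)
      also have "\<dots> \<le> (LINT y:{1<..}|lborel. ?f y)"
      proof -
        have "set_integrable lborel {1<..real (Suc (Suc N))} ?f" "set_integrable lborel {1<..} ?f"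
          by (intro fi; auto)+
        then show ?thesis unfolding set_lebesgue_integral_def set_integrable_def
          by (intro integral_mono) (auto simp: indicator_def)
      qed
      finally show ?thesis .
    qed
  qed
  then show ?thesis by (subst (asm) summable_Suc_iff)
qed

text \<open>
  A finite seminorm does not bound \<open>u\<close>, but it bounds the oscillation of the top derivative on
  intervals of length \<open>3\<close>. There all derivatives are controlled by the integral of \<open>|d 0|\<close>, and these
  integrals are summable against the weights.
\<close>

lemma one_sided_envelope:
  assumes d: "deriv_chain k d" and h: "holder_bound L \<beta> (d k)" and cont: "continuous_on UNIV (d k)" and b: "0 \<le> \<beta>" "\<beta> \<le> 1"
    and s: "0 < s" "s < 1"
    and int: "set_integrable lborel {1<..} (\<lambda>y. d 0 y * y powr (-1 - 2 * s))"
  shows "\<exists>D. (\<forall>n i z. i \<le> k \<longrightarrow> real n \<le> z \<longrightarrow> z \<le> real n + 3 \<longrightarrow> \<bar>d i z\<bar> \<le> D n) \<and>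
             summable (\<lambda>n. D n * real (Suc n) powr (-1 - 2 * s))"
proof -
  let ?w = "\<lambda>n. real (Suc n) powr (-1 - 2 * s)"
  have L: "L \<ge> 0" by (rule holder_bound_nonneg[OF h])
  have c0: "continuous_on UNIV (d 0)" by (rule deriv_chain_continuous[OF d cont]) simp
  obtain C where C: "C \<ge> 0" "\<And>a M i x. 
     (\<forall>x\<in>{a..a+3}. \<forall>y\<in>{a..a+3}. \<bar>d k x - d k y\<bar> \<le> M) \<Longrightarrow> i \<le> k \<Longrightarrow> x \<in> {a..a+3} \<Longrightarrow>
     \<bar>d i x\<bar> \<le> C * (integral {a..a+3} (\<lambda>y. \<bar>d 0 y\<bar>) + M)"
    using derivatives_le_integral[of k] d c0 by metis
  have osc: "\<bar>d k x - d k y\<bar> \<le> 3 * L" if "x \<in> {a..a+3}" "y \<in> {a..a+3}" for a x y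
  proof -
    have "\<bar>x - y\<bar> powr \<beta> \<le> 3 powr \<beta>" using that b by (intro powr_mono2) auto
    also have "\<dots> \<le> 3 powr 1" using b by (intro powr_mono) auto
    finally have "L * \<bar>x - y\<bar> powr \<beta> \<le> L * 3" using L by (intro mult_left_mono) auto
    with holder_boundD[OF h, of x y] show ?thesis by linarith
  qed
  define E where "E m = integral {real m..real m + 1} (\<lambda>y. \<bar>d 0 y\<bar>)" for m
  define e where "e m = E m * real (Suc m) powr (-1 - 2 * s)" for m
  define D where "D n = C * (E n + E (n + 1) + E (n + 2) + 3 * L)" for n
  have io: "(\<lambda>y. \<bar>d 0 y\<bar>) integrable_on {u..v}" for u v
    by (intro integrable_continuous_interval continuous_on_rabs continuous_on_subset[OF c0]) auto
  have I3: "integral {real n..real n + 3} (\<lambda>y. \<bar>d 0 y\<bar>) = E n + E (n + 1) + E (n + 2)" for n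
  proof -
    have "integral {real n..real n + 3} (\<lambda>y. \<bar>d 0 y\<bar>) = integral {real n..real n + 1} (\<lambda>y. \<bar>d 0 y\<bar>) + integral {real n + 1..real n + 3} (\<lambda>y. \<bar>d 0 y\<bar>)"
      by (rule Henstock_Kurzweil_Integration.integral_combine[symmetric]) (auto intro: io)
    also have "integral {real n + 1..real n + 3} (\<lambda>y. \<bar>d 0 y\<bar>) = integral {real n + 1..real n + 2} (\<lambda>y. \<bar>d 0 y\<bar>) + integral {real n + 2..real n + 3} (\<lambda>y. \<bar>d 0 y\<bar>)"
      by (rule Henstock_Kurzweil_Integration.integral_combine[symmetric]) (auto intro: io)
    finally show ?thesis by (simp add: E_def add_ac)
  qed
  have E0: "E m \<ge> 0" for m unfolding E_def by (intro integral_nonneg io) auto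
  have se: "summable e" unfolding e_def E_def using s by (intro summable_cell_integrals c0 int) auto
  have shift: "E (n + j) * ?w n \<le> 27 * e (n + j)" if "j \<le> 2" for n j
  proof -
    have "?w n = 3 powr (1 + 2 * s) * (3 * real (Suc n)) powr (-1 - 2 * s)"
    proof -
      have "(3 * real (Suc n)) powr (-1 - 2 * s) = 3 powr (-1 - 2 * s) * ?w n"
        by (rule powr_mult)
      moreover have "3 powr (1 + 2 * s) * 3 powr (-1 - 2 * s) = (1::real)" by (simp flip: powr_add)
      ultimately show ?thesis by (simp only: mult.assoc[symmetric])
    qed
    \<comment> \<open>Weights at indices at most two apart differ by a factor of at most \<open>3^(1 + 2 s) \<le> 27\<close>.\<close>
    also have "\<dots> \<le> 3 powr 3 * real (Suc (n + j)) powr (-1 - 2 * s)"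
      using s that by (intro mult_mono powr_mono powr_mono2') auto
    finally have "?w n \<le> 27 * real (Suc (n + j)) powr (-1 - 2 * s)" by simp
    then have "E (n + j) * ?w n \<le> E (n + j) * (27 * real (Suc (n + j)) powr (-1 - 2 * s))"
      using E0 by (intro mult_left_mono) auto
    then show ?thesis by (simp add: e_def)
  qed
  have bd: "\<bar>d i z\<bar> \<le> D n" if "i \<le> k" "real n \<le> z" "z \<le> real n + 3" for n i z
  proof -
    have "\<bar>d i z\<bar> \<le> C * (integral {real n..real n + 3} (\<lambda>y. \<bar>d 0 y\<bar>) + 3 * L)"
      by (rule C(2)) (use osc that in auto)
    then show ?thesis by (simp add: I3 D_def)
  qed
  moreover have "summable (\<lambda>n. D n * ?w n)"
  proof (rule summable_comparison_test')
    have sh: "summable (\<lambda>n. e (n + j))" for j using se by (subst summable_iff_shift)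
    show "summable (\<lambda>n. C * (27 * e (n + 0) + 27 * e (n + 1) + 27 * e (n + 2) + 3 * L * ?w n))"
      using s by (intro summable_mult summable_add sh) (rule summable_powr_Suc, simp)
    show "norm (D n * ?w n) \<le> C * (27 * e (n + 0) + 27 * e (n + 1) + 27 * e (n + 2) + 3 * L * ?w n)" if "n \<ge> 0" for n
    proof -
      have "D n \<ge> 0" unfolding D_def using E0 C L by simp
      then have "norm (D n * ?w n) = D n * ?w n" by simp
      also have "\<dots> = C * (E (n + 0) * ?w n + E (n + 1) * ?w n + E (n + 2) * ?w n + 3 * L * ?w n)"
        by (simp add: D_def algebra_simps)
      also have "\<dots> \<le> C * (27 * e (n + 0) + 27 * e (n + 1) + 27 * e (n + 2) + 3 * L * ?w n)"
        using C(1) L by (intro mult_left_mono add_mono shift) auto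
      finally show ?thesis .
    qed
  qed
  ultimately show ?thesis by blast
qed

text \<open>
  Turns a summable envelope on the cells into an integrable majorant.
\<close>

lemma integrable_step_function:
  fixes T :: "nat \<Rightarrow> real"
  assumes T: "\<And>m. T m \<ge> 0" "summable T"
  defines "G \<equiv> \<lambda>y. \<Sum>m. indicator {real (Suc m)<..real (Suc m) + 1} y * T m"
  shows "integrable lborel G" and "y \<in> {real (Suc m)<..real (Suc m) + 1} \<Longrightarrow> G y = T m"
proof -
  show "integrable lborel G" unfolding G_def
  proof (rule integrable_suminf)
    show "integrable lborel (\<lambda>y. indicator {real (Suc m)<..real (Suc m) + 1} y * T m)" for m
      by (intro integrable_mult_left) (auto intro!: integrable_real_indicator)
    show "AE y in lborel. summable (\<lambda>m. norm (indicator {real (Suc m)<..real (Suc m) + 1} y * T m))"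
      by (intro always_eventually allI summable_comparison_test'[OF T(2)]) (use T(1) in \<open>auto simp: indicator_def\<close>)
    have "(\<integral>y. norm (indicator {real (Suc m)<..real (Suc m) + 1} y * T m) \<partial>lborel) = T m" for m
      using T(1)[of m] by (simp add: abs_mult)
    then show "summable (\<lambda>m. \<integral>y. norm (indicator {real (Suc m)<..real (Suc m) + 1} y * T m) \<partial>lborel)"
      using T(2) by simp
  qed
  show "G y = T m" if y: "y \<in> {real (Suc m)<..real (Suc m) + 1}"
  proof -
    define F where "F m' = indicator {real (Suc m')<..real (Suc m') + 1} y * T m'" for m'
    have "G y = sum F {m}"
      unfolding G_def F_def[symmetric]
    proof (rule suminf_finite)
      fix m' assume m': "m' \<notin> {m}"
      have "y \<notin> {real (Suc m')<..real (Suc m') + 1}"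
      proof
        assume "y \<in> {real (Suc m')<..real (Suc m') + 1}"
        with y have "real m' < real (m + 1)" "real m < real (m' + 1)" by auto
        then have "m' = m" unfolding of_nat_less_iff by simp
        with m' show False by simp
      qed
      then show "F m' = 0" by (simp add: F_def)
    qed simp
    also have "\<dots> = F m" by simp
    also have "\<dots> = T m" unfolding F_def using y by (subst indicator_simps) auto
    finally show ?thesis .
  qed
qed

lemma dom_one_sided_diff:
  assumes u: "u \<in> frac_laplacian_dom s" and \<sigma>: "\<bar>\<sigma>\<bar> = 1" and e: "\<epsilon> > 0"
  shows "set_integrable lborel {\<epsilon><..} (\<lambda>z. (u x - u (x + \<sigma> * z)) * z powr (-1 - 2 * s))"
proof -
  have "set_integrable lborel {y. \<epsilon> < \<bar>x - y\<bar>} (\<lambda>y. (u x - u y) / \<bar>x - y\<bar> powr (1 + 2 * s))"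
    using u e by (auto simp: frac_laplacian_dom_def)
  then have "integrable lborel (\<lambda>z. indicator {y. \<epsilon> < \<bar>x - y\<bar>} (x + \<sigma> * z) *\<^sub>R ((u x - u (x + \<sigma> * z)) / \<bar>x - (x + \<sigma> * z)\<bar> powr (1 + 2 * s)))"
    unfolding set_integrable_def using \<sigma> by (intro lborel_integrable_real_affine) auto
  then have "set_integrable lborel {z. \<epsilon> < \<bar>z\<bar>} (\<lambda>z. (u x - u (x + \<sigma> * z)) / \<bar>z\<bar> powr (1 + 2 * s))"
    unfolding set_integrable_def by (simp add: abs_mult \<sigma> indicator_def)
  then have "set_integrable lborel {\<epsilon><..} (\<lambda>z. (u x - u (x + \<sigma> * z)) / \<bar>z\<bar> powr (1 + 2 * s))"
    by (rule set_integrable_subset) auto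
  also have "?this \<longleftrightarrow> ?thesis"
  proof (rule set_integrable_cong)
    fix z assume "z \<in> {\<epsilon><..}"
    then have z: "z > 0" using e by simp
    have "z powr (-1 - 2 * s) = inverse (z powr (1 + 2 * s))" unfolding powr_minus[symmetric] by simp
    then show "(u x - u (x + \<sigma> * z)) / \<bar>z\<bar> powr (1 + 2 * s) = (u x - u (x + \<sigma> * z)) * z powr (-1 - 2 * s)"
      using z by (simp add: divide_inverse)
  qed auto
  finally show ?thesis .
qed

lemma dom_one_sided:
  assumes u: "u \<in> frac_laplacian_dom s" and s: "0 < s" and \<sigma>: "\<bar>\<sigma>\<bar> = 1"
  shows "set_integrable lborel {1<..} (\<lambda>z. u (x + \<sigma> * z) * z powr (-1 - 2 * s))"
proof -
  have "set_integrable lborel {1<..} (\<lambda>z. u x * z powr (-1 - 2 * s) - (u x - u (x + \<sigma> * z)) * z powr (-1 - 2 * s))"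
    using s by (intro set_integral_diff(1) set_integrable_mult_right set_integrable_powr_inf dom_one_sided_diff u \<sigma>) auto
  then show ?thesis by (simp add: algebra_simps)
qed

lemma deriv_chain_affine:
  assumes "deriv_chain k d"
  shows "deriv_chain k (\<lambda>j z. \<sigma> ^ j * d j (x0 + \<sigma> * z))"
  unfolding deriv_chain_def
proof (intro allI impI)
  fix i x assume i: "i < k"
  have "((\<lambda>z. d i (x0 + \<sigma> * z)) has_real_derivative d (Suc i) (x0 + \<sigma> * x) * \<sigma>) (at x)"
    by (rule DERIV_chain2[OF deriv_chainD[OF assms i]]) (auto intro!: derivative_eq_intros)
  then have "((\<lambda>z. \<sigma> ^ i * d i (x0 + \<sigma> * z)) has_real_derivative \<sigma> ^ i * (d (Suc i) (x0 + \<sigma> * x) * \<sigma>)) (at x)"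
    by (rule DERIV_cmult)
  then show "((\<lambda>z. \<sigma> ^ i * d i (x0 + \<sigma> * z)) has_real_derivative \<sigma> ^ Suc i * d (Suc i) (x0 + \<sigma> * x)) (at x)"
    by (simp add: mult_ac)
qed

text \<open>
  The hypotheses on \<open>u = d 0\<close> in a form that is stable under dilation. The Hoelder bound on \<open>d k\<close>
  leaves polynomial growth possible; integrability at infinity comes from \<^const>\<open>frac_laplacian_dom\<close>.
\<close>

locale holder_chain =
  fixes k :: nat and d :: "nat \<Rightarrow> real \<Rightarrow> real" and L \<beta> s :: real
  assumes d: "deriv_chain k d" and h: "holder_bound L \<beta> (d k)" and cont: "continuous_on UNIV (d k)"
    and b: "0 \<le> \<beta>" "\<beta> \<le> 1" and s: "0 < s" "s < 1" and dom: "d 0 \<in> frac_laplacian_dom s"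

context holder_chain
begin

text \<open>
  The left half-line is reduced to the right one by reflection, which changes derivatives only by signs.
\<close>

lemma two_sided_envelope:
  shows "\<exists>D. (\<forall>n i z. i \<le> k \<longrightarrow> real n \<le> \<bar>z\<bar> \<longrightarrow> \<bar>z\<bar> \<le> real n + 3 \<longrightarrow> \<bar>d i (x0 + z)\<bar> \<le> D n) \<and>
             summable (\<lambda>n. D n * real (Suc n) powr (-1 - 2 * s))"
proof -
  have one: "\<exists>D. (\<forall>n i z. i \<le> k \<longrightarrow> real n \<le> z \<longrightarrow> z \<le> real n + 3 \<longrightarrow> \<bar>d i (x0 + \<sigma> * z)\<bar> \<le> D n) \<and>
             summable (\<lambda>n. D n * real (Suc n) powr (-1 - 2 * s))" if \<sigma>: "\<bar>\<sigma>\<bar> = 1" for \<sigma> :: real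
  proof -
    define e where "e = (\<lambda>j z. \<sigma> ^ j * d j (x0 + \<sigma> * z))"
    have ae: "\<bar>e j z\<bar> = \<bar>d j (x0 + \<sigma> * z)\<bar>" for j z using \<sigma> by (simp add: e_def abs_mult power_abs)
    have "deriv_chain k e" unfolding e_def by (rule deriv_chain_affine[OF d])
    moreover have "holder_bound L \<beta> (e k)" unfolding holder_bound_def
    proof (intro allI)
      fix x y
      have "\<bar>e k x - e k y\<bar> = \<bar>d k (x0 + \<sigma> * x) - d k (x0 + \<sigma> * y)\<bar>"
        using \<sigma> by (simp add: e_def right_diff_distrib[symmetric] abs_mult power_abs)
      also have "\<dots> \<le> L * \<bar>(x0 + \<sigma> * x) - (x0 + \<sigma> * y)\<bar> powr \<beta>" by (rule holder_boundD[OF h])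
      also have "\<bar>(x0 + \<sigma> * x) - (x0 + \<sigma> * y)\<bar> = \<bar>x - y\<bar>" using \<sigma> by (simp add: right_diff_distrib[symmetric] abs_mult)
      finally show "\<bar>e k x - e k y\<bar> \<le> L * \<bar>x - y\<bar> powr \<beta>" .
    qed
    moreover have "continuous_on UNIV (e k)" unfolding e_def
      by (intro continuous_intros continuous_on_compose2[OF cont]) auto
    moreover have "set_integrable lborel {1<..} (\<lambda>y. e 0 y * y powr (-1 - 2 * s))"
      using dom_one_sided[OF dom s(1) \<sigma>] by (simp add: e_def)
    ultimately show ?thesis using one_sided_envelope[of k e L \<beta> s] b s by (simp add: ae)
  qed
  obtain D1 where D1: "\<And>n i z. i \<le> k \<Longrightarrow> real n \<le> z \<Longrightarrow> z \<le> real n + 3 \<Longrightarrow> \<bar>d i (x0 + 1 * z)\<bar> \<le> D1 n"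
    "summable (\<lambda>n. D1 n * real (Suc n) powr (-1 - 2 * s))" using one[of 1] by auto
  obtain D2 where D2: "\<And>n i z. i \<le> k \<Longrightarrow> real n \<le> z \<Longrightarrow> z \<le> real n + 3 \<Longrightarrow> \<bar>d i (x0 + (-1) * z)\<bar> \<le> D2 n"
    "summable (\<lambda>n. D2 n * real (Suc n) powr (-1 - 2 * s))" using one[of "-1"] by auto
  have nn: "D1 n \<ge> 0" "D2 n \<ge> 0" for n
  proof -
    have "\<bar>d 0 (x0 + 1 * real n)\<bar> \<le> D1 n" "\<bar>d 0 (x0 + (-1) * real n)\<bar> \<le> D2 n"
      by (intro D1(1) D2(1); simp)+
    then show "D1 n \<ge> 0" "D2 n \<ge> 0" by linarith+
  qed
  have "\<bar>d i (x0 + z)\<bar> \<le> D1 n + D2 n" if "i \<le> k" "real n \<le> \<bar>z\<bar>" "\<bar>z\<bar> \<le> real n + 3" for n i z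
  proof (cases "z \<ge> 0")
    case True
    then show ?thesis using D1(1)[of i n z] nn[of n] that by simp
  next
    case False
    then show ?thesis using D2(1)[of i n "-z"] nn[of n] that by simp
  qed
  moreover have "summable (\<lambda>n. (D1 n + D2 n) * real (Suc n) powr (-1 - 2 * s))"
    using summable_add[OF D1(2) D2(2)] by (simp add: distrib_right)
  ultimately show ?thesis
    by (intro exI[of _ "\<lambda>n. D1 n + D2 n"] conjI allI impI)
qed

lemma summable_derivative_samples:
  assumes i: "i \<le> k" and \<sigma>: "\<bar>\<sigma>\<bar> = 1"
  shows "summable (\<lambda>n. \<bar>d i (x0 + \<sigma> * real (Suc n))\<bar> * real (Suc n) powr (-1 - 2 * s))"
proof -
  obtain D where D: "\<And>n i z. i \<le> k \<Longrightarrow> real n \<le> \<bar>z\<bar> \<Longrightarrow> \<bar>z\<bar> \<le> real n + 3 \<Longrightarrow> \<bar>d i (x0 + z)\<bar> \<le> D n"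
    "summable (\<lambda>n. D n * real (Suc n) powr (-1 - 2 * s))"
    using two_sided_envelope[of x0] by blast
  show ?thesis
  proof (rule summable_comparison_test'[OF D(2)])
    fix n :: nat
    have "\<bar>d i (x0 + \<sigma> * real (Suc n))\<bar> \<le> D n" by (rule D(1)[OF i]) (auto simp: abs_mult \<sigma>)
    then show "norm (\<bar>d i (x0 + \<sigma> * real (Suc n))\<bar> * real (Suc n) powr (-1 - 2 * s)) \<le> D n * real (Suc n) powr (-1 - 2 * s)"
      by (simp add: abs_mult mult_right_mono)
  qed
qed

text \<open>
  One integrable majorant serves all base points at distance at most \<open>1\<close> from \<open>x0\<close>, since a point at
  distance \<open>y\<close> from such a base point stays in the interval of length \<open>3\<close> around the cell of \<open>y\<close>.
\<close>

lemma far_field_dominator: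
  obtains B G where "\<And>i z. i \<le> k \<Longrightarrow> \<bar>z\<bar> \<le> 3 \<Longrightarrow> \<bar>d i (x0 + z)\<bar> \<le> B"
    and "integrable lborel G" and "\<And>y. 0 \<le> G y"
    and "\<And>i y z. i \<le> k \<Longrightarrow> y > 1 \<Longrightarrow> \<bar>\<bar>z\<bar> - y\<bar> \<le> 1 \<Longrightarrow> (B + \<bar>d i (x0 + z)\<bar>) * y powr (-1 - 2 * s) \<le> G y"
proof -
  obtain D where D: "\<And>n i z. i \<le> k \<Longrightarrow> real n \<le> \<bar>z\<bar> \<Longrightarrow> \<bar>z\<bar> \<le> real n + 3 \<Longrightarrow> \<bar>d i (x0 + z)\<bar> \<le> D n"
    "summable (\<lambda>n. D n * real (Suc n) powr (-1 - 2 * s))"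
    using two_sided_envelope[of x0] by blast
  have D0: "D n \<ge> 0" for n
  proof -
    have "\<bar>d 0 (x0 + real n)\<bar> \<le> D n" by (rule D(1)) simp_all
    then show ?thesis by linarith
  qed
  define T where "T m = (D 0 + D m) * real (Suc m) powr (-1 - 2 * s)" for m
  have T0: "T m \<ge> 0" for m using D0 by (simp add: T_def)
  have sT: "summable T"
  proof -
    have "summable (\<lambda>m. D 0 * real (Suc m) powr (-1 - 2 * s) + D m * real (Suc m) powr (-1 - 2 * s))"
      using s by (intro summable_add summable_mult D(2)) (rule summable_powr_Suc, simp)
    then show ?thesis by (simp add: T_def[abs_def] distrib_right)
  qed
  define G where "G = (\<lambda>y. \<Sum>m. indicator {real (Suc m)<..real (Suc m) + 1} y * T m)"
  have G: "integrable lborel G" "\<And>y m. y \<in> {real (Suc m)<..real (Suc m) + 1} \<Longrightarrow> G y = T m"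
    unfolding G_def using integrable_step_function[OF T0 sT] by auto
  have G0: "G y \<ge> 0" for y unfolding G_def
    by (intro suminf_nonneg summable_comparison_test'[OF sT]) (use T0 in \<open>auto simp: indicator_def\<close>)
  have far: "(D 0 + \<bar>d i (x0 + z)\<bar>) * y powr (-1 - 2 * s) \<le> G y" if i: "i \<le> k" and y: "y > 1" and z: "\<bar>\<bar>z\<bar> - y\<bar> \<le> 1" for i y z
  proof -
    \<comment> \<open>The cell \<open>(m + 1, m + 2]\<close> that contains \<open>y\<close>.\<close>
    define m where "m = nat (\<lceil>y\<rceil> - 2)"
    have "\<lceil>y\<rceil> \<ge> 2" using y by linarith
    then have "real (Suc m) = of_int \<lceil>y\<rceil> - 1" by (simp add: m_def)
    then have m: "y \<in> {real (Suc m)<..real (Suc m) + 1}" using ceiling_correct[of y] by auto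
    have "\<bar>d i (x0 + z)\<bar> \<le> D m" by (rule D(1)[OF i]) (use z m in auto)
    moreover have "y powr (-1 - 2 * s) \<le> real (Suc m) powr (-1 - 2 * s)" using m s by (intro powr_mono2') auto
    ultimately have "(D 0 + \<bar>d i (x0 + z)\<bar>) * y powr (-1 - 2 * s) \<le> T m"
      unfolding T_def using D0 by (intro mult_mono) auto
    then show ?thesis using G(2)[OF m] by simp
  qed
  have B: "\<bar>d i (x0 + z)\<bar> \<le> D 0" if "i \<le> k" "\<bar>z\<bar> \<le> 3" for i z
    by (rule D(1)) (use that in auto)
  show thesis by (rule that[OF B G(1) G0 far])
qed

text \<open>
  The truncated integrals of the derivatives must converge as well, since otherwise the integral in
  the definition of \<^const>\<open>frac_laplacian\<close> would not have its intended value for them.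
\<close>

lemma derivative_in_dom:
  assumes i: "i \<le> k"
  shows "d i \<in> frac_laplacian_dom s"
  unfolding frac_laplacian_dom_def mem_Collect_eq
proof (intro allI impI)
  fix x \<epsilon> :: real assume e: "\<epsilon> > 0"
  obtain B G where B': "\<And>i z. i \<le> k \<Longrightarrow> \<bar>z\<bar> \<le> 3 \<Longrightarrow> \<bar>d i (x + z)\<bar> \<le> B" and G: "integrable lborel G" "\<And>y. 0 \<le> G y"
    and far': "\<And>i y z. i \<le> k \<Longrightarrow> y > 1 \<Longrightarrow> \<bar>\<bar>z\<bar> - y\<bar> \<le> 1 \<Longrightarrow> (B + \<bar>d i (x + z)\<bar>) * y powr (-1 - 2 * s) \<le> G y"
  proof (rule far_field_dominator[of x], goal_cases)
    case (1 B G)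
    show ?case by (rule 1(1)[OF 1(2-5)])
  qed
  note B = B'[OF i] and far = far'[OF i]
  have Bx: "\<bar>d i x\<bar> \<le> B" using B[of 0] by simp
  have [measurable]: "d i \<in> borel_measurable borel"
    by (rule borel_measurable_continuous_onI[OF deriv_chain_continuous[OF d cont i]])
  let ?q = "\<lambda>y. norm (indicator {y. \<epsilon> < \<bar>x - y\<bar>} y *\<^sub>R ((d i x - d i y) / \<bar>x - y\<bar> powr (1 + 2 * s)))"
  let ?bd = "\<lambda>y. G (- x + 1 * y) + G (x + (-1) * y) + indicator {x - 1..x + 1} y * (2 * B * \<epsilon> powr (-1 - 2 * s))"
  have iG: "integrable lborel (\<lambda>y. G (- x + 1 * y))" "integrable lborel (\<lambda>y. G (x + (-1) * y))"
    by (rule lborel_integrable_real_affine[OF G(1)]; simp)+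
  have "integrable lborel ?bd"
    by (intro Bochner_Integration.integrable_add iG integrable_mult_left) (auto intro!: integrable_real_indicator)
  then show "set_integrable lborel {y. \<epsilon> < \<bar>x - y\<bar>} (\<lambda>y. (d i x - d i y) / \<bar>x - y\<bar> powr (1 + 2 * s))"
    unfolding set_integrable_def
  proof (rule Bochner_Integration.integrable_bound)
    show "AE y in lborel. ?q y \<le> norm (?bd y)"
    proof (intro always_eventually allI)
      fix y
      have B0: "B \<ge> 0" using Bx by linarith
      have bd0: "?bd y \<ge> 0" using G(2) B0 by (intro add_nonneg_nonneg mult_nonneg_nonneg) auto
      show "?q y \<le> norm (?bd y)"
      proof (cases "\<epsilon> < \<bar>x - y\<bar>")
        case True
        define r where "r = \<bar>x - y\<bar>"
        have r: "r > \<epsilon>" using True by (simp add: r_def)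
        have "?q y = \<bar>d i x - d i y\<bar> * r powr (-1 - 2 * s)"
          using True r e powr_minus[of r "1 + 2 * s"] by (simp add: r_def[symmetric] divide_inverse abs_mult)
        also have "\<dots> \<le> ?bd y"
        proof (cases "r \<le> 1")
          case True
          have "\<bar>d i (x + (y - x))\<bar> \<le> B" by (rule B) (use True in \<open>auto simp: r_def\<close>)
          then have "\<bar>d i x - d i y\<bar> \<le> 2 * B" using Bx by simp
          moreover have "r powr (-1 - 2 * s) \<le> \<epsilon> powr (-1 - 2 * s)" using r e s by (intro powr_mono2') auto
          ultimately have "\<bar>d i x - d i y\<bar> * r powr (-1 - 2 * s) \<le> 2 * B * \<epsilon> powr (-1 - 2 * s)"
            using B0 by (intro mult_mono) auto
          moreover have "y \<in> {x - 1..x + 1}" using True by (auto simp: r_def)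
          ultimately show ?thesis using G(2)[of "- x + 1 * y"] G(2)[of "x + (-1) * y"] by simp
        next
          case False
          have "\<bar>d i x - d i y\<bar> * r powr (-1 - 2 * s) \<le> (B + \<bar>d i (x + (y - x))\<bar>) * r powr (-1 - 2 * s)"
            using Bx by (intro mult_right_mono) auto
          also have "\<dots> \<le> G r" by (rule far) (use False in \<open>auto simp: r_def\<close>)
          also have "\<dots> \<le> G (- x + 1 * y) + G (x + (-1) * y)"
            using G(2)[of "- x + 1 * y"] G(2)[of "x + (-1) * y"] by (cases "x \<le> y") (auto simp: r_def)
          also have "\<dots> \<le> ?bd y" using B0 by simp
          finally show ?thesis .
        qed
        finally show ?thesis using bd0 by simp
      qed (use bd0 in simp)
    qed
  qed measurable
qed

end

section \<open>The fractional Laplacian as an integral of second differences\<close>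

text \<open>
  Folding the truncated integral at \<open>x\<close> pairs \<open>x + z\<close> with \<open>x - z\<close>. The second difference is integrable
  against the kernel up to zero, so the principal value is a limit of integrals of one integrable
  function over increasing domains.
\<close>

lemma frac_laplacian_eq:
  assumes u: "u \<in> frac_laplacian_dom s" and i: "set_integrable lborel {0<..} (\<lambda>y. sdiff u x y * y powr (-1 - 2 * s))"
  shows "frac_laplacian s u x = frac_const s * (LINT y:{0<..}|lborel. sdiff u x y * y powr (-1 - 2 * s))"
proof -
  let ?f = "\<lambda>y. sdiff u x y * y powr (-1 - 2 * s)"
  let ?F = "\<lambda>y. (u x - u y) / \<bar>x - y\<bar> powr (1 + 2 * s)"
  have trunc: "(LINT y:{y. \<epsilon> < \<bar>x - y\<bar>}|lborel. ?F y) = (LINT y:{\<epsilon><..}|lborel. ?f y)"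
    if e: "\<epsilon> > 0" for \<epsilon>
  proof -
    have F: "set_integrable lborel {y. \<epsilon> < \<bar>x - y\<bar>} ?F" using u e by (auto simp: frac_laplacian_dom_def)
    have sub: "set_integrable lborel A ?F" if "A \<subseteq> {y. \<epsilon> < \<bar>x - y\<bar>}" "A \<in> sets lborel" for A
      using F by (rule set_integrable_subset) (use that in auto)
    have "{y. \<epsilon> < \<bar>x - y\<bar>} = {x + \<epsilon><..} \<union> {..<x - \<epsilon>}" using e by auto
    then have 1: "(LINT y:{y. \<epsilon> < \<bar>x - y\<bar>}|lborel. ?F y) = (LINT y:{x + \<epsilon><..}|lborel. ?F y) + (LINT y:{..<x - \<epsilon>}|lborel. ?F y)"
      using e by (simp only:) (intro set_integral_Un sub; auto)
    have w: "z powr (-1 - 2 * s) = 1 / (z powr (1 + 2 * s))" for z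
      using powr_minus[of z "1 + 2 * s"] by (simp add: inverse_eq_divide)
    have 2: "(LINT y:{x + \<epsilon><..}|lborel. ?F y) = (LINT z:{\<epsilon><..}|lborel. (u x - u (x + 1 * z)) * z powr (-1 - 2 * s))"
      unfolding set_lebesgue_integral_def
      by (subst lborel_integral_real_affine[where c = 1 and t = x]) (use e in \<open>auto intro!: Bochner_Integration.integral_cong simp: indicator_def w\<close>)
    have 3: "(LINT y:{..<x - \<epsilon>}|lborel. ?F y) = (LINT z:{\<epsilon><..}|lborel. (u x - u (x + (-1) * z)) * z powr (-1 - 2 * s))"
      unfolding set_lebesgue_integral_def
      by (subst lborel_integral_real_affine[where c = "-1" and t = x]) (use e in \<open>auto intro!: Bochner_Integration.integral_cong simp: indicator_def w\<close>)
    have "(LINT z:{\<epsilon><..}|lborel. (u x - u (x + 1 * z)) * z powr (-1 - 2 * s) + (u x - u (x + (-1) * z)) * z powr (-1 - 2 * s)) =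
      (LINT z:{\<epsilon><..}|lborel. (u x - u (x + 1 * z)) * z powr (-1 - 2 * s)) + (LINT z:{\<epsilon><..}|lborel. (u x - u (x + (-1) * z)) * z powr (-1 - 2 * s))"
      by (intro set_integral_add(2) dom_one_sided_diff u e) auto
    also have "(LINT z:{\<epsilon><..}|lborel. (u x - u (x + 1 * z)) * z powr (-1 - 2 * s) + (u x - u (x + (-1) * z)) * z powr (-1 - 2 * s))
      = (LINT z:{\<epsilon><..}|lborel. sdiff u x z * z powr (-1 - 2 * s))"
      unfolding set_lebesgue_integral_def by (intro Bochner_Integration.integral_cong) (auto simp: sdiff_def algebra_simps)
    finally show ?thesis using 1 2 3 by simp
  qed
  have "((\<lambda>\<epsilon>. LINT y:{\<epsilon><..}|lborel. ?f y) \<longlongrightarrow> (LINT y:{0<..}|lborel. ?f y)) (at_right 0)"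
  proof (rule tendsto_at_right_sequentially[of 0 1])
    fix S :: "nat \<Rightarrow> real" assume S: "\<And>n. 0 < S n" "decseq S" "S \<longlonglongrightarrow> 0"
    have "(\<lambda>n. LINT y:{S n<..}|lborel. ?f y) \<longlonglongrightarrow> (LINT y:(\<Union>n. {S n<..})|lborel. ?f y)"
    proof (rule set_integral_cont_up)
      show "incseq (\<lambda>n. {S n<..})" using S(2) by (auto simp: incseq_def decseq_def intro: order.strict_trans1)
      show "set_integrable lborel (\<Union>n. {S n<..}) (\<lambda>y. ?f y)"
        using i by (rule set_integrable_subset) (use S(1) in \<open>auto intro: order.strict_trans\<close>)
    qed auto
    also have "(\<Union>n. {S n<..}) = {0<..}"
    proof (intro equalityI subsetI)
      fix y :: real assume "y \<in> {0<..}"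
      then have "eventually (\<lambda>n. S n < y) sequentially" using S(3) by (intro order_tendstoD) auto
      then show "y \<in> (\<Union>n. {S n<..})" by (auto simp: eventually_at_top_linorder)
    qed (use S(1) in \<open>auto intro: order.strict_trans\<close>)
    finally show "(\<lambda>n. LINT y:{S n<..}|lborel. ?f y) \<longlonglongrightarrow> (LINT y:{0<..}|lborel. ?f y)" .
  qed simp
  then have "((\<lambda>\<epsilon>. LINT y:{y. \<epsilon> < \<bar>x - y\<bar>}|lborel. ?F y) \<longlongrightarrow> (LINT y:{0<..}|lborel. ?f y)) (at_right 0)"
    by (rule Lim_transform_eventually) (auto simp: eventually_at_right_field trunc intro!: exI[of _ 1])
  then show ?thesis unfolding frac_laplacian_def by (subst tendsto_Lim) auto
qed

context holder_chain
begin

text \<open>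
  Near \<open>y = 0\<close> the regularity gives a power \<open>y^p\<close> with \<open>p > 2 s\<close>, where two or more derivatives allow
  \<open>p = 2\<close>; for \<open>y > 1\<close> the growth envelope takes over. Uniformity in \<open>x\<close> is what differentiation under
  the integral sign needs.
\<close>

lemma sdiff_dominated:
  assumes i: "i \<le> k"
    and reg: "2 * s < real (k - i) + \<beta>"
  shows "\<exists>g. integrable lborel g \<and> (\<forall>x y. \<bar>x - x0\<bar> \<le> 1 \<longrightarrow> y > 0 \<longrightarrow> \<bar>sdiff (d i) x y * y powr (-1 - 2 * s)\<bar> \<le> g y)"
proof -
  have L: "L \<ge> 0" by (rule holder_bound_nonneg[OF h])
  obtain B G where B: "\<And>i z. i \<le> k \<Longrightarrow> \<bar>z\<bar> \<le> 3 \<Longrightarrow> \<bar>d i (x0 + z)\<bar> \<le> B" and G: "integrable lborel G" "\<And>y. 0 \<le> G y"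
    and far: "\<And>i y z. i \<le> k \<Longrightarrow> y > 1 \<Longrightarrow> \<bar>\<bar>z\<bar> - y\<bar> \<le> 1 \<Longrightarrow> (B + \<bar>d i (x0 + z)\<bar>) * y powr (-1 - 2 * s) \<le> G y"
  proof (rule far_field_dominator[of x0], goal_cases)
    case (1 B G)
    show ?case by (rule 1(1)[OF 1(2-5)])
  qed
  have B0: "B \<ge> 0" using B[of 0 0] by simp
  have near: "\<exists>K p. K \<ge> 0 \<and> 2 * s < p \<and> (\<forall>x y. \<bar>x - x0\<bar> \<le> 1 \<longrightarrow> 0 < y \<longrightarrow> y \<le> 1 \<longrightarrow> \<bar>sdiff (d i) x y\<bar> \<le> K * y powr p)"
  proof -
    consider "k = i" | "k = Suc i" | "Suc (Suc i) \<le> k" using i by linarith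
    then show ?thesis
    proof cases
      case 1
      then show ?thesis using sdiff_profile0[of L \<beta> "d i"] h b reg L
        by (intro exI[of _ "2 * L"] exI[of _ \<beta>]) auto
    next
      case 2
      then show ?thesis using sdiff_profile1(2)[of "d i" "d (Suc i)" L \<beta>] h b reg L deriv_chainD[OF d, of i]
        by (intro exI[of _ "2 * L"] exI[of _ "1 + \<beta>"]) auto
    next
      case 3
      have v: "(d i has_real_derivative d (Suc i) z) (at z)" "(d (Suc i) has_real_derivative d (Suc (Suc i)) z) (at z)" for z
        using 3 by (auto intro!: deriv_chainD[OF d])
      have B2: "\<bar>d (Suc (Suc i)) z\<bar> \<le> B" if "\<bar>z - x0\<bar> \<le> 2" for z
        using B[of "Suc (Suc i)" "z - x0"] 3 that by simp
      have "\<bar>sdiff (d i) x y\<bar> \<le> (2 * B) * y powr 2" if x: "\<bar>x - x0\<bar> \<le> 1" and y: "0 < y" "y \<le> 1" for x y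
      proof -
        have "\<bar>sdiff (d i) x y - sdiff (d i) x 0\<bar> \<le> (B * (2 * y)) * (y - 0)"
        proof (rule increment_le)
          fix t assume t: "0 < t" "t < y"
          have "\<bar>d (Suc i) (x + t) - d (Suc i) (x - t)\<bar> \<le> B * ((x + t) - (x - t))"
            by (rule increment_le[OF _ v(2) B2]) (use t x y in auto)
          also have "\<dots> \<le> B * (2 * y)" using B0 t by (intro mult_left_mono) auto
          finally show "\<bar>d (Suc i) (x - t) - d (Suc i) (x + t)\<bar> \<le> B * (2 * y)" by (simp add: abs_minus_commute)
        qed (use y sdiff_deriv_y[OF v(1)] in auto)
        then show ?thesis using y by (simp add: sdiff_def power2_eq_square mult_ac)
      qed
      then show ?thesis using B0 s by (intro exI[of _ "2 * B"] exI[of _ 2]) auto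
    qed
  qed
  then obtain K p where Kp: "K \<ge> 0" "2 * s < p" "\<And>x y. \<bar>x - x0\<bar> \<le> 1 \<Longrightarrow> 0 < y \<Longrightarrow> y \<le> 1 \<Longrightarrow> \<bar>sdiff (d i) x y\<bar> \<le> K * y powr p" by blast
  define N where "N y = indicator {0<..1} y * (K * y powr (p - 1 - 2 * s))" for y
  have iN: "integrable lborel N"
  proof -
    have "set_integrable lborel {0<..1} (\<lambda>y. K * y powr (p - 1 - 2 * s))"
      using Kp by (intro set_integrable_mult_right set_integrable_powr_0) auto
    then show ?thesis by (simp add: set_integrable_def N_def[abs_def])
  qed
  have "\<bar>sdiff (d i) x y * y powr (-1 - 2 * s)\<bar> \<le> 2 * G y + N y" if x: "\<bar>x - x0\<bar> \<le> 1" and y: "y > 0" for x y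
  proof (cases "y \<le> 1")
    case True
    have "\<bar>sdiff (d i) x y * y powr (-1 - 2 * s)\<bar> \<le> (K * y powr p) * y powr (-1 - 2 * s)"
      unfolding abs_mult using Kp(3)[OF x y True] by (simp add: mult_right_mono)
    also have "\<dots> = N y" using True y by (simp add: N_def powr_add[symmetric] algebra_simps)
    finally show ?thesis using G(2)[of y] by linarith
  next
    case False
    let ?w = "y powr (-1 - 2 * s)"
    have x3: "\<bar>d i (x0 + (x - x0))\<bar> \<le> B" by (rule B[OF i]) (use x in auto)
    have "\<bar>sdiff (d i) x y * ?w\<bar> \<le> ((B + \<bar>d i (x0 + (x + y - x0))\<bar>) + (B + \<bar>d i (x0 + (x - y - x0))\<bar>)) * ?w"
      unfolding abs_mult sdiff_def using x3 by (intro mult_mono) auto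
    also have "\<dots> = (B + \<bar>d i (x0 + (x + y - x0))\<bar>) * ?w + (B + \<bar>d i (x0 + (x - y - x0))\<bar>) * ?w" by (rule distrib_right)
    also have "\<dots> \<le> G y + G y"
      by (intro add_mono far[OF i]) (use x False in auto)
    also have "\<dots> = 2 * G y + N y" using False by (simp add: N_def)
    finally show ?thesis .
  qed
  then show ?thesis using G(1) iN by (intro exI[of _ "\<lambda>y. 2 * G y + N y"]) auto
qed

lemma sdiff_integrable:
  assumes i: "i \<le> k"
    and reg: "2 * s < real (k - i) + \<beta>"
  shows "set_integrable lborel {0<..} (\<lambda>y. sdiff (d i) x y * y powr (-1 - 2 * s))"
proof -
  obtain g where g: "integrable lborel g" "\<And>y. y > 0 \<Longrightarrow> \<bar>sdiff (d i) x y * y powr (-1 - 2 * s)\<bar> \<le> g y"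
    using sdiff_dominated[OF i reg, of x] by auto
  have [measurable]: "d i \<in> borel_measurable borel"
    by (rule borel_measurable_continuous_onI[OF deriv_chain_continuous[OF d cont i]])
  show ?thesis unfolding set_integrable_def
  proof (rule Bochner_Integration.integrable_bound[OF g(1)])
    show "(\<lambda>y. indicat_real {0<..} y *\<^sub>R (sdiff (d i) x y * y powr (-1 - 2 * s))) \<in> borel_measurable lborel"
      unfolding sdiff_def by measurable
    have "norm (indicat_real {0<..} y *\<^sub>R (sdiff (d i) x y * y powr (-1 - 2 * s))) \<le> norm (g y)" for y
      using g(2)[of y] by (cases "y > 0") auto
    then show "AE y in lborel. norm (indicat_real {0<..} y *\<^sub>R (sdiff (d i) x y * y powr (-1 - 2 * s))) \<le> norm (g y)"
      by simp
  qed
qed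

lemma frac_laplacian_derivative_eq:
  assumes "i \<le> k" "2 * s < real (k - i) + \<beta>"
  shows "frac_laplacian s (d i) x = frac_const s * (LINT y:{0<..}|lborel. sdiff (d i) x y * y powr (-1 - 2 * s))"
  using assms by (intro frac_laplacian_eq derivative_in_dom sdiff_integrable)

text \<open>
  Difference quotients of the second difference of \<open>v\<close> are bounded by the majorant of the second
  difference of \<open>v'\<close>, so dominated convergence applies.
\<close>

lemma integral_sdiff_deriv:
  assumes i: "Suc i \<le> k"
    and reg: "2 * s < real (k - Suc i) + \<beta>"
  shows "((\<lambda>x. LINT y:{0<..}|lborel. sdiff (d i) x y * y powr (-1 - 2 * s)) has_real_derivative
           (LINT y:{0<..}|lborel. sdiff (d (Suc i)) x0 y * y powr (-1 - 2 * s))) (at x0)"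
proof -
  let ?w = "\<lambda>y::real. y powr (-1 - 2 * s)"
  define J where "J x = (LINT y:{0<..}|lborel. sdiff (d i) x y * ?w y)" for x
  define S' where "S' = (\<lambda>y. indicator {0<..} y *\<^sub>R (sdiff (d (Suc i)) x0 y * ?w y))"
  have v: "(d i has_real_derivative d (Suc i) z) (at z)" for z using i by (intro deriv_chainD[OF d]) auto
  have reg': "2 * s < real (k - i) + \<beta>" using reg i by (simp add: of_nat_diff)
  have int: "set_integrable lborel {0<..} (\<lambda>y. sdiff (d i) x y * ?w y)" for x
    using i by (intro sdiff_integrable[OF _ reg']) auto
  obtain g where g: "integrable lborel g"
    "\<And>x y. \<bar>x - x0\<bar> \<le> 1 \<Longrightarrow> y > 0 \<Longrightarrow> \<bar>sdiff (d (Suc i)) x y * ?w y\<bar> \<le> g y"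
    using sdiff_dominated[OF i reg, of x0] by blast
  have [measurable]: "d i \<in> borel_measurable borel" "d (Suc i) \<in> borel_measurable borel"
    using i by (auto intro!: borel_measurable_continuous_onI deriv_chain_continuous[OF d cont])
  have lim: "(\<lambda>n. (J (x0 + Y n) - J x0) / Y n) \<longlonglongrightarrow> integral\<^sup>L lborel S'"
    if Y: "Y \<longlonglongrightarrow> 0" "\<And>n. Y n \<noteq> 0" "\<And>n. \<bar>Y n\<bar> \<le> 1" for Y :: "nat \<Rightarrow> real"
  proof -
    let ?i = "\<lambda>n y. sdiff (d i) (x0 + Y n) y * ?w y - sdiff (d i) x0 y * ?w y"
    define Q where "Q n y = indicator {0<..} y *\<^sub>R ((sdiff (d i) (x0 + Y n) y - sdiff (d i) x0 y) / Y n * ?w y)" for n y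
    have "(J (x0 + Y n) - J x0) / Y n = integral\<^sup>L lborel (Q n)" for n
    proof -
      have "J (x0 + Y n) - J x0 = (LINT y:{0<..}|lborel. ?i n y)"
        unfolding J_def by (rule set_integral_diff(2)[OF int int, symmetric])
      then have "(J (x0 + Y n) - J x0) / Y n = (LINT y:{0<..}|lborel. (?i n y) / Y n)"
        by simp
      also have "\<dots> = integral\<^sup>L lborel (Q n)" unfolding set_lebesgue_integral_def Q_def
        by (intro Bochner_Integration.integral_cong) (auto simp: left_diff_distrib diff_divide_distrib)
      finally show ?thesis .
    qed
    moreover have "(\<lambda>n. integral\<^sup>L lborel (Q n)) \<longlonglongrightarrow> integral\<^sup>L lborel S'"
    proof (rule integral_dominated_convergence[where w = "\<lambda>y. norm (g y)"])
      show "S' \<in> borel_measurable lborel" unfolding S'_def sdiff_def by measurable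
      show "Q n \<in> borel_measurable lborel" for n unfolding Q_def[abs_def] sdiff_def by measurable
      show "integrable lborel (\<lambda>y. norm (g y))" using g(1) by simp
      show "AE y in lborel. (\<lambda>n. Q n y) \<longlonglongrightarrow> S' y"
      proof (intro always_eventually allI)
        fix y
        have "((\<lambda>h. (sdiff (d i) (x0 + h) y - sdiff (d i) x0 y) / h) \<longlongrightarrow> sdiff (d (Suc i)) x0 y) (at 0)"
          using sdiff_deriv_x[OF v, of y x0] by (simp add: DERIV_def)
        moreover have "filterlim Y (at 0) sequentially" using Y by (simp add: filterlim_at)
        ultimately have "(\<lambda>n. (sdiff (d i) (x0 + Y n) y - sdiff (d i) x0 y) / Y n) \<longlonglongrightarrow> sdiff (d (Suc i)) x0 y"
          by (rule filterlim_compose)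
        then show "(\<lambda>n. Q n y) \<longlonglongrightarrow> S' y" unfolding Q_def S'_def by (intro tendsto_intros)
      qed
      show "AE y in lborel. norm (Q n y) \<le> norm (g y)" for n
      proof (intro always_eventually allI)
        fix y
        show "norm (Q n y) \<le> norm (g y)"
        proof (cases "y > 0")
          case True
          have DQ: "((\<lambda>x. sdiff (d i) x y * ?w y) has_real_derivative sdiff (d (Suc i)) t y * ?w y) (at t)" for t
            by (intro DERIV_cmult_right sdiff_deriv_x v)
          have "\<bar>?i n y\<bar> \<le> g y * \<bar>Y n\<bar>"
          proof (cases "Y n \<ge> 0")
            case pos: True
            then show ?thesis using increment_le[OF _ DQ g(2)[OF _ True], of x0 "x0 + Y n"] Y(3)[of n] by simp
          next
            case False
            then show ?thesis using increment_le[OF _ DQ g(2)[OF _ True], of "x0 + Y n" x0] Y(3)[of n] by (simp add: abs_minus_commute)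
          qed
          then have "\<bar>?i n y\<bar> / \<bar>Y n\<bar> \<le> g y"
            using Y(2)[of n] by (simp add: divide_le_eq)
          moreover have "norm (Q n y) = \<bar>?i n y\<bar> / \<bar>Y n\<bar>"
            using True by (simp add: Q_def left_diff_distrib[symmetric] abs_mult)
          ultimately show ?thesis by simp
        qed (simp add: Q_def)
      qed
    qed
    ultimately show ?thesis by simp
  qed
  have "((\<lambda>h. (J (x0 + h) - J x0) / h) \<longlongrightarrow> integral\<^sup>L lborel S') (at 0)"
    unfolding tendsto_at_iff_sequentially
  proof (intro allI impI)
    fix X :: "nat \<Rightarrow> real" assume X: "\<forall>n. X n \<in> UNIV - {0}" "X \<longlonglongrightarrow> 0"
    have "eventually (\<lambda>n. \<bar>X n\<bar> < 1) sequentially"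
      using X(2) tendsto_rabs[OF X(2)] by (auto intro!: order_tendstoD(2))
    \<comment> \<open>The majorant covers only \<open>|h| \<le> 1\<close>, so finitely many terms are dropped.\<close>
    then obtain N where N: "\<And>n. n \<ge> N \<Longrightarrow> \<bar>X n\<bar> < 1" by (auto simp: eventually_at_top_linorder)
    have "(\<lambda>n. (J (x0 + X (n + N)) - J x0) / X (n + N)) \<longlonglongrightarrow> integral\<^sup>L lborel S'"
      by (rule lim) (use X N in \<open>auto intro!: LIMSEQ_ignore_initial_segment less_imp_le\<close>)
    then show "((\<lambda>h. (J (x0 + h) - J x0) / h) \<circ> X) \<longlonglongrightarrow> integral\<^sup>L lborel S'"
      unfolding o_def by (rule LIMSEQ_offset)
  qed
  then show ?thesis by (simp add: DERIV_def J_def S'_def set_lebesgue_integral_def)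
qed

lemma higher_deriv_frac_laplacian:
  assumes l: "l \<le> k"
    and reg: "2 * s < real (k - l) + \<beta>"
  shows "(deriv ^^ l) (frac_laplacian s (d 0)) = frac_laplacian s (d l)"
  using l reg
proof (induction l)
  case (Suc l)
  have reg': "2 * s < real (k - l) + \<beta>" using Suc.prems by (simp add: of_nat_diff)
  have "deriv (frac_laplacian s (d l)) x = frac_laplacian s (d (Suc l)) x" for x
  proof (rule DERIV_imp_deriv)
    have "((\<lambda>x. frac_const s * (LINT y:{0<..}|lborel. sdiff (d l) x y * y powr (-1 - 2 * s))) has_real_derivative
       frac_const s * (LINT y:{0<..}|lborel. sdiff (d (Suc l)) x y * y powr (-1 - 2 * s))) (at x)"
      using Suc.prems by (intro DERIV_cmult integral_sdiff_deriv)
    moreover have "frac_laplacian s (d l) = (\<lambda>x. frac_const s * (LINT y:{0<..}|lborel. sdiff (d l) x y * y powr (-1 - 2 * s)))"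
      by (intro ext frac_laplacian_derivative_eq reg') (use Suc.prems in simp)
    moreover have "frac_laplacian s (d (Suc l)) x = frac_const s * (LINT y:{0<..}|lborel. sdiff (d (Suc l)) x y * y powr (-1 - 2 * s))"
      by (intro frac_laplacian_derivative_eq Suc.prems)
    ultimately show "(frac_laplacian s (d l) has_real_derivative frac_laplacian s (d (Suc l)) x) (at x)"
      by simp
  qed
  then show ?case using Suc reg' by auto
qed simp

end

section \<open>The error on the unit mesh\<close>

text \<open>
  A forward difference of a function with \<open>l + 1\<close> derivatives has \<open>l\<close> derivatives, which are the forward
  differences of the given ones; the induction ends with the ordinary mean value theorem.
\<close>

lemma forward_difference_mean_value:
  assumes "deriv_chain l e"
  shows "\<exists>\<xi>. of_int j \<le> \<xi> \<and> \<xi> \<le> of_int j + real l \<and> (D_plus 1 ^^ l) (\<lambda>i. e 0 (of_int i)) j = e l \<xi>"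
  using assms
proof (induction l arbitrary: e)
  case 0
  show ?case by (intro exI[of _ "of_int j"]) simp
next
  case (Suc l)
  define e' where "e' i x = e i (x + 1) - e i x" for i x
  have chain: "deriv_chain l e'"
    unfolding deriv_chain_def
  proof (intro allI impI)
    fix i x assume i: "i < l"
    then have "((\<lambda>x. e i (x + 1)) has_real_derivative e (Suc i) (x + 1) * 1) (at x)"
      by (intro DERIV_chain2[OF deriv_chainD[OF Suc.prems]]) (auto intro!: derivative_eq_intros)
    then show "(e' i has_real_derivative e' (Suc i) x) (at x)"
      unfolding e'_def using deriv_chainD[OF Suc.prems, of i x] i by (auto intro!: derivative_eq_intros)
  qed
  have "D_plus 1 (\<lambda>i. e 0 (of_int i)) = (\<lambda>i. e' 0 (of_int i))"
    by (rule ext) (simp add: D_plus_def e'_def)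
  then have "(D_plus 1 ^^ Suc l) (\<lambda>i. e 0 (of_int i)) j = (D_plus 1 ^^ l) (\<lambda>i. e' 0 (of_int i)) j"
    by (simp only: funpow_Suc_right o_apply)
  with Suc.IH[OF chain] obtain \<xi> where \<xi>: "of_int j \<le> \<xi>" "\<xi> \<le> of_int j + real l"
    "(D_plus 1 ^^ Suc l) (\<lambda>i. e 0 (of_int i)) j = e l (\<xi> + 1) - e l \<xi>" by (auto simp: e'_def)
  obtain z where "\<xi> < z" "z < \<xi> + 1" "e l (\<xi> + 1) - e l \<xi> = (\<xi> + 1 - \<xi>) * e (Suc l) z"
    using MVT2[of \<xi> "\<xi> + 1" "e l" "e (Suc l)"] deriv_chainD[OF Suc.prems] by auto
  with \<xi> show ?case by (intro exI[of _ z]) auto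
qed

lemma D_plus_power_Suc:
  "(D_plus h ^^ Suc l) f j = ((D_plus h ^^ l) f (j + 1) - (D_plus h ^^ l) f j) / h"
  by (simp only: funpow.simps o_apply D_plus_def)

lemma D_plus_power_suminf:
  fixes a :: "nat \<Rightarrow> real" and F :: "nat \<Rightarrow> int \<Rightarrow> real"
  assumes "\<And>j. summable (\<lambda>n. a n * F n j)"
  shows "(\<lambda>n. a n * (D_plus 1 ^^ l) (F n) j) sums (D_plus 1 ^^ l) (\<lambda>j. \<Sum>n. a n * F n j) j"
proof (induction l arbitrary: j)
  case 0
  show ?case using assms[of j] by (simp add: summable_sums)
next
  case (Suc l)
  have "(\<lambda>n. a n * (D_plus 1 ^^ l) (F n) (j + 1) - a n * (D_plus 1 ^^ l) (F n) j) sums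
     ((D_plus 1 ^^ l) (\<lambda>j. \<Sum>n. a n * F n j) (j + 1) - (D_plus 1 ^^ l) (\<lambda>j. \<Sum>n. a n * F n j) j)"
    by (intro sums_diff Suc.IH)
  then show ?case by (simp add: D_plus_power_Suc right_diff_distrib del: funpow.simps)
qed

lemma D_plus_power_scale:
  "(D_plus h ^^ l) (\<lambda>j. c * f j) j = c / h ^ l * (D_plus 1 ^^ l) f j"
proof (induction l arbitrary: j)
  case (Suc l)
  then show ?case by (simp add: D_plus_power_Suc right_diff_distrib diff_divide_distrib mult.commute del: funpow.simps)
qed simp

text \<open>
  The error splits into the cost of replacing \<open>D_+^l (S u)\<close> by \<open>S (u^(l))\<close> in the lattice sum and the
  difference between the sum and the integral for \<open>u^(l)\<close>. In both parts only the \<open>m = k - l\<close> further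
  derivatives of \<open>u^(l)\<close> are used.
\<close>

lemma unit_mesh_error:
  fixes s \<beta> :: real
  assumes s: "0 < s" "s < 1" and b: "0 < \<beta>" "\<beta> \<le> 1" and l: "l \<le> k" "k - l \<le> 2"
    and reg: "2 * s < real (k - l) + \<beta>" "real (k - l) + \<beta> < 1 + 2 * s"
  shows "\<exists>C\<ge>0. \<forall>d L j. holder_chain k d L \<beta> s \<longrightarrow>
     \<bar>(D_plus 1 ^^ l) (frac_discrete_laplacian s 1 (mesh_restrict 1 (d 0))) j - frac_laplacian s (d l) (of_int j)\<bar> \<le> C * L"
proof -
  let ?w = "\<lambda>n. real (Suc n) powr (-1 - 2 * s)"
  define m where "m = k - l"
  have m: "m \<le> 2" "k = l + m" using l by (auto simp: m_def)
  define \<gamma> where "\<gamma> = variation_exp m \<beta>"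
  have \<gamma>: "\<gamma> < 2 * s" using reg s by (auto simp: \<gamma>_def variation_exp_def m_def)
  have \<alpha>: "2 * s < real m + \<beta>" "real m + \<beta> < 1 + 2 * s" using reg by (simp_all add: m_def)
  obtain C where C: "C \<ge> 0" and comparison: "\<forall>L\<ge>0. \<forall>S a. (a = 0 \<or> 1/2 < s) \<longrightarrow>
      profile_bounds L (real m + \<beta>) \<gamma> (\<lambda>y. S y + a * y\<^sup>2) \<longrightarrow>
      summable (\<lambda>n. lap_weight s (Suc n) * S (real (Suc n))) \<longrightarrow>
      set_integrable lborel {0<..} (\<lambda>y. S y * y powr (-1 - 2 * s)) \<longrightarrow>
      \<bar>(\<Sum>n. lap_weight s (Suc n) * S (real (Suc n))) - (LINT y:{0<..}|lborel. S y * y powr (-1 - 2 * s))\<bar> \<le> C * L"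
    using sum_minus_integral_le[OF s \<alpha> \<gamma>] by (elim exE conjE)
  have sZ: "summable (\<lambda>n. lap_weight s (Suc n) * real (Suc n) powr \<gamma>)"
  proof -
    have "summable (\<lambda>n. \<bar>real (Suc n) powr \<gamma>\<bar> * ?w n)"
      using summable_powr_Suc[of "\<gamma> + (-1 - 2 * s)"] \<gamma> by (simp only: powr_add abs_of_nonneg[OF powr_ge_zero])
    from summable_lap_weight_mult[OF s this] show ?thesis by simp
  qed
  define Z where "Z = (\<Sum>n. lap_weight s (Suc n) * real (Suc n) powr \<gamma>)"
  have lw: "lap_weight s (Suc n) > 0" for n using lap_weight_pos[OF s] by simp
  have Z: "Z \<ge> 0" unfolding Z_def using lw by (intro suminf_nonneg sZ mult_nonneg_nonneg less_imp_le) auto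
  define c where "c = \<bar>frac_const s\<bar>"
  define C' where "C' = c * (4 * (1 + real l) * Z + C)"
  have "C' \<ge> 0" using Z C by (simp add: C'_def c_def)
  moreover have "\<bar>(D_plus 1 ^^ l) (frac_discrete_laplacian s 1 (mesh_restrict 1 (d 0))) j - frac_laplacian s (d l) (of_int j)\<bar> \<le> C' * L"
    if "holder_chain k d L \<beta> s" for d L j
  proof -
    interpret H: holder_chain k d L \<beta> s by (rule that)
    have L: "L \<ge> 0" by (rule holder_bound_nonneg[OF H.h])
    let ?x = "real_of_int j"
    let ?S = "\<lambda>i x n. sdiff (d i) x (real (Suc n))" and ?K = "\<lambda>n. lap_weight s (Suc n)"
    let ?D = "\<lambda>n. (D_plus 1 ^^ l) (\<lambda>i. ?S 0 (of_int i) n) j"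
    let ?\<Delta> = "(D_plus 1 ^^ l) (frac_discrete_laplacian s 1 (mesh_restrict 1 (d 0))) j"
    have samples: "summable (\<lambda>n. \<bar>d i (x + \<sigma> * real (Suc n))\<bar> * ?w n)"
      if "i \<le> k" "\<bar>\<sigma>\<bar> = 1" for i x \<sigma>
      by (rule H.summable_derivative_samples[OF that])
    have sS: "summable (\<lambda>n. ?K n * ?S i x n)" if "i \<le> k" for i x
    proof -
      have "summable (\<lambda>n. \<bar>?S i x n\<bar> * ?w n)"
      proof (rule summable_comparison_test')
        show "summable (\<lambda>n. 2 * \<bar>d i x\<bar> * ?w n + \<bar>d i (x + 1 * real (Suc n))\<bar> * ?w n
            + \<bar>d i (x + (-1) * real (Suc n))\<bar> * ?w n)"
          using s that by (intro summable_add summable_mult samples summable_powr_Suc) auto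
        fix n :: nat
        have "\<bar>?S i x n\<bar> \<le> 2 * \<bar>d i x\<bar> + \<bar>d i (x + 1 * real (Suc n))\<bar> + \<bar>d i (x + (-1) * real (Suc n))\<bar>"
        proof -
          have e: "x + 1 * real (Suc n) = x + real (Suc n)" "x + (-1) * real (Suc n) = x - real (Suc n)" by simp_all
          show ?thesis unfolding sdiff_def e by linarith
        qed
        then have "\<bar>?S i x n\<bar> * ?w n \<le> (2 * \<bar>d i x\<bar> + \<bar>d i (x + 1 * real (Suc n))\<bar> + \<bar>d i (x + (-1) * real (Suc n))\<bar>) * ?w n"
          by (intro mult_right_mono) auto
        then show "norm (\<bar>?S i x n\<bar> * ?w n) \<le> 2 * \<bar>d i x\<bar> * ?w n + \<bar>d i (x + 1 * real (Suc n))\<bar> * ?w n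
            + \<bar>d i (x + (-1) * real (Suc n))\<bar> * ?w n"
          by (simp only: distrib_right real_norm_def abs_mult abs_abs abs_of_nonneg[OF powr_ge_zero])
      qed
      then have "summable (\<lambda>n. ?K n * \<bar>?S i x n\<bar>)" by (rule summable_lap_weight_mult[OF s])
      then have "summable (\<lambda>n. norm (?K n * ?S i x n))" by (simp only: real_norm_def abs_mult abs_of_pos[OF lw])
      then show ?thesis by (rule summable_norm_cancel)
    qed
    have disc: "frac_discrete_laplacian s 1 (mesh_restrict 1 (d 0)) = (\<lambda>i. frac_const s * (\<Sum>n. ?K n * ?S 0 (of_int i) n))"
    proof
      fix i
      have e: "x + (-1) * r = x - r" for x r :: real by simp
      have "frac_discrete_laplacian s 1 (mesh_restrict 1 (d 0)) i = frac_const s *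
         (\<Sum>n. ?K n * (2 * mesh_restrict 1 (d 0) i - mesh_restrict 1 (d 0) (i + int (Suc n)) - mesh_restrict 1 (d 0) (i - int (Suc n))))"
        by (rule frac_discrete_laplacian_unit[OF s])
          (use samples[of 0 1 "of_int i"] samples[of 0 "-1" "of_int i", unfolded e] in \<open>simp_all add: mesh_restrict_def\<close>)
      then show "frac_discrete_laplacian s 1 (mesh_restrict 1 (d 0)) i = frac_const s * (\<Sum>n. ?K n * ?S 0 (of_int i) n)"
        by (simp add: mesh_restrict_def sdiff_def)
    qed
    have cont_eq: "frac_laplacian s (d l) ?x = frac_const s * (LINT y:{0<..}|lborel. sdiff (d l) ?x y * y powr (-1 - 2 * s))"
      by (rule H.frac_laplacian_derivative_eq[OF l(1) reg(1)])
    have sD: "(\<lambda>n. ?K n * ?D n) sums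
        (D_plus 1 ^^ l) (\<lambda>i. \<Sum>n. ?K n * ?S 0 (of_int i) n) j"
      by (rule D_plus_power_suminf) (rule sS, simp)
    have chain: "deriv_chain m (\<lambda>i. d (l + i))" using deriv_chain_shift[of m l d] H.d m by (simp add: add.commute)
    have hm: "holder_bound L \<beta> ((\<lambda>i. d (l + i)) m)" using H.h m by simp
    have diff_le: "\<bar>?D n - ?S l ?x n\<bar> \<le> 4 * L * (1 + real l) * real (Suc n) powr \<gamma>" for n
    proof -
      have "deriv_chain l (\<lambda>i x. ?S i x n)"
        unfolding deriv_chain_def using l by (auto intro!: sdiff_deriv_x deriv_chainD[OF H.d])
      from forward_difference_mean_value[OF this, of j] obtain \<xi> where
        \<xi>: "?x \<le> \<xi>" "\<xi> \<le> ?x + real l" "?D n = ?S l \<xi> n" by blast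
      have "\<bar>?S l \<xi> n - ?S l ?x n\<bar> \<le> 4 * L * (1 + \<bar>\<xi> - ?x\<bar>) * real (Suc n) powr \<gamma>"
        using sdiff_shift[OF chain hm H.b m(1), of "real (Suc n)" \<xi> ?x] by (simp add: \<gamma>_def)
      also have "\<dots> \<le> 4 * L * (1 + real l) * real (Suc n) powr \<gamma>"
        using \<xi> L by (intro mult_right_mono mult_left_mono) auto
      finally show ?thesis by (simp only: \<xi>(3))
    qed
    let ?A = "(D_plus 1 ^^ l) (\<lambda>i. \<Sum>n. ?K n * ?S 0 (of_int i) n) j"
    let ?B = "\<Sum>n. ?K n * ?S l ?x n"
    let ?I = "LINT y:{0<..}|lborel. sdiff (d l) ?x y * y powr (-1 - 2 * s)"
    have AB: "\<bar>?A - ?B\<bar> \<le> 4 * L * (1 + real l) * Z"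
    proof -
      have up: "(\<lambda>n. ?K n * ?D n - ?K n * ?S l ?x n) sums (?A - ?B)"
        by (intro sums_diff sD summable_sums sS l)
      have bd: "\<bar>?K n * ?D n - ?K n * ?S l ?x n\<bar>
          \<le> 4 * L * (1 + real l) * (?K n * real (Suc n) powr \<gamma>)" for n
      proof -
        have "\<bar>?K n * ?D n - ?K n * ?S l ?x n\<bar>
          = ?K n * \<bar>?D n - ?S l ?x n\<bar>"
          by (simp only: right_diff_distrib[symmetric] abs_mult abs_of_pos[OF lw])
        also have "\<dots> \<le> ?K n * (4 * L * (1 + real l) * real (Suc n) powr \<gamma>)"
          by (intro mult_left_mono diff_le less_imp_le[OF lw])
        also have "\<dots> = 4 * L * (1 + real l) * (?K n * real (Suc n) powr \<gamma>)" by (rule mult.left_commute)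
        finally show ?thesis .
      qed
      have sb: "(\<lambda>n. 4 * L * (1 + real l) * (?K n * real (Suc n) powr \<gamma>)) sums (4 * L * (1 + real l) * Z)"
        unfolding Z_def by (intro sums_mult summable_sums sZ)
      have "?A - ?B \<le> 4 * L * (1 + real l) * Z"
        by (rule sums_le[OF _ up sb]) (use bd abs_le_D1 in blast)
      moreover have "- (?A - ?B) \<le> 4 * L * (1 + real l) * Z"
        by (rule sums_le[OF _ sums_minus[OF up] sb]) (use bd abs_le_D2 in blast)
      ultimately show ?thesis by (rule abs_leI)
    qed
    have BI: "\<bar>?B - ?I\<bar> \<le> C * L"
    proof -
      obtain a where a: "m < 2 \<longrightarrow> a = 0"
        "profile_bounds L (real m + \<beta>) (variation_exp m \<beta>) (\<lambda>y. sdiff (d (l + 0)) ?x y + a * y\<^sup>2)"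
        using sdiff_profile[OF chain hm H.b m(1), of ?x] by blast
      \<comment> \<open>Two derivatives are used only if \<open>2 + \<beta> < 1 + 2 s\<close>, which forces \<open>s > 1/2\<close>.\<close>
      have "a = 0 \<or> 1/2 < s"
      proof (cases "m < 2")
        case False
        then have "m = 2" using m by simp
        then show ?thesis using \<alpha>(2) b by simp
      qed (use a(1) in simp)
      then show ?thesis
        using comparison[THEN spec, THEN mp, OF L, THEN spec, THEN spec, of a "sdiff (d l) ?x"] a(2)
          sS[OF l(1), of ?x] H.sdiff_integrable[OF l(1) reg(1), of ?x]
        by (simp only: add_0_right \<gamma>_def[symmetric] simp_thms)
    qed
    have "?\<Delta> = frac_const s * ?A"
      unfolding disc using D_plus_power_scale[where h = 1 and l = l and c = "frac_const s"] by (simp del: of_nat_Suc)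
    then have "\<bar>?\<Delta> - frac_laplacian s (d l) ?x\<bar> = c * \<bar>?A - ?I\<bar>"
      by (simp only: cont_eq right_diff_distrib[symmetric] abs_mult c_def)
    also have "\<dots> \<le> c * (4 * L * (1 + real l) * Z + C * L)"
      using AB BI by (intro mult_left_mono) (auto simp: c_def)
    also have "\<dots> = C' * L" by (simp add: C'_def algebra_simps)
    finally show ?thesis .
  qed
  ultimately show ?thesis by blast
qed

section \<open>Dilation to an arbitrary mesh\<close>

lemma set_integral_dilation:
  fixes F :: "real \<Rightarrow> real"
  assumes h: "h > 0"
  shows "(LINT t:{0<..}|lborel. F (h * t) * t powr q) = h powr (- q - 1) * (LINT t:{0<..}|lborel. F t * t powr q)"
proof -
  have "(LINT t:{0<..}|lborel. F t * t powr q) = \<bar>h\<bar> *\<^sub>R (\<integral>t. indicator {0<..} (0 + h * t) *\<^sub>R (F (0 + h * t) * (0 + h * t) powr q) \<partial>lborel)"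
    unfolding set_lebesgue_integral_def using h by (intro lborel_integral_real_affine) auto
  also have "(\<integral>t. indicator {0<..} (0 + h * t) *\<^sub>R (F (0 + h * t) * (0 + h * t) powr q) \<partial>lborel)
      = (\<integral>t. h powr q * (indicator {0<..} t *\<^sub>R (F (h * t) * t powr q)) \<partial>lborel)"
    using h by (intro Bochner_Integration.integral_cong) (auto simp: indicator_def powr_mult zero_less_mult_iff)
  also have "\<dots> = h powr q * (LINT t:{0<..}|lborel. F (h * t) * t powr q)"
    unfolding set_lebesgue_integral_def by simp
  finally have "(LINT t:{0<..}|lborel. F t * t powr q) = (h powr 1 * h powr q) * (LINT t:{0<..}|lborel. F (h * t) * t powr q)"
    using h by simp
  then have "h powr (- q - 1) * (LINT t:{0<..}|lborel. F t * t powr q) = (h powr (- q - 1) * (h powr 1 * h powr q)) * (LINT t:{0<..}|lborel. F (h * t) * t powr q)"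
    by (simp only: mult.assoc)
  also have "h powr (- q - 1) * (h powr 1 * h powr q) = 1" using h unfolding powr_add[symmetric] by simp
  finally show ?thesis by simp
qed

lemma frac_discrete_laplacian_dilation:
  assumes h: "h > 0"
  shows "frac_discrete_laplacian s h v j = h powr (- 2 * s) * frac_discrete_laplacian s 1 v j"
proof -
  have eq: "(X / t powr (1 + s)) = X * t powr (- 1 - s)" for X t :: real
    using powr_minus[of t "1 + s"] by (simp add: divide_inverse)
  let ?F = "\<lambda>t. discrete_heat 1 t v j - v j"
  have "discrete_heat h t v j = discrete_heat 1 (1 / h\<^sup>2 * t) v j" for t
    by (simp add: discrete_heat_def)
  then have "(LINT t:{0<..}|lborel. (discrete_heat h t v j - v j) * t powr (- 1 - s)) = (LINT t:{0<..}|lborel. ?F (1 / h\<^sup>2 * t) * t powr (- 1 - s))"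
    by (simp only:)
  also have "\<dots> = (1 / h\<^sup>2) powr (- (- 1 - s) - 1) * (LINT t:{0<..}|lborel. ?F t * t powr (- 1 - s))"
    using h by (intro set_integral_dilation[where F = ?F]) auto
  also have "(1 / h\<^sup>2) powr (- (- 1 - s) - 1) = h powr (- 2 * s)"
  proof -
    have "1 / h\<^sup>2 = h powr (- 2)" using h by (simp add: powr_minus divide_inverse)
    then show ?thesis by (simp only: powr_powr) simp
  qed
  finally show ?thesis unfolding frac_discrete_laplacian_def eq by simp
qed

lemma dom_dilation:
  assumes u: "u \<in> frac_laplacian_dom s" and h: "h > 0"
  shows "(\<lambda>y. u (h * y)) \<in> frac_laplacian_dom s"
  unfolding frac_laplacian_dom_def mem_Collect_eq
proof (intro allI impI)
  fix x \<epsilon> :: real assume e: "\<epsilon> > 0"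
  let ?q = "\<lambda>y. indicator {y. h * \<epsilon> < \<bar>h * x - y\<bar>} (0 + h * y) *\<^sub>R ((u (h * x) - u (0 + h * y)) / \<bar>h * x - (0 + h * y)\<bar> powr (1 + 2 * s))"
  have "set_integrable lborel {y. h * \<epsilon> < \<bar>h * x - y\<bar>} (\<lambda>y. (u (h * x) - u y) / \<bar>h * x - y\<bar> powr (1 + 2 * s))"
    using u e h by (auto simp: frac_laplacian_dom_def)
  then have "integrable lborel (\<lambda>y. ?q y)"
    unfolding set_integrable_def using h by (intro lborel_integrable_real_affine) auto
  then have "integrable lborel (\<lambda>y. h powr (1 + 2 * s) * (?q y))"
    by (rule integrable_mult_right)
  also have "(\<lambda>y. h powr (1 + 2 * s) * (?q y))
     = (\<lambda>y. indicator {y. \<epsilon> < \<bar>x - y\<bar>} y *\<^sub>R ((u (h * x) - u (h * y)) / \<bar>x - y\<bar> powr (1 + 2 * s)))"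
  proof
    fix y
    have "\<bar>h * x - h * y\<bar> = h * \<bar>x - y\<bar>" using h by (simp add: right_diff_distrib[symmetric] abs_mult)
    then show "h powr (1 + 2 * s) * (?q y)
      = indicator {y. \<epsilon> < \<bar>x - y\<bar>} y *\<^sub>R ((u (h * x) - u (h * y)) / \<bar>x - y\<bar> powr (1 + 2 * s))"
      using h by (simp add: indicator_def powr_mult)
  qed
  finally show "set_integrable lborel {y. \<epsilon> < \<bar>x - y\<bar>} (\<lambda>y. (u (h * x) - u (h * y)) / \<bar>x - y\<bar> powr (1 + 2 * s))"
    by (simp add: set_integrable_def)
qed

text \<open>
  The function \<open>y \<mapsto> u (h y)\<close> has the same samples on the unit mesh as \<open>u\<close> on the mesh of size \<open>h\<close>. Its
  seminorm is \<open>h^(k + \<beta>)\<close> times that of \<open>u\<close>, while both sides of the comparison scale by \<open>h^(2 s + l)\<close>.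
\<close>

lemma mesh_error:
  fixes s \<beta> :: real
  assumes s: "0 < s" "s < 1" and b: "0 < \<beta>" "\<beta> \<le> 1" and l: "l \<le> k" "k - l \<le> 2"
    and reg: "2 * s < real (k - l) + \<beta>" "real (k - l) + \<beta> < 1 + 2 * s"
  shows "\<exists>C. \<forall>h>0. \<forall>d L j. holder_chain k d L \<beta> s \<longrightarrow>
     \<bar>(D_plus h ^^ l) (frac_discrete_laplacian s h (mesh_restrict h (d 0))) j - (deriv ^^ l) (frac_laplacian s (d 0)) (h * of_int j)\<bar>
       \<le> C * L * h powr (\<beta> - 2 * s + real k - real l)"
proof -
  obtain C where C: "\<forall>d L j. holder_chain k d L \<beta> s \<longrightarrow>
     \<bar>(D_plus 1 ^^ l) (frac_discrete_laplacian s 1 (mesh_restrict 1 (d 0))) j - frac_laplacian s (d l) (of_int j)\<bar> \<le> C * L"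
    using unit_mesh_error[OF s b l reg] by (elim exE conjE)
  have "\<bar>(D_plus h ^^ l) (frac_discrete_laplacian s h (mesh_restrict h (d 0))) j - (deriv ^^ l) (frac_laplacian s (d 0)) (h * of_int j)\<bar>
       \<le> C * L * h powr (\<beta> - 2 * s + real k - real l)"
    if h: "h > 0" and "holder_chain k d L \<beta> s" for h d L j
  proof -
    interpret H: holder_chain k d L \<beta> s by (rule that(2))
    define e where "e = (\<lambda>i y. h ^ i * d i (0 + h * y))"
    define M where "M = L * h ^ k * h powr \<beta>"
    let ?\<Delta> = "(D_plus 1 ^^ l) (frac_discrete_laplacian s 1 (mesh_restrict 1 (e 0))) j"
    have e_chain: "deriv_chain k e" unfolding e_def by (rule deriv_chain_affine[OF H.d])
    have e_holder: "holder_bound M \<beta> (e k)" unfolding holder_bound_def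
    proof (intro allI)
      fix x y
      have "\<bar>e k x - e k y\<bar> = h ^ k * \<bar>d k (h * x) - d k (h * y)\<bar>"
        using h by (simp add: e_def right_diff_distrib[symmetric] abs_mult)
      also have "\<dots> \<le> h ^ k * (L * \<bar>h * x - h * y\<bar> powr \<beta>)"
        using h by (intro mult_left_mono holder_boundD[OF H.h]) auto
      also have "\<bar>h * x - h * y\<bar> powr \<beta> = h powr \<beta> * \<bar>x - y\<bar> powr \<beta>"
        using h by (simp add: right_diff_distrib[symmetric] abs_mult powr_mult)
      finally show "\<bar>e k x - e k y\<bar> \<le> M * \<bar>x - y\<bar> powr \<beta>" by (simp add: M_def mult_ac)
    qed
    have e_cont: "continuous_on UNIV (e k)" unfolding e_def
      by (intro continuous_intros continuous_on_compose2[OF H.cont]) auto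
    have e_dom: "e 0 \<in> frac_laplacian_dom s" using dom_dilation[OF H.dom h] by (simp add: e_def)
    interpret E: holder_chain k e M \<beta> s
      by (intro holder_chain.intro e_chain e_holder e_cont H.b s e_dom)
    have main: "\<bar>?\<Delta> - frac_laplacian s (e l) (of_int j)\<bar> \<le> C * M"
      using C E.holder_chain_axioms by blast
    have "mesh_restrict 1 (e 0) = mesh_restrict h (d 0)" by (rule ext) (simp add: mesh_restrict_def e_def)
    moreover have "frac_discrete_laplacian s h v = (\<lambda>j. h powr (- 2 * s) * frac_discrete_laplacian s 1 v j)" for v
      by (rule ext) (rule frac_discrete_laplacian_dilation[OF h])
    ultimately have disc: "(D_plus h ^^ l) (frac_discrete_laplacian s h (mesh_restrict h (d 0))) j
       = h powr (- 2 * s) / h ^ l * ?\<Delta>"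
      by (simp only: D_plus_power_scale)
    have "frac_laplacian s (e l) (of_int j) = frac_const s * (LINT y:{0<..}|lborel. sdiff (e l) (of_int j) y * y powr (-1 - 2 * s))"
      by (rule E.frac_laplacian_derivative_eq[OF l(1) reg(1)])
    also have "(LINT y:{0<..}|lborel. sdiff (e l) (of_int j) y * y powr (-1 - 2 * s))
       = (LINT y:{0<..}|lborel. (h ^ l * sdiff (d l) (h * of_int j) (h * y)) * y powr (-1 - 2 * s))"
      by (simp add: sdiff_def e_def algebra_simps)
    also have "\<dots> = h powr (- (-1 - 2 * s) - 1) * (LINT y:{0<..}|lborel. (h ^ l * sdiff (d l) (h * of_int j) y) * y powr (-1 - 2 * s))"
      by (rule set_integral_dilation[OF h, where F = "\<lambda>y. h ^ l * sdiff (d l) (h * of_int j) y"])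
    also have "\<dots> = h powr (2 * s) * h ^ l * (LINT y:{0<..}|lborel. sdiff (d l) (h * of_int j) y * y powr (-1 - 2 * s))"
      by (simp add: mult.assoc)
    finally have "frac_laplacian s (e l) (of_int j) = h powr (2 * s) * h ^ l * frac_laplacian s (d l) (h * of_int j)"
      by (simp add: H.frac_laplacian_derivative_eq[OF l(1) reg(1)] mult_ac)
    moreover have "(deriv ^^ l) (frac_laplacian s (d 0)) = frac_laplacian s (d l)"
      by (rule H.higher_deriv_frac_laplacian[OF l(1) reg(1)])
    moreover have "h powr (- 2 * s) * h powr (2 * s) = 1" using h by (simp flip: powr_add)
    ultimately have lap: "(deriv ^^ l) (frac_laplacian s (d 0)) (h * of_int j) = h powr (- 2 * s) / h ^ l * frac_laplacian s (e l) (of_int j)"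
      using h by (simp add: field_simps)
    have "\<bar>(D_plus h ^^ l) (frac_discrete_laplacian s h (mesh_restrict h (d 0))) j - (deriv ^^ l) (frac_laplacian s (d 0)) (h * of_int j)\<bar>
      = h powr (- 2 * s) / h ^ l * \<bar>?\<Delta> - frac_laplacian s (e l) (of_int j)\<bar>"
      unfolding disc lap right_diff_distrib[symmetric] abs_mult using h by simp
    also have "\<dots> \<le> h powr (- 2 * s) / h ^ l * (C * M)" using h by (intro mult_left_mono main) auto
    also have "\<dots> = C * L * (h powr (- 2 * s) * h powr (- real l) * h powr real k * h powr \<beta>)"
      using h by (simp add: M_def powr_minus powr_realpow divide_inverse mult_ac)
    also have "h powr (- 2 * s) * h powr (- real l) * h powr real k * h powr \<beta> = h powr (\<beta> - 2 * s + real k - real l)"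
      by (simp add: powr_add[symmetric] algebra_simps)
    finally show ?thesis .
  qed
  then show ?thesis by blast
qed

text \<open>
  Translates the extended-real seminorm into a real Hoelder constant that equals it.
\<close>

lemma holder_space_deriv_chain:
  assumes "u \<in> holder_space k \<beta>"
  obtains L where "L \<ge> 0" "holder_seminorm k \<beta> u = ereal L" "holder_bound L \<beta> ((deriv ^^ k) u)"
    "deriv_chain k (\<lambda>i. (deriv ^^ i) u)" "continuous_on UNIV ((deriv ^^ k) u)"
proof -
  have Ck: "C_k k u" and fin: "holder_seminorm k \<beta> u < \<infinity>" using assms by (auto simp: holder_space_def)
  let ?q = "\<lambda>x y. \<bar>(deriv ^^ k) u x - (deriv ^^ k) u y\<bar> / \<bar>x - y\<bar> powr \<beta>"
  have up: "ereal (?q x y) \<le> holder_seminorm k \<beta> u" if "x \<noteq> y" for x y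
    unfolding holder_seminorm_def by (rule SUP_upper2[of "(x, y)"]) (use that in auto)
  have "0 \<le> ereal (?q 0 1)" by simp
  also have "\<dots> \<le> holder_seminorm k \<beta> u" by (rule up) simp
  finally have nn: "0 \<le> holder_seminorm k \<beta> u" .
  with fin obtain L where L: "holder_seminorm k \<beta> u = ereal L" "L \<ge> 0" by (cases "holder_seminorm k \<beta> u") auto
  have "holder_bound L \<beta> ((deriv ^^ k) u)" unfolding holder_bound_def
  proof (intro allI)
    fix x y
    show "\<bar>(deriv ^^ k) u x - (deriv ^^ k) u y\<bar> \<le> L * \<bar>x - y\<bar> powr \<beta>"
    proof (cases "x = y")
      case False
      then have "?q x y \<le> L" using up[OF False] L by simp
      then show ?thesis using False by (simp add: divide_le_eq)
    qed simp
  qed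
  moreover have "deriv_chain k (\<lambda>i. (deriv ^^ i) u)"
    using Ck by (auto simp: deriv_chain_def C_k_def DERIV_deriv_iff_real_differentiable)
  moreover have "continuous_on UNIV ((deriv ^^ k) u)" using Ck by (simp add: C_k_def)
  ultimately show thesis using that L by blast
qed

lemma mesh_error_linf:
  fixes s \<beta> :: real
  assumes s: "0 < s" "s < 1" and b: "0 < \<beta>" "\<beta> \<le> 1" and l: "l \<le> k" "k - l \<le> 2"
    and reg: "2 * s < real (k - l) + \<beta>" "real (k - l) + \<beta> < 1 + 2 * s"
  shows "\<exists>C::real. \<forall>h>0. \<forall>u \<in> holder_space k \<beta> \<inter> frac_laplacian_dom s.
          linf_norm (\<lambda>j. (D_plus h ^^ l) (frac_discrete_laplacian s h (mesh_restrict h u)) j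
                         - mesh_restrict h ((deriv ^^ l) (frac_laplacian s u)) j)
          \<le> ereal C * holder_seminorm k \<beta> u
             * ereal (h powr (\<beta> - 2 * s + real k - real l))"
proof -
  obtain C where C: "\<forall>h>0. \<forall>d L j. holder_chain k d L \<beta> s \<longrightarrow>
     \<bar>(D_plus h ^^ l) (frac_discrete_laplacian s h (mesh_restrict h (d 0))) j - (deriv ^^ l) (frac_laplacian s (d 0)) (h * of_int j)\<bar>
       \<le> C * L * h powr (\<beta> - 2 * s + real k - real l)"
    using mesh_error[OF s b l reg] by (elim exE)
  show ?thesis
  proof (intro exI[of _ C] allI impI ballI)
    fix h :: real and u assume h: "0 < h" and u: "u \<in> holder_space k \<beta> \<inter> frac_laplacian_dom s"
    then obtain L where L: "holder_seminorm k \<beta> u = ereal L" "holder_bound L \<beta> ((deriv ^^ k) u)"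
      "deriv_chain k (\<lambda>i. (deriv ^^ i) u)" "continuous_on UNIV ((deriv ^^ k) u)"
      by (auto elim: holder_space_deriv_chain)
    have "\<bar>(D_plus h ^^ l) (frac_discrete_laplacian s h (mesh_restrict h u)) j - mesh_restrict h ((deriv ^^ l) (frac_laplacian s u)) j\<bar>
       \<le> C * L * h powr (\<beta> - 2 * s + real k - real l)" for j
      using C[rule_format, OF h, of "\<lambda>i. (deriv ^^ i) u" L j] L u b s
      by (simp add: mesh_restrict_def holder_chain_def)
    then show "linf_norm (\<lambda>j. (D_plus h ^^ l) (frac_discrete_laplacian s h (mesh_restrict h u)) j
                         - mesh_restrict h ((deriv ^^ l) (frac_laplacian s u)) j)
          \<le> ereal C * holder_seminorm k \<beta> u * ereal (h powr (\<beta> - 2 * s + real k - real l))"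
      unfolding linf_norm_def L(1) by (intro SUP_least) simp
  qed
qed

theorem theorem1p1:
  fixes \<beta> s :: real
  assumes "0 < \<beta>" and "\<beta> \<le> 1" and "0 < s" and "s < 1"
  shows
    "(2 * s < \<beta> \<longrightarrow>
       (\<exists>C::real. \<forall>h>0. \<forall>u \<in> holder_space 0 \<beta> \<inter> frac_laplacian_dom s.
          linf_norm (\<lambda>j. frac_discrete_laplacian s h (mesh_restrict h u) j
                         - mesh_restrict h (frac_laplacian s u) j)
          \<le> ereal C * holder_seminorm 0 \<beta> u * ereal (h powr (\<beta> - 2 * s))))
     \<and>
     (2 * s < \<beta> \<longrightarrow>
       (\<exists>C::real. \<forall>h>0. \<forall>u \<in> holder_space 1 \<beta> \<inter> frac_laplacian_dom s.
          linf_norm (\<lambda>j. D_plus h (frac_discrete_laplacian s h (mesh_restrict h u)) j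
                         - mesh_restrict h (deriv (frac_laplacian s u)) j)
          \<le> ereal C * holder_seminorm 1 \<beta> u * ereal (h powr (\<beta> - 2 * s))))
     \<and>
     (\<beta> < 2 * s \<and> 2 * s < 1 + \<beta> \<longrightarrow>
       (\<exists>C::real. \<forall>h>0. \<forall>u \<in> holder_space 1 \<beta> \<inter> frac_laplacian_dom s.
          linf_norm (\<lambda>j. frac_discrete_laplacian s h (mesh_restrict h u) j
                         - mesh_restrict h (frac_laplacian s u) j)
          \<le> ereal C * holder_seminorm 1 \<beta> u * ereal (h powr (\<beta> - 2 * s + 1))))
     \<and>
     (\<forall>k l :: nat. real k + \<beta> - 2 * s \<notin> \<int> \<and> 2 * s < real k + \<beta> \<and>
         int l = \<lfloor>real k + \<beta> - 2 * s\<rfloor> \<longrightarrow>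
       (\<exists>C::real. \<forall>h>0. \<forall>u \<in> holder_space k \<beta> \<inter> frac_laplacian_dom s.
          linf_norm (\<lambda>j. (D_plus h ^^ l) (frac_discrete_laplacian s h (mesh_restrict h u)) j
                         - mesh_restrict h ((deriv ^^ l) (frac_laplacian s u)) j)
          \<le> ereal C * holder_seminorm k \<beta> u
             * ereal (h powr (\<beta> - 2 * s + real k - real l))))"
proof (intro conjI impI allI, goal_cases)
  case 1
  show ?case using mesh_error_linf[OF assms(3,4,1,2), of 0 0] 1 assms by simp
next
  case 2
  show ?case using mesh_error_linf[OF assms(3,4,1,2), of 1 1] 2 assms by simp
next
  case 3
  show ?case using mesh_error_linf[OF assms(3,4,1,2), of 0 1] 3 assms by simp
next
  case (4 k l)
  then have fl: "real k + \<beta> - 2 * s \<notin> \<int>" "int l = \<lfloor>real k + \<beta> - 2 * s\<rfloor>" by auto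
  have le: "real l \<le> real k + \<beta> - 2 * s" "real k + \<beta> - 2 * s < real l + 1"
    using floor_correct[of "real k + \<beta> - 2 * s"] fl(2)[symmetric] by simp_all
  have ne: "real l \<noteq> real k + \<beta> - 2 * s" using fl(1) by (metis Ints_of_nat)
  \<comment> \<open>Here \<open>2 s > 0\<close> and \<open>\<beta> \<le> 1\<close> give the first bound, \<open>2 s < 2\<close> and \<open>\<beta> > 0\<close> the second.\<close>
  have "real l < real (k + 1)" "real k < real (l + 3)" using le assms by simp_all
  then have lk: "l \<le> k" "k - l \<le> 2" unfolding of_nat_less_iff by auto
  show ?case
    by (rule mesh_error_linf[OF assms(3,4,1,2) lk]) (use le ne lk in \<open>auto simp: of_nat_diff\<close>)
qed

end
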